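(* (Generalization of the NSVW formula.) Let $N\ge1$, $I=N+1$, $J=N+2$, and let $\mathcal A_{\rm MHV}$ be the tree-level amplitude for $N$ positive helicity gravitons $1,\dots,N$ and two negative helicity gravitons $I,J$, given by the MHV generating function in the context. Write $\mathcal A_{\rm MHV}=\mathrm i(2\pi)^4\delta^{(4)}\big(\sum_{i=1}^{N+2}p_i\big)\,\mathcal M_{\rm MHV}$. Let $\iota^A=(0,1)$ and $o^A=(0,1)$, so that $\langle\iota i\rangle=\langle o i\rangle=1$ for all $i\in\{1,\dots,N+2\}$. Then $$\mathcal M_{\rm MHV}=-\frac{\langle IJ\rangle^4\langle I\iota\rangle\langle Io\rangle\langle J\iota\rangle\langle Jo\rangle}{[\xi I][\chi J]}\left(\sum_{\mathbf t}K(\mathbf t)\prod_{\{i,j\}\in\text{edges}(\mathbf t)}\frac{[ij]}{\langle ij\rangle}\ \prod_{a=1}^{N+2}\big(\langle a\iota\rangle\langle ao\rangle\big)^{\deg(a)-2}\right),$$ where the sum is over all trees $\mathbf t$ with vertex set exactly $\{1,\dots,N\}\cup\{I,J\}$, $\deg(a)$ is the number of edges of $\mathbf t$ at the node $a$, and $$K(\mathbf t)=\begin{cases}\dfrac{[\xi a]}{[Ia]}\dfrac{[\chi b]}{[Jb]} & \text{if } I,J \text{ are not adjacent in }\mathbf t,\\[2mm] \dfrac{[\xi\chi]}{[IJ]}&\text{if }I,J\text{ are adjacent in }\mathbf t,\end{cases}$$ with $a$ the neighbour of $I$ on the path from $I$ to $J$ in $\mathbf t$ and $b$ the neighbour of $J$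 on that path (the denominators of $K(\mathbf t)$ cancel against the numerators of the corresponding edge factors). Moreover, regarded as a function of the spinors, the right-hand side has little group weight $+4$ in $I$ and in $J$, and $-4$ in each $i\ne I,J$ (the weight in $i$ is the power of $t$ by which it scales under $|i\rangle\mapsto t|i\rangle$, $|i]\mapsto t^{-1}|i]$), and it has weight $0$ under rescaling of each of $\iota$, $o$, $\xi$, $\chi$.
   Context: Coordinates $u,\bar u,w,\bar w$ are independent. For $i=1,\dots,N+2$ fix $\omega_i\ne0$, $z_i$, $\bar z_i$ ($z_i$ pairwise distinct), $z_{ij}=z_i-z_j$, and $p_i\cdot X=\omega_i(u+z_i\bar z_i\bar u-\bar z_iw-z_i\bar w)$. Commuting parameters $\epsilon_i$ satisfy $\epsilon_i^2=0$ (products of distinct ones are nonzero). Seeds: $\phi_i=\epsilon_ie^{\mathrm ip_i\cdot X}$. Spinors: $|i\rangle=\kappa_i^A=(1,z_i)$, $\kappa^i_A=(-z_i,1)$, $|i]=\tilde\kappa^i_{\dot A}=\omega_i(-\bar z_i,1)$. $\varepsilon^{12}=-\varepsilon_{12}=\varepsilon^{\dot1\dot2}=-\varepsilon_{\dot1\dot2}=1$, indices raised/lowered from the left ($\lambda_A=\varepsilon_{AB}\lambda^B$, $\lambda^A=\varepsilon^{AB}\lambda_B$, and likewise for dotted indices). Brackets: $\langle\lambda\mu\rangle=\varepsilon_{AB}\lambda^A\mu^B$, so $\langle ij\rangle=z_{ij}$, and $\langle a\iota\rangle=\varepsilon_{AB}\kappa_a^A\iota^B$; $[\xi\chi]=\varepsilon^{\dot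 A\dot B}\xi_{\dot A}\chi_{\dot B}=\xi_{\dot1}\chi_{\dot2}-\xi_{\dot2}\chi_{\dot1}$, $[ij]=[\tilde\kappa^i\tilde\kappa^j]=-\omega_i\omega_j(\bar z_i-\bar z_j)$, and $[\xi i]$ means $[\xi\tilde\kappa^i]$. Self-dual background: $\mathcal T_N$ is the set of trees whose vertex set is a nonempty subset of $\{1,\dots,N\}$; for $\mathbf t\in\mathcal T_N$, $\phi_{\mathbf t}=\prod_{\{i,j\}\in\text{edges}}\frac{[ij]}{\langle ij\rangle}\prod_{k\in\text{nodes}}\phi_k$; $\phi=\sum_{\mathbf t\in\mathcal T_N}\phi_{\mathbf t}$. Tetrad: $\theta^{1\dot1}=2d\bar u$, $\theta^{1\dot2}=2d\bar w$, $\theta^{2\dot1}=2(dw-(\partial_u\partial_w\phi)d\bar u-(\partial_u^2\phi)d\bar w)$, $\theta^{2\dot2}=2(du+(\partial_w^2\phi)d\bar u+(\partial_u\partial_w\phi)d\bar w)$. $\Sigma_0^{AB}=\theta^{A\dot A}\wedge\theta^B{}_{\dot A}$, and $\mathrm{dvol}=4\mathrm i\,du\wedge d\bar u\wedge dw\wedge d\bar w$. Negative helicity gravitons: for $L\in\{I,J\}$ define $F_L^{\dot A}$ by requiring, for every dotted spinor $\xi$, $$\xi_{\dot A}F_L^{\dot A}=\xi_{\dot1}(w-z_L\bar u)+\xi_{\dot2}(u-z_L\bar w)-\mathrm i\sum_{(\mathbf t,k)}\frac{[\xi k]}{\langle Lk\rangle}\phi_{\mathbf t},$$ the sum over all $\mathbf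 t\in\mathcal T_N$ and all nodes $k$ of $\mathbf t$; put $F_L=\tilde\kappa^L_{\dot A}F_L^{\dot A}$ and $(H_L)_{\dot 1}{}^{\dot B}=\partial_wF_L^{\dot B}$, $(H_L)_{\dot2}{}^{\dot B}=\partial_uF_L^{\dot B}$. The linearized anti-self-dual spin connections are $$(\gamma^I)_{AB}=-\mathrm i\,\epsilon_I\,\kappa^I_A\kappa^I_B\,\frac{\kappa^I_C\,\xi_{\dot C}(H_I)_{\dot A}{}^{\dot C}\theta^{C\dot A}}{2[\xi I]}\,e^{\mathrm iF_I},$$ and $(\gamma^J)_{AB}$ is given by the same formula with $I\to J$ and $\xi\to\chi$, where $\xi,\chi$ are arbitrary constant reference spinors with $[\xi I]\neq0$, $[\chi J]\ne0$ (the same $\xi,\chi$ as in the claim). The MHV amplitude is $$\mathcal A_{\rm MHV}=\frac{\partial^{N+2}}{\partial\epsilon_1\cdots\partial\epsilon_{N+2}}\int\Sigma_0^{AB}\wedge(\gamma^I)_{AC}\wedge(\gamma^J)^C{}_B\Big|_{\epsilon=0},$$ with $\int e^{\mathrm iP\cdot X}\mathrm{dvol}=(2\pi)^4\delta^{(4)}(P)$. *)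

theory Defs
  imports "HOL-Analysis.Analysis" "HOL-Library.Poly_Mapping"
begin

section \<open>Commuting square-zero parameters\<close>

text \<open>
  An element is given by its coefficients: \<open>f S\<close> is the coefficient of the monomial
  \<open>\<Prod>i\<in>S. \<epsilon>\<^sub>i\<close> (\<open>S\<close> a finite set of labels).  For a commutative ring of coefficients this is
  the ring of (possibly infinite) sums of such monomials with \<open>\<epsilon>\<^sub>i\<^sup>2 = 0\<close>.
\<close>

typedef (overloaded) 'c nilalg = "{f :: nat set \<Rightarrow> 'c::zero. \<forall>S. infinite S \<longrightarrow> f S = 0}"
  morphisms ncoeff Abs_nilalg
  by (rule exI[of _ "\<lambda>_. 0"]) simp

setup_lifting type_definition_nilalg

lemma nilalg_eqI: "(\<And>S. finite S \<Longrightarrow> ncoeff a S = ncoeff b S) \<Longrightarrow> a = b"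
  by transfer (metis (lifting) ext mem_Collect_eq)

lemma ncoeff_infinite: "infinite S \<Longrightarrow> ncoeff a S = 0"
  by transfer simp

lemma sum_Pow_compl:
  fixes f :: "'a set \<Rightarrow> 'a set \<Rightarrow> 'b::comm_monoid_add"
  shows "(\<Sum>T\<in>Pow S. f T (S - T)) = (\<Sum>T\<in>Pow S. f (S - T) T)"
  by (rule sum.reindex_bij_witness[of _ "\<lambda>T. S - T" "\<lambda>T. S - T"]) (auto simp: double_diff)

lemma sum_Pow_assoc:
  fixes f :: "'a set \<Rightarrow> 'a set \<Rightarrow> 'a set \<Rightarrow> 'b::comm_monoid_add"
  assumes "finite S"
  shows "(\<Sum>T\<in>Pow S. \<Sum>U\<in>Pow T. f U (T - U) (S - T)) =
         (\<Sum>U\<in>Pow S. \<Sum>V\<in>Pow (S - U). f U V (S - U - V))"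
proof -
  have fin: "finite T" if "T \<subseteq> S" for T
    using assms that by (rule rev_finite_subset)
  have "(\<Sum>T\<in>Pow S. \<Sum>U\<in>Pow T. f U (T - U) (S - T)) =
        (\<Sum>(T, U)\<in>Sigma (Pow S) Pow. f U (T - U) (S - T))"
    using assms fin by (subst sum.Sigma) auto
  also have "\<dots> = (\<Sum>(U, V)\<in>Sigma (Pow S) (\<lambda>U. Pow (S - U)). f U V (S - U - V))"
    by (rule sum.reindex_bij_witness[of _ "\<lambda>(U, V). (U \<union> V, U)" "\<lambda>(T, U). (U, T - U)"])
       (auto intro!: arg_cong3[of _ _ _ _ _ _ f])
  also have "\<dots> = (\<Sum>U\<in>Pow S. \<Sum>V\<in>Pow (S - U). f U V (S - U - V))"
    using assms by (subst sum.Sigma) auto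
  finally show ?thesis .
qed

instantiation nilalg :: (comm_ring_1) comm_ring_1
begin

lift_definition zero_nilalg :: "'a nilalg" is "\<lambda>S. 0" by simp
lift_definition one_nilalg :: "'a nilalg" is "\<lambda>S. if S = {} then 1 else 0" by auto
lift_definition plus_nilalg :: "'a nilalg \<Rightarrow> 'a nilalg \<Rightarrow> 'a nilalg" is "\<lambda>a b S. a S + b S" by simp
lift_definition minus_nilalg :: "'a nilalg \<Rightarrow> 'a nilalg \<Rightarrow> 'a nilalg" is "\<lambda>a b S. a S - b S" by simp
lift_definition uminus_nilalg :: "'a nilalg \<Rightarrow> 'a nilalg" is "\<lambda>a S. - a S" by simp
lift_definition times_nilalg :: "'a nilalg \<Rightarrow> 'a nilalg \<Rightarrow> 'a nilalg" is
  "\<lambda>a b S. \<Sum>T\<in>Pow S. a T * b (S - T)"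
  by (simp add: finite_Pow_iff)

instance
proof
  fix a b c :: "'a nilalg"
  show "a + b + c = a + (b + c)" by transfer (simp add: add.assoc)
  show "a + b = b + a" by transfer (simp add: add.commute)
  show "0 + a = a" by transfer simp
  show "- a + a = 0" by transfer simp
  show "a - b = a + - b" by transfer simp
  show "(a + b) * c = a * c + b * c"
    by transfer (simp add: algebra_simps sum.distrib)
  show "(0::'a nilalg) \<noteq> 1" by transfer (auto dest: fun_cong[of _ _ "{}"])
  show "a * b = b * a"
  proof (rule nilalg_eqI)
    fix S
    show "ncoeff (a * b) S = ncoeff (b * a) S"
      unfolding times_nilalg.rep_eq
      using sum_Pow_compl[of "\<lambda>T U. ncoeff a T * ncoeff b U" S] by (simp add: mult.commute)
  qed
  show "1 * a = a"
  proof (rule nilalg_eqI)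
    fix S :: "nat set" assume "finite S"
    have "ncoeff (1 * a) S = (\<Sum>T\<in>Pow S. if T = {} then ncoeff a S else 0)"
      unfolding times_nilalg.rep_eq one_nilalg.rep_eq by (rule sum.cong) auto
    also have "\<dots> = ncoeff a S" using \<open>finite S\<close> by simp
    finally show "ncoeff (1 * a) S = ncoeff a S" .
  qed
  show "a * b * c = a * (b * c)"
  proof (rule nilalg_eqI)
    fix S :: "nat set" assume S: "finite S"
    have "ncoeff (a * b * c) S =
        (\<Sum>T\<in>Pow S. \<Sum>U\<in>Pow T. ncoeff a U * ncoeff b (T - U) * ncoeff c (S - T))"
      by (simp add: times_nilalg.rep_eq sum_distrib_right)
    also have "\<dots> = (\<Sum>U\<in>Pow S. \<Sum>V\<in>Pow (S - U).
        ncoeff a U * ncoeff b V * ncoeff c (S - U - V))"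
      by (rule sum_Pow_assoc[OF S])
    also have "\<dots> = ncoeff (a * (b * c)) S"
      by (simp add: times_nilalg.rep_eq sum_distrib_left mult.assoc)
    finally show "ncoeff (a * b * c) S = ncoeff (a * (b * c)) S" .
  qed
qed

end

lift_definition nconst :: "'c::zero \<Rightarrow> 'c nilalg" is "\<lambda>c S. if S = {} then c else 0" by auto

lemma nconst_add: "nconst (a + b) = nconst a + (nconst b :: 'c::comm_ring_1 nilalg)"
  by transfer auto

lemma nconst_mult: "nconst (a * b) = nconst a * (nconst b :: 'c::comm_ring_1 nilalg)"
proof (rule nilalg_eqI)
  fix S :: "nat set" assume "finite S"
  have "ncoeff (nconst a * nconst b) S =
      (\<Sum>T\<in>Pow S. if T = {} then (if S = {} then a * b else 0) else 0)"
    unfolding times_nilalg.rep_eq nconst.rep_eq by (rule sum.cong) auto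
  then show "ncoeff (nconst (a * b)) S = ncoeff (nconst a * nconst b) S"
    using \<open>finite S\<close> by (simp add: nconst.rep_eq)
qed

lift_definition eps :: "nat \<Rightarrow> 'c::zero_neq_one nilalg" is "\<lambda>i S. if S = {i} then 1 else 0" by auto

lemma eps_square: "eps i * eps i = (0 :: 'c::comm_ring_1 nilalg)"
proof (rule nilalg_eqI)
  fix S :: "nat set"
  have "(\<Sum>T\<in>Pow S. (if T = {i} then 1 else 0) * (if S - T = {i} then 1 else (0::'c))) = 0"
    by (rule sum.neutral) auto
  then show "ncoeff (eps i * eps i) S = ncoeff (0 :: 'c nilalg) S"
    by (simp add: times_nilalg.rep_eq eps.rep_eq zero_nilalg.rep_eq)
qed

lemma ncoeff_prod_eps:
  assumes "finite A"
  shows "ncoeff (\<Prod>i\<in>A. eps i :: 'c::comm_ring_1 nilalg) S = (if S = A then 1 else 0)"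
  using assms
proof (induction A arbitrary: S rule: finite_induct)
  case empty
  then show ?case by (simp add: one_nilalg.rep_eq)
next
  case (insert i A)
  show ?case
  proof (cases "finite S")
    case False
    then show ?thesis using insert.hyps by (auto simp: ncoeff_infinite)
  next
    case True
    have "ncoeff (\<Prod>j\<in>insert i A. eps j :: 'c nilalg) S =
        (\<Sum>T\<in>Pow S. if T = {i} then (if S - T = A then 1 else 0) else 0)"
      using insert by (simp add: times_nilalg.rep_eq eps.rep_eq if_distrib cong: if_cong)
        (intro sum.cong; simp)
    also have "\<dots> = (if {i} \<subseteq> S \<and> S - {i} = A then 1 else 0)"
      using True by (simp add: sum.delta)
    also have "\<dots> = (if S = insert i A then 1 else 0)"
      using insert.hyps by auto
    finally show ?thesis .
  qed
qed

text \<open>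
  The exponential series, summed coefficientwise.
\<close>

lift_definition nexp :: "complex nilalg \<Rightarrow> complex nilalg" is
  "\<lambda>a S. if finite S then suminf (\<lambda>k. ncoeff (Abs_nilalg a ^ k) S / fact k) else 0"
  by simp

lemma ncoeff_nexp: "finite S \<Longrightarrow> ncoeff (nexp a) S = suminf (\<lambda>k. ncoeff (a ^ k) S / fact k)"
  by (simp add: nexp.rep_eq ncoeff_inverse)

lift_definition neps_deriv :: "nat \<Rightarrow> 'c::zero nilalg \<Rightarrow> 'c nilalg" is
  "\<lambda>i a S. if i \<in> S then 0 else a (insert i S)"
  by simp

section \<open>Coordinates, spinors and differential forms\<close>

text \<open>\<open>Cu, Cub, Cw, Cwb\<close> stand for \<open>u\<close>, \<open>u\<close>-bar, \<open>w\<close>, \<open>w\<close>-bar.\<close>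

datatype coord = Cu | Cub | Cw | Cwb

lemma UNIV_coord: "UNIV = {Cu, Cub, Cw, Cwb}"
  using coord.exhaust by auto

instance coord :: finite
  by standard (simp add: UNIV_coord)

fun coord_pos :: "coord \<Rightarrow> nat" where
  "coord_pos Cu = 0" | "coord_pos Cub = 1" | "coord_pos Cw = 2" | "coord_pos Cwb = 3"

type_synonym point = "complex ^ coord"
type_synonym covector = "complex ^ coord"
type_synonym spinor = "complex ^ 2"

definition pairing :: "covector \<Rightarrow> point \<Rightarrow> complex" where
  "pairing P X = (\<Sum>c\<in>UNIV. P $ c * X $ c)"

definition pd :: "coord \<Rightarrow> (point \<Rightarrow> complex nilalg) \<Rightarrow> point \<Rightarrow> complex nilalg" where
  "pd c f X = Abs_nilalg (\<lambda>S. deriv (\<lambda>s. ncoeff (f (\<chi> d. if d = c then s else X $ d)) S) (X $ c))"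

lemma ncoeff_pd:
  "ncoeff (pd c f X) S = deriv (\<lambda>s. ncoeff (f (\<chi> d. if d = c then s else X $ d)) S) (X $ c)"
  unfolding pd_def by (subst Abs_nilalg_inverse) (auto simp: ncoeff_infinite)

text \<open>
  A differential form at a point: the component at \<open>S\<close> is the coefficient of the wedge
  product of the \<open>dX\<^sup>c\<close>, \<open>c \<in> S\<close>, taken in the order \<open>u\<close>, \<open>u\<close>-bar, \<open>w\<close>, \<open>w\<close>-bar.
\<close>

type_synonym 'a form = "('a, coord set) vec"

definition dX :: "coord \<Rightarrow> 'a::comm_ring_1 form" where
  "dX c = axis {c} 1"

definition wedge :: "'a::comm_ring_1 form \<Rightarrow> 'a form \<Rightarrow> 'a form" (infixl "\<and>\<^sub>F" 70) where
  "\<alpha> \<and>\<^sub>F \<beta> = (\<chi> S. \<Sum>T\<in>Pow S.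
     (-1) ^ card {(i, j). i \<in> T \<and> j \<in> S - T \<and> coord_pos j < coord_pos i} * \<alpha> $ T * \<beta> $ (S - T))"

definition dvol :: "complex nilalg form" where
  "dvol = nconst (4 * \<i>) *s (dX Cu \<and>\<^sub>F dX Cub \<and>\<^sub>F dX Cw \<and>\<^sub>F dX Cwb)"

text \<open>
  Both kinds of spinor index run over \<open>{1, 2}\<close>.  \<open>eps_up\<close> and \<open>eps_low\<close> are the symbols with
  both indices up and both indices down; they are the same for dotted indices.
\<close>

definition eps_up :: "2 \<Rightarrow> 2 \<Rightarrow> complex" where
  "eps_up A B = (if A = 1 \<and> B = 2 then 1 else if A = 2 \<and> B = 1 then -1 else 0)"

definition eps_low :: "2 \<Rightarrow> 2 \<Rightarrow> complex" where
  "eps_low A B = - eps_up A B"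

definition lower :: "spinor \<Rightarrow> spinor" where
  "lower \<mu> = (\<chi> A. \<Sum>B\<in>UNIV. eps_low A B * \<mu> $ B)"

text \<open>\<open>ang\<close> takes undotted spinors with upper index, \<open>sqb\<close> dotted spinors with lower index.\<close>

definition ang :: "spinor \<Rightarrow> spinor \<Rightarrow> complex" where
  "ang \<mu> \<nu> = (\<Sum>A\<in>UNIV. \<Sum>B\<in>UNIV. eps_low A B * \<mu> $ A * \<nu> $ B)"

definition sqb :: "spinor \<Rightarrow> spinor \<Rightarrow> complex" where
  "sqb \<xi> chi = (\<Sum>A\<in>UNIV. \<Sum>B\<in>UNIV. eps_up A B * \<xi> $ A * chi $ B)"

lemma ang_eq: "ang \<mu> \<nu> = \<mu> $ 2 * \<nu> $ 1 - \<mu> $ 1 * \<nu> $ 2"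
  by (simp add: ang_def eps_low_def eps_up_def sum_2)

lemma sqb_eq: "sqb \<xi> chi = \<xi> $ 1 * chi $ 2 - \<xi> $ 2 * chi $ 1"
  by (simp add: sqb_def eps_up_def sum_2)

section \<open>Trees\<close>

definition adjacent :: "nat set set \<Rightarrow> nat \<Rightarrow> nat \<Rightarrow> bool" where
  "adjacent E i j \<longleftrightarrow> {i, j} \<in> E"

definition is_path :: "nat set set \<Rightarrow> nat \<Rightarrow> nat list \<Rightarrow> nat \<Rightarrow> bool" where
  "is_path E i xs j \<longleftrightarrow>
     xs \<noteq> [] \<and> hd xs = i \<and> last xs = j \<and> distinct xs \<and> successively (adjacent E) xs"

definition is_cycle :: "nat set set \<Rightarrow> nat list \<Rightarrow> bool" where
  "is_cycle E xs \<longleftrightarrow>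
     length xs \<ge> 3 \<and> distinct xs \<and> successively (adjacent E) xs \<and> adjacent E (last xs) (hd xs)"

definition is_tree :: "nat set \<Rightarrow> nat set set \<Rightarrow> bool" where
  "is_tree V E \<longleftrightarrow>
     finite V \<and> V \<noteq> {} \<and> (\<forall>e\<in>E. \<exists>i\<in>V. \<exists>j\<in>V. i \<noteq> j \<and> e = {i, j}) \<and>
     (\<forall>i\<in>V. \<forall>j\<in>V. \<exists>xs. is_path E i xs j) \<and> (\<nexists>xs. is_cycle E xs)"

definition subtrees :: "nat \<Rightarrow> (nat set \<times> nat set set) set" where
  "subtrees N = {(V, E). V \<subseteq> {1..N} \<and> is_tree V E}"

definition degree_at :: "nat set set \<Rightarrow> nat \<Rightarrow> nat" where
  "degree_at E a = card {e \<in> E. a \<in> e}"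

definition path_of :: "nat set set \<Rightarrow> nat \<Rightarrow> nat \<Rightarrow> nat list" where
  "path_of E i j = (THE xs. is_path E i xs j)"

definition neighbour_towards :: "nat set set \<Rightarrow> nat \<Rightarrow> nat \<Rightarrow> nat" where
  "neighbour_towards E i j = path_of E i j ! 1"

text \<open>The quotient is symmetric in the two end points, so their order is irrelevant.\<close>

definition edge_factor :: "(nat \<Rightarrow> spinor) \<Rightarrow> (nat \<Rightarrow> spinor) \<Rightarrow> nat set \<Rightarrow> complex" where
  "edge_factor lam lamt e =
     sqb (lamt (Min e)) (lamt (Max e)) / ang (lam (Min e)) (lam (Max e))"

lemma edge_factor_pair:
  "edge_factor lam lamt {i, j} = sqb (lamt i) (lamt j) / ang (lam i) (lam j)"
proof (cases "i \<le> j")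
  case True
  then show ?thesis by (simp add: edge_factor_def min_def max_def)
next
  case False
  have "sqb (lamt j) (lamt i) / ang (lam j) (lam i) = (- sqb (lamt i) (lamt j)) / (- ang (lam i) (lam j))"
    by (simp add: sqb_eq ang_eq algebra_simps)
  with False show ?thesis by (simp add: edge_factor_def min_def max_def)
qed

section \<open>Formal integration of plane waves\<close>

text \<open>
  Finite linear combinations of the symbols \<open>\<delta>\<^sup>4(P)\<close>, for complex covectors \<open>P\<close>.
\<close>

type_synonym deltas = "covector \<Rightarrow>\<^sub>0 complex"

definition delta4 :: "covector \<Rightarrow> deltas" where
  "delta4 P = Poly_Mapping.single P 1"

definition scale_deltas :: "complex \<Rightarrow> deltas \<Rightarrow> deltas" where
  "scale_deltas c d = Poly_Mapping.map (\<lambda>x. c * x) d"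

definition plane_wave_sum :: "deltas \<Rightarrow> point \<Rightarrow> complex" where
  "plane_wave_sum d X = (\<Sum>P\<in>Poly_Mapping.keys d. Poly_Mapping.lookup d P * exp (\<i> * pairing P X))"

text \<open>
  \<open>plane_wave_integral f\<close> is \<open>\<integral> f dvol\<close>; it is determined on sums of plane waves by linearity and
  \<open>\<integral> e\<^bsup>iP\<cdot>X\<^esup> dvol = (2\<pi>)\<^sup>4 \<delta>\<^sup>4(P)\<close>, because plane waves are linearly independent (see below).
\<close>

definition plane_wave_integral :: "(point \<Rightarrow> complex) \<Rightarrow> deltas" where
  "plane_wave_integral f = scale_deltas ((2 * of_real pi) ^ 4) (THE d. f = plane_wave_sum d)"

lemma plane_waves_independent:
  assumes "finite A" and "\<And>X. (\<Sum>P\<in>A. c P * exp (\<i> * pairing P X)) = 0" and "P \<in> A"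
  shows "c P = 0"
  using assms
proof (induction A arbitrary: c P rule: finite_induct)
  case empty
  then show ?case by simp
next
  case (insert Q A)
  have add: "pairing P (X + Y) = pairing P X + pairing P Y" for P X Y
    by (simp add: pairing_def ring_distribs sum.distrib)
  have zero: "c R = 0" if R: "R \<in> A" for R
  proof -
    have "R \<noteq> Q" using R insert.hyps by auto
    then obtain k where k: "R $ k \<noteq> Q $ k" by (auto simp: vec_eq_iff)
    define Y :: point where "Y = axis k (of_real pi / (R $ k - Q $ k))"
    have pY: "pairing P Y = P $ k * (of_real pi / (R $ k - Q $ k))" for P
    proof -
      have "pairing P Y = (\<Sum>j\<in>UNIV. if j = k then P $ k * (of_real pi / (R $ k - Q $ k)) else 0)"
        unfolding pairing_def Y_def by (rule sum.cong) (auto simp: axis_def)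
      then show ?thesis by simp
    qed
    have "pairing R Y = pairing Q Y + of_real pi"
      unfolding pY using k by (simp add: divide_simps) (simp add: algebra_simps)
    then have ne: "exp (\<i> * pairing R Y) \<noteq> exp (\<i> * pairing Q Y)"
      by (simp add: distrib_left exp_add mult.commute[of \<i> "of_real pi"])
    define b where "b P = c P * (exp (\<i> * pairing P Y) - exp (\<i> * pairing Q Y))" for P
    have "(\<Sum>P\<in>A. b P * exp (\<i> * pairing P X)) = 0" for X
    proof -
      have "(\<Sum>P\<in>A. b P * exp (\<i> * pairing P X)) =
          (\<Sum>P\<in>insert Q A. b P * exp (\<i> * pairing P X))"
        using insert.hyps by (simp add: b_def)
      also have "\<dots> = (\<Sum>P\<in>insert Q A. c P * exp (\<i> * pairing P (X + Y)))
          - exp (\<i> * pairing Q Y) * (\<Sum>P\<in>insert Q A. c P * exp (\<i> * pairing P X))"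
        unfolding sum_distrib_left sum_subtractf[symmetric]
        by (rule sum.cong) (simp_all add: b_def add distrib_left exp_add algebra_simps)
      also have "\<dots> = 0" by (simp only: insert.prems(1)) simp
      finally show ?thesis .
    qed
    from insert.IH[OF this R] ne show ?thesis by (simp add: b_def)
  qed
  moreover have "c Q = 0"
    using insert.prems(1)[of 0] insert.hyps zero by simp
  ultimately show ?case using insert.prems(2) by auto
qed

lemma plane_wave_sum_inj: "plane_wave_sum d = plane_wave_sum d' \<Longrightarrow> d = d'"
proof (rule poly_mapping_eqI)
  fix P assume eq: "plane_wave_sum d = plane_wave_sum d'"
  let ?A = "insert P (Poly_Mapping.keys d \<union> Poly_Mapping.keys d')"
  have ext: "plane_wave_sum e X = (\<Sum>P\<in>?A. Poly_Mapping.lookup e P * exp (\<i> * pairing P X))"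
    if "Poly_Mapping.keys e \<subseteq> ?A" for e X
    unfolding plane_wave_sum_def
    by (rule sum.mono_neutral_left) (use that in \<open>auto simp: in_keys_iff\<close>)
  have "(\<Sum>P\<in>?A. (Poly_Mapping.lookup d P - Poly_Mapping.lookup d' P) * exp (\<i> * pairing P X)) = 0" for X
  proof -
    have "plane_wave_sum d X - plane_wave_sum d' X = 0" using eq by simp
    moreover have "Poly_Mapping.keys d \<subseteq> ?A" "Poly_Mapping.keys d' \<subseteq> ?A" by auto
    ultimately show ?thesis
      by (simp only: ext left_diff_distrib sum_subtractf)
  qed
  from plane_waves_independent[OF _ this, of P]
  show "Poly_Mapping.lookup d P = Poly_Mapping.lookup d' P" by simp
qed

lemma plane_wave_integral_sum:
  "plane_wave_integral (plane_wave_sum d) = scale_deltas ((2 * of_real pi) ^ 4) d"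
proof -
  have "(THE e. plane_wave_sum d = plane_wave_sum e) = d"
    by (rule the_equality) (auto dest: plane_wave_sum_inj)
  then show ?thesis by (simp add: plane_wave_integral_def)
qed

lemma plane_wave_integral_exp:
  "plane_wave_integral (\<lambda>X. exp (\<i> * pairing P X)) = scale_deltas ((2 * of_real pi) ^ 4) (delta4 P)"
proof -
  have "(\<lambda>X. exp (\<i> * pairing P X)) = plane_wave_sum (delta4 P)"
    by (simp add: fun_eq_iff plane_wave_sum_def delta4_def)
  then show ?thesis by (simp only: plane_wave_integral_sum)
qed

text \<open>The integral of a field of 4-forms, taken monomial by monomial in the \<open>\<epsilon>\<^sub>i\<close>.\<close>

definition density :: "complex nilalg form \<Rightarrow> complex nilalg" where
  "density \<alpha> = (THE f. \<alpha> = f *s dvol)"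

definition form_integral :: "(point \<Rightarrow> complex nilalg form) \<Rightarrow> deltas nilalg" where
  "form_integral \<Omega> = Abs_nilalg (\<lambda>S.
     if finite S then plane_wave_integral (\<lambda>X. ncoeff (density (\<Omega> X)) S) else 0)"

lemma ncoeff_form_integral:
  "finite S \<Longrightarrow>
   ncoeff (form_integral \<Omega>) S = plane_wave_integral (\<lambda>X. ncoeff (density (\<Omega> X)) S)"
  unfolding form_integral_def by (subst Abs_nilalg_inverse) auto

section \<open>The generating function\<close>

context
  fixes N :: nat and om z zb :: "nat \<Rightarrow> complex"
begin

definition momentum :: "nat \<Rightarrow> covector" where
  "momentum i = (\<chi> c. case c of
      Cu \<Rightarrow> om i | Cub \<Rightarrow> om i * z i * zb i | Cw \<Rightarrow> - om i * zb i | Cwb \<Rightarrow> - om i * z i)"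

lemma pairing_momentum:
  "pairing (momentum i) X = om i * (X $ Cu + z i * zb i * X $ Cub - zb i * X $ Cw - z i * X $ Cwb)"
  by (simp add: pairing_def momentum_def UNIV_coord algebra_simps)

definition kap :: "nat \<Rightarrow> spinor" where
  "kap i = vector [1, z i]"

definition kapt :: "nat \<Rightarrow> spinor" where
  "kapt i = vector [- om i * zb i, om i]"

lemma kap_lower: "lower (kap i) = vector [- z i, 1]"
  by (simp add: lower_def kap_def eps_low_def eps_up_def sum_2 vec_eq_iff forall_2)

lemma ang_kap: "ang (kap i) (kap j) = z i - z j"
  by (simp add: ang_eq kap_def)

lemma sqb_kapt: "sqb (kapt i) (kapt j) = - om i * om j * (zb i - zb j)"
  by (simp add: sqb_eq kapt_def algebra_simps)

definition seed :: "nat \<Rightarrow> point \<Rightarrow> complex nilalg" where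
  "seed i X = eps i * nconst (exp (\<i> * pairing (momentum i) X))"

definition phi_tree :: "nat set \<times> nat set set \<Rightarrow> point \<Rightarrow> complex nilalg" where
  "phi_tree t X = nconst (\<Prod>e\<in>snd t. edge_factor kap kapt e) * (\<Prod>k\<in>fst t. seed k X)"

definition phi :: "point \<Rightarrow> complex nilalg" where
  "phi X = (\<Sum>t\<in>subtrees N. phi_tree t X)"

text \<open>\<open>tetrad A A' X\<close> is \<open>\<theta>\<^bsup>AA'\<^esup>\<close> at \<open>X\<close>, with \<open>A'\<close> the dotted index.\<close>

definition tetrad :: "2 \<Rightarrow> 2 \<Rightarrow> point \<Rightarrow> complex nilalg form" where
  "tetrad A A' X =
    (if A = 1 then (if A' = 1 then 2 *s dX Cub else 2 *s dX Cwb)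
     else if A' = 1
       then 2 *s (dX Cw - pd Cu (pd Cw phi) X *s dX Cub - pd Cu (pd Cu phi) X *s dX Cwb)
       else 2 *s (dX Cu + pd Cw (pd Cw phi) X *s dX Cub + pd Cu (pd Cw phi) X *s dX Cwb))"

definition Sigma0 :: "2 \<Rightarrow> 2 \<Rightarrow> point \<Rightarrow> complex nilalg form" where
  "Sigma0 A B X = (\<Sum>A'\<in>UNIV. tetrad A A' X \<and>\<^sub>F
     (\<Sum>B'\<in>UNIV. nconst (eps_low A' B') *s tetrad B B' X))"

text \<open>
  \<open>F_contr L \<xi>\<close> is the prescribed contraction of \<open>\<xi>\<close> with \<open>F\<^sub>L\<close>; it is linear in \<open>\<xi>\<close>, and the
  components \<open>F_up L\<close> are its values on the basis.
\<close>

definition F_contr :: "nat \<Rightarrow> spinor \<Rightarrow> point \<Rightarrow> complex nilalg" where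
  "F_contr L \<xi> X =
     nconst (\<xi> $ 1 * (X $ Cw - z L * X $ Cub) + \<xi> $ 2 * (X $ Cu - z L * X $ Cwb))
     - nconst \<i> * (\<Sum>t\<in>subtrees N. \<Sum>k\<in>fst t.
         nconst (sqb \<xi> (kapt k) / ang (kap L) (kap k)) * phi_tree t X)"

definition F_up :: "nat \<Rightarrow> 2 \<Rightarrow> point \<Rightarrow> complex nilalg" where
  "F_up L A' X = F_contr L (axis A' 1) X"

lemma F_up_contraction: "(\<Sum>A'\<in>UNIV. nconst (\<xi> $ A') * F_up L A' X) = F_contr L \<xi> X"
proof -
  have ax: "(axis 1 1 :: spinor) $ 1 = 1" "(axis 1 1 :: spinor) $ 2 = 0"
    "(axis 2 1 :: spinor) $ 1 = 0" "(axis 2 1 :: spinor) $ 2 = 1"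
    by (simp_all add: axis_def)
  have split: "nconst (sqb \<xi> (kapt k) / d) =
      nconst (\<xi> $ 1) * nconst (sqb (axis 1 1) (kapt k) / d) +
      nconst (\<xi> $ 2) * nconst (sqb (axis 2 1) (kapt k) / d)" for k d
    by (simp add: nconst_mult[symmetric] nconst_add[symmetric])
       (simp add: sqb_eq ax algebra_simps diff_divide_distrib)
  have lin: "nconst (\<xi> $ 1 * p + \<xi> $ 2 * q) =
      nconst (\<xi> $ 1) * nconst (1 * p + 0 * q) + nconst (\<xi> $ 2) * nconst (0 * p + 1 * q)" for p q
    by (simp add: nconst_mult nconst_add)
  show ?thesis
    unfolding F_up_def F_contr_def sum_2 split lin ax
    by (simp only: sum.distrib sum_distrib_left distrib_left distrib_right right_diff_distrib)
       (simp add: mult_ac)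
qed

definition F_scalar :: "nat \<Rightarrow> point \<Rightarrow> complex nilalg" where
  "F_scalar L X = (\<Sum>A'\<in>UNIV. nconst (kapt L $ A') * F_up L A' X)"

text \<open>\<open>H_mat L A' B'\<close> has its first (dotted) index down and its second one up.\<close>

definition H_mat :: "nat \<Rightarrow> 2 \<Rightarrow> 2 \<Rightarrow> point \<Rightarrow> complex nilalg" where
  "H_mat L A' B' X = (if A' = 1 then pd Cw (F_up L B') X else pd Cu (F_up L B') X)"

definition gam :: "nat \<Rightarrow> spinor \<Rightarrow> 2 \<Rightarrow> 2 \<Rightarrow> point \<Rightarrow> complex nilalg form" where
  "gam L \<xi> A B X =
     (nconst (- \<i> * lower (kap L) $ A * lower (kap L) $ B / (2 * sqb \<xi> (kapt L)))
        * eps L * nexp (nconst \<i> * F_scalar L X)) *s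
     (\<Sum>C\<in>UNIV. \<Sum>A'\<in>UNIV. \<Sum>C'\<in>UNIV.
        (nconst (lower (kap L) $ C * \<xi> $ C') * H_mat L A' C' X) *s tetrad C A' X)"

definition gam_up :: "nat \<Rightarrow> spinor \<Rightarrow> 2 \<Rightarrow> 2 \<Rightarrow> point \<Rightarrow> complex nilalg form" where
  "gam_up L \<xi> C B X = (\<Sum>D\<in>UNIV. nconst (eps_up C D) *s gam L \<xi> D B X)"

definition MHV_form :: "spinor \<Rightarrow> spinor \<Rightarrow> point \<Rightarrow> complex nilalg form" where
  "MHV_form \<xi> chi X = (\<Sum>A\<in>UNIV. \<Sum>B\<in>UNIV. \<Sum>C\<in>UNIV.
     Sigma0 A B X \<and>\<^sub>F gam (N + 1) \<xi> A C X \<and>\<^sub>F gam_up (N + 2) chi C B X)"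

text \<open>Setting all \<open>\<epsilon>\<^sub>i\<close> to zero is taking the coefficient of the empty monomial.\<close>

definition MHV_amplitude :: "spinor \<Rightarrow> spinor \<Rightarrow> deltas" where
  "MHV_amplitude \<xi> chi =
     ncoeff (foldr neps_deriv [1..<N + 3] (form_integral (MHV_form \<xi> chi))) {}"

end

section \<open>The tree formula\<close>

text \<open>
  The formula as a function of arbitrary spinors, \<open>lam i\<close> for \<open>|i\<rangle>\<close> (upper index) and \<open>lamt i\<close> for
  \<open>|i]\<close> (lower index), with \<open>I = N + 1\<close> and \<open>J = N + 2\<close>.

  \<open>tree_K\<close> has the denominators \<open>[Ia]\<close>, \<open>[Jb]\<close> or \<open>[IJ]\<close>, which always occur as numerators of edge
  factors.  \<open>tree_weight\<close> is the product of \<open>tree_K\<close> with all edge factors after this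
  cancellation; it is the meaning of that product also where one of these brackets vanishes
  (in HOL, division by zero would give the value 0 there).
\<close>

context
  fixes N :: nat and lam lamt :: "nat \<Rightarrow> spinor"
begin

definition tree_K :: "spinor \<Rightarrow> spinor \<Rightarrow> nat set set \<Rightarrow> complex" where
  "tree_K \<xi> chi E =
    (let I = N + 1; J = N + 2; a = neighbour_towards E I J; b = neighbour_towards E J I in
     if adjacent E I J then sqb \<xi> chi / sqb (lamt I) (lamt J)
     else sqb \<xi> (lamt a) / sqb (lamt I) (lamt a) * (sqb chi (lamt b) / sqb (lamt J) (lamt b)))"

definition tree_weight :: "spinor \<Rightarrow> spinor \<Rightarrow> nat set set \<Rightarrow> complex" where
  "tree_weight \<xi> chi E =
    (let I = N + 1; J = N + 2; a = neighbour_towards E I J; b = neighbour_towards E J I in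
     if adjacent E I J
     then sqb \<xi> chi / ang (lam I) (lam J) * (\<Prod>e\<in>E - {{I, J}}. edge_factor lam lamt e)
     else sqb \<xi> (lamt a) / ang (lam I) (lam a) * (sqb chi (lamt b) / ang (lam J) (lam b)) *
          (\<Prod>e\<in>E - {{I, a}, {J, b}}. edge_factor lam lamt e))"

definition MHV_formula_with ::
  "(nat set set \<Rightarrow> complex) \<Rightarrow> spinor \<Rightarrow> spinor \<Rightarrow> spinor \<Rightarrow> spinor \<Rightarrow> complex" where
  "MHV_formula_with W \<iota> omicron \<xi> chi =
    (let I = N + 1; J = N + 2 in
     - (ang (lam I) (lam J) ^ 4 * ang (lam I) \<iota> * ang (lam I) omicron * ang (lam J) \<iota> * ang (lam J) omicron
        / (sqb \<xi> (lamt I) * sqb chi (lamt J))) *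
     (\<Sum>E | is_tree {1..N + 2} E.
        W E * (\<Prod>a = 1..N + 2. (ang (lam a) \<iota> * ang (lam a) omicron) powi (int (degree_at E a) - 2))))"

definition MHV_formula :: "spinor \<Rightarrow> spinor \<Rightarrow> spinor \<Rightarrow> spinor \<Rightarrow> complex" where
  "MHV_formula \<iota> omicron \<xi> chi = MHV_formula_with (tree_weight \<xi> chi) \<iota> omicron \<xi> chi"

definition MHV_formula_K :: "spinor \<Rightarrow> spinor \<Rightarrow> spinor \<Rightarrow> spinor \<Rightarrow> complex" where
  "MHV_formula_K \<iota> omicron \<xi> chi =
     MHV_formula_with (\<lambda>E. tree_K \<xi> chi E * (\<Prod>e\<in>E. edge_factor lam lamt e)) \<iota> omicron \<xi> chi"

end

end

theory Submission
  imports Defs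
begin

text \<open>
  Contracting the spinor indices of the 4-form gives, whatever the potential, the density
  \<open>e\<^bsup>i(F\<^sub>I + F\<^sub>J)\<^esup> [h\<^sub>I h\<^sub>J]\<close> up to constants, where \<open>h\<^sub>L\<close> consists of the two derivatives of the
  contraction of \<open>\<xi>\<close> (or \<open>chi\<close>) with \<open>F\<^sub>L\<close>.  Each coefficient of a monomial in the \<open>\<epsilon>\<^sub>i\<close> is a plane
  wave.  The exponentials generate the trees rooted at \<open>I\<close> and at \<open>J\<close>.  In \<open>[h\<^sub>I h\<^sub>J]\<close> the products
  of two trees are rewritten as sums over the trees obtained by joining them with an edge; after a
  telescoping along paths this leaves \<open>[\<xi> chi]\<close> (the trees in which \<open>I\<close> and \<open>J\<close> are adjacent)
  and \<open>z\<^sub>I - z\<^sub>J\<close> times the sum over trees with one node marked by \<open>I\<close> and one by \<open>J\<close> (the trees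
  in which they are not).
\<close>

section \<open>Trees\<close>

text \<open>A pair of background trees in \<open>[h_I h_J]\<close> carries a factor
  \<open>[l m]\<close> without its denominator, so it is not yet a tree term. Writing
  \<open>[l m]\<close> as edge weight times \<open>z l - z m\<close> turns the pair into one tree
  with an oriented edge. If \<open>I\<close> marks the node \<open>k\<close> and \<open>J\<close>
  the node \<open>k'\<close>, the factors \<open>z l - z m\<close> run over the edges separating
  \<open>k\<close> from \<open>k'\<close> and add up to \<open>z k - z k'\<close>. The one-tree
  terms contribute \<open>z I - z k\<close> and \<open>- (z J - z k')\<close>, so the total
  \<open>z I - z J\<close> is independent of the marks. Subsets of labels organise everything: a
  product of coefficients is a sum over splittings of the label set, and so is a tree with an
  oriented edge, once the edge is cut. All tree sums therefore rest on one bijection between trees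
  with an oriented edge and pairs of trees with a chosen vertex each. The brackets
  \<open>[ij]\<close> may vanish while \<open>z i - z j\<close> does not, so the evaluation uses
  \<open>tree_weight\<close>, in which no \<open>[ij]\<close> is a denominator. At the reference
  spinors (0,1) every factor raised to a degree equals 1; the degrees become visible only in the
  homogeneity statements.\<close>

abbreviation conn :: "nat set set \<Rightarrow> nat \<Rightarrow> nat \<Rightarrow> bool" where
  "conn E \<equiv> (adjacent E)\<^sup>*\<^sup>*"

definition side :: "nat set set \<Rightarrow> nat \<Rightarrow> nat \<Rightarrow> nat set" where
  "side E l m = {x. conn (E - {{l, m}}) l x}"

definition induced :: "nat set set \<Rightarrow> nat set \<Rightarrow> nat set set" where
  "induced E A = {e \<in> E. e \<subseteq> A}"

section \<open>Reachability, simple paths and bridges\<close>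

lemma adjacent_sym: "adjacent E i j \<Longrightarrow> adjacent E j i"
  by (simp add: adjacent_def insert_commute)

lemma conn_sym: "conn E i j \<Longrightarrow> conn E j i"
proof (induction rule: rtranclp_induct)
  case (step y z)
  then show ?case by (meson adjacent_sym converse_rtranclp_into_rtranclp)
qed simp

lemma conn_mono: "conn E i j \<Longrightarrow> E \<subseteq> E' \<Longrightarrow> conn E' i j"
proof (induction rule: rtranclp_induct)
  case (step y z)
  then have "adjacent E' y z" by (auto simp: adjacent_def)
  with step show ?case by (meson rtranclp.rtrancl_into_rtrancl)
qed simp

lemma conn_step: "{i, j} \<in> E \<Longrightarrow> conn E i j"
  by (simp add: adjacent_def r_into_rtranclp)

lemma conn_closed:
  assumes "conn E i j" "i \<in> A" "\<And>a b. a \<in> A \<Longrightarrow> {a, b} \<in> E \<Longrightarrow> b \<in> A"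
  shows "j \<in> A"
  using assms(1) by (induction rule: rtranclp_induct) (use assms in \<open>auto simp: adjacent_def\<close>)

lemma successively_conn:
  "successively (adjacent E) xs \<Longrightarrow> xs \<noteq> [] \<Longrightarrow> conn E (hd xs) (last xs)"
proof (induction xs rule: induct_list012)
  case (3 x y zs)
  then have "conn E y (last (y # zs))" "adjacent E x y" by auto
  then show ?case by (simp add: converse_rtranclp_into_rtranclp)
qed auto

lemma is_path_conn: "is_path E i xs j \<Longrightarrow> conn E i j"
  using successively_conn by (auto simp: is_path_def)

text \<open>Prepending a vertex keeps a path simple unless the vertex already lies on it; in that
  case the tail starting at that vertex is the required path.\<close>

lemma conn_is_path: "conn E i j \<Longrightarrow> \<exists>xs. is_path E i xs j"
proof (induction rule: converse_rtranclp_induct)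
  case base
  have "is_path E j [j] j" by (simp add: is_path_def)
  then show ?case by blast
next
  case (step y z)
  then obtain xs where xs: "is_path E z xs j" by blast
  show ?case
  proof (cases "y \<in> set xs")
    case False
    have "is_path E y (y # xs) j"
      using False xs step by (cases xs) (auto simp: is_path_def)
    then show ?thesis by blast
  next
    case True
    then obtain us vs where "xs = us @ y # vs" by (auto dest: split_list)
    then have "is_path E y (y # vs) j"
      using xs by (auto simp: is_path_def successively_append_iff)
    then show ?thesis by blast
  qed
qed

text \<open>A simple path never returns to its first vertex, so after the first step it uses no edge
  at \<open>i\<close>. The vertex \<open>k\<close> is left free: it will be the far end of a closing
  edge, or the next vertex of this path or of a competing one.\<close>

lemma is_path_avoid:
  assumes "is_path E i (i # y # zs) j"
  shows "is_path (E - {{i, k}}) y (y # zs) j"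
proof -
  have *: "successively (adjacent E) (y # zs)" "i \<notin> set (y # zs)"
    using assms by (auto simp: is_path_def)
  have "successively (adjacent (E - {{i, k}})) (y # zs)"
    by (rule successively_mono[OF *(1)]) (use *(2) in \<open>auto simp: adjacent_def doubleton_eq_iff\<close>)
  with assms show ?thesis by (auto simp: is_path_def)
qed

text \<open>A simple path that joins the ends of an edge without using it closes up to a cycle;
  conversely a cycle without its closing edge is such a path. Loops are excluded because
  reachability is reflexive: a loop would violate the right-hand side without giving a cycle of
  length at least 3.\<close>

lemma acyclic_iff_bridges:
  assumes "\<And>i. {i} \<notin> E"
  shows "(\<nexists>xs. is_cycle E xs) \<longleftrightarrow> (\<forall>i j. {i, j} \<in> E \<longrightarrow> \<not> conn (E - {{i, j}}) i j)"
proof safe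
  fix i j assume ij: "{i, j} \<in> E" "conn (E - {{i, j}}) i j" and nc: "\<nexists>xs. is_cycle E xs"
  obtain xs where xs: "is_path (E - {{i, j}}) i xs j" using conn_is_path ij by blast
  have ne: "i \<noteq> j" using assms ij by auto
  have "length xs \<ge> 3"
  proof (rule ccontr)
    assume "\<not> ?thesis"
    with xs ne have "xs = [i, j]"
      by (cases xs; cases "tl xs"; cases "tl (tl xs)") (auto simp: is_path_def)
    with xs show False by (auto simp: is_path_def adjacent_def)
  qed
  moreover have "successively (adjacent E) xs"
    using xs by (auto simp: is_path_def adjacent_def elim: successively_mono)
  ultimately have "is_cycle E xs"
    using xs ij by (auto simp: is_cycle_def is_path_def adjacent_def insert_commute)
  with nc show False by blast
next
  fix xs assume br: "\<forall>i j. {i, j} \<in> E \<longrightarrow> \<not> conn (E - {{i, j}}) i j" and c: "is_cycle E xs"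
  obtain x y zs where xs: "xs = x # y # zs" "zs \<noteq> []"
    using c by (cases xs; cases "tl xs"; cases "tl (tl xs)") (auto simp: is_cycle_def)
  let ?l = "last xs"
  have "successively (adjacent (E - {{x, ?l}})) (y # zs)"
    using is_path_avoid[of E x y zs ?l ?l] c xs by (auto simp: is_path_def is_cycle_def)
  moreover have "adjacent (E - {{x, ?l}}) x y"
    using c xs by (auto simp: is_cycle_def adjacent_def doubleton_eq_iff)
  ultimately have "conn (E - {{x, ?l}}) x ?l"
    using successively_conn[of "E - {{x, ?l}}" xs] xs by auto
  moreover have "{x, ?l} \<in> E" using c xs by (auto simp: is_cycle_def adjacent_def insert_commute)
  ultimately show False using br by blast
qed

text \<open>Vertex lists are awkward to glue and cut, whereas reachability can be controlled by
  monotonicity in the edge set and by sets closed under edges.\<close>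

lemma is_tree_iff:
  "is_tree V E \<longleftrightarrow> finite V \<and> V \<noteq> {} \<and> (\<forall>e\<in>E. \<exists>i\<in>V. \<exists>j\<in>V. i \<noteq> j \<and> e = {i, j}) \<and>
     (\<forall>i\<in>V. \<forall>j\<in>V. conn E i j) \<and> (\<forall>i j. {i, j} \<in> E \<longrightarrow> \<not> conn (E - {{i, j}}) i j)"
proof (cases "\<forall>e\<in>E. \<exists>i\<in>V. \<exists>j\<in>V. i \<noteq> j \<and> e = {i, j}")
  case True
  have "\<And>i. {i} \<notin> E"
  proof
    fix i assume "{i} \<in> E"
    with True obtain a b where "a \<noteq> b" "{i} = {a, b}" by blast
    then show False by auto
  qed
  from acyclic_iff_bridges[OF this]
  have "is_tree V E \<longleftrightarrow> finite V \<and> V \<noteq> {} \<and> (\<forall>e\<in>E. \<exists>i\<in>V. \<exists>j\<in>V. i \<noteq> j \<and> e = {i, j}) \<and>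
     (\<forall>i\<in>V. \<forall>j\<in>V. \<exists>xs. is_path E i xs j) \<and> (\<forall>i j. {i, j} \<in> E \<longrightarrow> \<not> conn (E - {{i, j}}) i j)"
    unfolding is_tree_def by simp
  moreover have "(\<exists>xs. is_path E i xs j) \<longleftrightarrow> conn E i j" for i j
    using conn_is_path is_path_conn by blast
  ultimately show ?thesis by simp
next
  case False
  then show ?thesis unfolding is_tree_def by blast
qed

lemma is_treeD:
  assumes "is_tree V E"
  shows "finite V" "V \<noteq> {}" "{i, j} \<in> E \<Longrightarrow> i \<in> V" "{i, j} \<in> E \<Longrightarrow> j \<in> V" "{i, j} \<in> E \<Longrightarrow> i \<noteq> j"
    "i \<in> V \<Longrightarrow> j \<in> V \<Longrightarrow> conn E i j" "{i, j} \<in> E \<Longrightarrow> \<not> conn (E - {{i, j}}) i j"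
    "E \<subseteq> Pow V" "finite E" "{} \<notin> E" "e \<in> E \<Longrightarrow> \<exists>i\<in>V. \<exists>j\<in>V. i \<noteq> j \<and> e = {i, j}"
proof -
  note t = assms[unfolded is_tree_iff]
  show "finite V" "V \<noteq> {}" and ed: "e \<in> E \<Longrightarrow> \<exists>i\<in>V. \<exists>j\<in>V. i \<noteq> j \<and> e = {i, j}" for e
    using t by blast+
  have "{i, j} \<in> E \<Longrightarrow> i \<in> V \<and> j \<in> V \<and> i \<noteq> j"
    using ed[of "{i, j}"] by (auto simp: doubleton_eq_iff)
  then show "{i, j} \<in> E \<Longrightarrow> i \<in> V" "{i, j} \<in> E \<Longrightarrow> j \<in> V" "{i, j} \<in> E \<Longrightarrow> i \<noteq> j" by blast+
  show "i \<in> V \<Longrightarrow> j \<in> V \<Longrightarrow> conn E i j" "{i, j} \<in> E \<Longrightarrow> \<not> conn (E - {{i, j}}) i j"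
    using t by blast+
  show sub: "E \<subseteq> Pow V" "{} \<notin> E" using ed by auto
  then show "finite E" using \<open>finite V\<close> by (meson finite_Pow_iff finite_subset)
qed

lemma finite_trees: "finite {E. is_tree V E}"
proof (cases "finite V")
  case True
  have "{E. is_tree V E} \<subseteq> Pow (Pow V)" using is_treeD(8) by blast
  then show ?thesis using True by (meson finite_Pow_iff finite_subset)
next
  case False
  then show ?thesis by (simp add: is_tree_def)
qed

section \<open>Gluing two trees by an edge\<close>

lemma conn_glued:
  assumes tr: "is_tree V1 E1" "is_tree V2 E2" and V: "V1 \<inter> V2 = {}" "l \<in> V1" "m \<in> V2"
    and c: "conn (insert {l, m} (E1 \<union> E2) - {e}) a b" and a: "a \<in> V1" "b \<in> V1"
  shows "conn (E1 - {e}) a b"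
proof -
  \<comment> \<open>Retraction onto the first tree: the whole second tree goes to \<open>l\<close>,
    so an edge of \<open>E2\<close> and the joining edge become stationary steps while an edge of
    \<open>E1\<close> is kept. A detour through the second tree therefore cannot replace
    \<open>e\<close>.\<close>
  define p where "p x = (if x \<in> V1 then x else l)" for x
  have *: "conn (E1 - {e}) (p x) (p y)" if "adjacent (insert {l, m} (E1 \<union> E2) - {e}) x y" for x y
  proof -
    have "{x, y} = {l, m} \<or> {x, y} \<in> E1 - {e} \<or> {x, y} \<in> E2"
      using that by (auto simp: adjacent_def)
    then show ?thesis
    proof (elim disjE)
      assume "{x, y} = {l, m}"
      then have "p x = l" "p y = l" using V by (auto simp: p_def doubleton_eq_iff)
      then show ?thesis by simp
    next
      assume h: "{x, y} \<in> E1 - {e}"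
      then have "x \<in> V1" "y \<in> V1" using is_treeD(3,4)[OF tr(1)] by blast+
      then show ?thesis using h by (simp add: p_def conn_step)
    next
      assume h: "{x, y} \<in> E2"
      then have "x \<in> V2" "y \<in> V2" using is_treeD(3,4)[OF tr(2)] by blast+
      then have "p x = l" "p y = l" using V by (auto simp: p_def)
      then show ?thesis by simp
    qed
  qed
  from c have "conn (E1 - {e}) (p a) (p b)"
  proof (induction rule: rtranclp_induct)
    case (step y z)
    then show ?case using * by (meson rtranclp_trans)
  qed simp
  then show ?thesis using a by (simp add: p_def)
qed

lemma glue_edges:
  assumes tr: "is_tree V1 E1" "is_tree V2 E2" and V: "V1 \<inter> V2 = {}" "l \<in> V1" "m \<in> V2"
  shows "{l, m} \<notin> E1" "{l, m} \<notin> E2" "E1 \<inter> E2 = {}"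
    "insert {l, m} (E1 \<union> E2) - {{l, m}} = E1 \<union> E2"
proof -
  show 1: "{l, m} \<notin> E1" "{l, m} \<notin> E2"
    using is_treeD(3,4)[OF tr(1), of l m] is_treeD(3,4)[OF tr(2), of l m] V by blast+
  then show "insert {l, m} (E1 \<union> E2) - {{l, m}} = E1 \<union> E2" by blast
  show "E1 \<inter> E2 = {}"
  proof (rule ccontr)
    assume "E1 \<inter> E2 \<noteq> {}"
    then obtain e where e: "e \<in> E1" "e \<in> E2" by blast
    then have "e \<subseteq> V1 \<inter> V2" "e \<noteq> {}"
      using is_treeD(8,10)[OF tr(1)] is_treeD(8,10)[OF tr(2)] by auto
    then show False using V(1) by simp
  qed
qed

lemma side_glue:
  assumes tr: "is_tree V1 E1" "is_tree V2 E2" and V: "V1 \<inter> V2 = {}" "l \<in> V1" "m \<in> V2"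
  shows "side (insert {l, m} (E1 \<union> E2)) l m = V1"
proof -
  have "conn (E1 \<union> E2) l x \<longleftrightarrow> x \<in> V1" for x
  proof
    assume "conn (E1 \<union> E2) l x"
    then show "x \<in> V1"
      using V(2)
    proof (rule conn_closed)
      fix a b assume "a \<in> V1" "{a, b} \<in> E1 \<union> E2"
      then show "b \<in> V1"
        using is_treeD(4)[OF tr(1), of a b] is_treeD(3)[OF tr(2), of a b] V(1) by blast
    qed
  next
    assume "x \<in> V1"
    then show "conn (E1 \<union> E2) l x"
      using is_treeD(6)[OF tr(1), of l x] V conn_mono by blast
  qed
  then show ?thesis unfolding side_def glue_edges(4)[OF assms] by blast
qed

lemma is_tree_glue:
  assumes tr: "is_tree V1 E1" "is_tree V2 E2" and V: "V1 \<inter> V2 = {}" "l \<in> V1" "m \<in> V2"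
  shows "is_tree (V1 \<union> V2) (insert {l, m} (E1 \<union> E2))" (is "is_tree ?V ?E")
  unfolding is_tree_iff
proof (intro conjI ballI allI impI)
  show "finite ?V" "?V \<noteq> {}" using is_treeD(1,2)[OF tr(1)] is_treeD(1,2)[OF tr(2)] by auto
  fix e assume "e \<in> ?E"
  then show "\<exists>i\<in>?V. \<exists>j\<in>?V. i \<noteq> j \<and> e = {i, j}"
  proof (elim insertE UnE)
    assume "e = {l, m}"
    then show ?thesis using V by (intro bexI[of _ l] bexI[of _ m]) auto
  next
    assume "e \<in> E1"
    then show ?thesis using is_treeD(11)[OF tr(1), of e] by (meson UnCI)
  next
    assume "e \<in> E2"
    then show ?thesis using is_treeD(11)[OF tr(2), of e] by (meson UnCI)
  qed
next
  have lm: "conn ?E l m" by (simp add: conn_step)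
  have "conn ?E i l" if i: "i \<in> ?V" for i
  proof (cases "i \<in> V1")
    case True
    then show ?thesis using is_treeD(6)[OF tr(1), of i l] V conn_mono[of E1 i l ?E] by blast
  next
    case False
    then have "conn ?E m i" using is_treeD(6)[OF tr(2), of m i] V conn_mono[of E2 m i ?E] i by blast
    then show ?thesis using lm conn_sym by (meson rtranclp_trans)
  qed
  then show "conn ?E i j" if "i \<in> ?V" "j \<in> ?V" for i j
    using that conn_sym by (meson rtranclp_trans)
next
  fix i j assume ij: "{i, j} \<in> ?E"
  show "\<not> conn (?E - {{i, j}}) i j"
  proof
    assume c: "conn (?E - {{i, j}}) i j"
    consider "{i, j} \<in> E1" | "{i, j} \<in> E2" | "{i, j} = {l, m}" using ij by blast
    then show False
    proof cases
      case 1
      then show False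
        using conn_glued[OF assms c] is_treeD(3,4,7)[OF tr(1), of i j] by blast
    next
      case 2
      \<comment> \<open>Gluing is symmetric, so an edge of the second tree is handled by exchanging
        the two trees.\<close>
      have "?E = insert {m, l} (E2 \<union> E1)" by (auto simp: insert_commute)
      with c have c': "conn (insert {m, l} (E2 \<union> E1) - {{i, j}}) i j" by simp
      from 2 show False
        using conn_glued[OF tr(2,1) _ V(3,2) c'] V(1) is_treeD(3,4,7)[OF tr(2), of i j] by blast
    next
      case 3
      have "conn (?E - {{l, m}}) l m"
        using c 3 conn_sym by (auto simp: doubleton_eq_iff insert_commute)
      then have "m \<in> side ?E l m" by (simp add: side_def)
      then show False using side_glue[OF assms] V by blast
    qed
  qed
qed

lemma induced_glue:
  assumes tr: "is_tree V1 E1" "is_tree V2 E2" and V: "V1 \<inter> V2 = {}" "l \<in> V1" "m \<in> V2"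
  shows "induced (insert {l, m} (E1 \<union> E2)) V1 = E1"
proof -
  have "e \<notin> E2" if "e \<subseteq> V1" for e
    using that is_treeD(8,10)[OF tr(2)] V(1) by (metis Int_greatest Pow_iff subsetD subset_empty)
  moreover have "\<not> {l, m} \<subseteq> V1" using V by blast
  ultimately show ?thesis using is_treeD(8)[OF tr(1)] by (auto simp: induced_def)
qed

section \<open>Cutting a tree at an edge\<close>

lemma side_step:
  assumes "{a, b} \<in> E" "{a, b} \<noteq> {c, d}" "a \<in> side E c d"
  shows "b \<in> side E c d"
  using assms unfolding side_def mem_Collect_eq
  by (intro rtranclp.rtrancl_into_rtrancl[of _ c a b]) (simp_all add: adjacent_def)

text \<open>Inverse to gluing. The sides are disjoint because \<open>{l, m}\<close> is a bridge, and
  they exhaust \<open>V\<close> because their union is closed under edges. The tree property is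
  stated for one side only; exchanging \<open>l\<close> and \<open>m\<close> gives the
  other.\<close>

lemma split_tree:
  assumes tr: "is_tree V E" and lm: "{l, m} \<in> E"
  shows "l \<in> side E l m" "m \<in> side E m l" "side E l m \<inter> side E m l = {}"
    "side E l m \<union> side E m l = V" "is_tree (side E l m) (induced E (side E l m))"
    "insert {l, m} (induced E (side E l m) \<union> induced E (side E m l)) = E"
proof -
  have side': "side E m l = {x. conn (E - {{l, m}}) m x}" by (simp add: side_def insert_commute)
  show ll: "l \<in> side E l m" and mm: "m \<in> side E m l" by (simp_all add: side_def)
  show dis: "side E l m \<inter> side E m l = {}"
  proof (rule ccontr)
    assume "side E l m \<inter> side E m l \<noteq> {}"
    then obtain x where x: "x \<in> side E l m" "x \<in> side E m l" by blast
    have "conn (E - {{l, m}}) l x" using x(1) by (simp add: side_def)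
    moreover have "conn (E - {{l, m}}) m x" using x(2) by (simp add: side')
    ultimately have "conn (E - {{l, m}}) l m" using conn_sym by (meson rtranclp_trans)
    then show False using is_treeD(7)[OF tr lm] by blast
  qed
  have lV: "l \<in> V" "m \<in> V" "l \<noteq> m" using is_treeD(3-5)[OF tr lm] by auto
  have sub: "side E a b \<subseteq> V" if "a \<in> V" for a b
  proof
    fix x assume "x \<in> side E a b"
    then have "conn (E - {{a, b}}) a x" by (simp add: side_def)
    then show "x \<in> V" by (rule conn_closed) (use that is_treeD(4)[OF tr] in auto)
  qed
  note closed = side_step
  have "x \<in> side E l m \<union> side E m l" if "x \<in> V" for x
  proof (rule conn_closed)
    show "conn E l x" using is_treeD(6)[OF tr lV(1) that] .
    fix a b assume a: "a \<in> side E l m \<union> side E m l" "{a, b} \<in> E"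
    show "b \<in> side E l m \<union> side E m l"
    proof (cases "{a, b} = {l, m}")
      case True
      then show ?thesis using ll mm by (auto simp: doubleton_eq_iff)
    next
      case False
      then show ?thesis using a closed[of a b E l m] closed[of a b E m l] by (auto simp: insert_commute)
    qed
  qed (use ll in auto)
  then show un: "side E l m \<union> side E m l = V" using sub lV by blast
  show "insert {l, m} (induced E (side E l m) \<union> induced E (side E m l)) = E"
  proof (intro equalityI subsetI)
    fix e assume e: "e \<in> E"
    obtain i j where ij: "i \<in> V" "e = {i, j}" using is_treeD(11)[OF tr e] by blast
    show "e \<in> insert {l, m} (induced E (side E l m) \<union> induced E (side E m l))"
      using closed[of i j E l m] closed[of i j E m l] e ij un by (auto simp: induced_def insert_commute)
  qed (use lm in \<open>auto simp: induced_def\<close>)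
  show "is_tree (side E l m) (induced E (side E l m))" (is "is_tree ?V1 ?E1")
    unfolding is_tree_iff
  proof (intro conjI ballI allI impI)
    show "finite ?V1" "?V1 \<noteq> {}"
      using sub[OF lV(1)] is_treeD(1)[OF tr] ll by (auto intro: finite_subset)
    fix e assume e: "e \<in> ?E1"
    then show "\<exists>i\<in>?V1. \<exists>j\<in>?V1. i \<noteq> j \<and> e = {i, j}"
      using is_treeD(11)[OF tr, of e] by (auto simp: induced_def)
  next
    have "conn ?E1 l x \<and> x \<in> ?V1" if "conn (E - {{l, m}}) l x" for x
      using that
    proof (induction rule: rtranclp_induct)
      case (step y z)
      have "z \<in> ?V1" using step closed[of y z E l m] by (auto simp: adjacent_def)
      moreover have "adjacent ?E1 y z" using step calculation by (auto simp: adjacent_def induced_def)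
      ultimately show ?case using step by (meson rtranclp.rtrancl_into_rtrancl)
    qed (use ll in simp)
    then have "conn ?E1 l x" if "x \<in> ?V1" for x using that by (simp add: side_def)
    then show "conn ?E1 i j" if "i \<in> ?V1" "j \<in> ?V1" for i j
      using that conn_sym by (meson rtranclp_trans)
  next
    fix i j assume "{i, j} \<in> ?E1"
    then have "\<not> conn (E - {{i, j}}) i j" using is_treeD(7)[OF tr, of i j] by (auto simp: induced_def)
    moreover have "?E1 - {{i, j}} \<subseteq> E - {{i, j}}" by (auto simp: induced_def)
    ultimately show "\<not> conn (?E1 - {{i, j}}) i j" using conn_mono by blast
  qed
qed

lemma side_step_iff:
  assumes "{a, b} \<in> E" "{a, b} \<noteq> {c, d}"
  shows "a \<in> side E c d \<longleftrightarrow> b \<in> side E c d"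
proof -
  have "{b, a} = {a, b}" by (rule insert_commute)
  with assms have "{b, a} \<in> E" "{b, a} \<noteq> {c, d}" by simp_all
  from side_step[OF assms] side_step[OF this] show ?thesis by blast
qed

text \<open>Cutting and gluing are mutually inverse. Edges are oriented, so each contributes twice,
  as \<open>(l, m)\<close> and as \<open>(m, l)\<close>. The extreme subsets \<open>{}\<close> and
  \<open>W\<close> contribute nothing, since a tree has at least one vertex.\<close>

lemma sum_tree_edges:
  fixes f :: "nat set \<Rightarrow> nat set set \<Rightarrow> nat set set \<Rightarrow> nat \<Rightarrow> nat \<Rightarrow> 'a::comm_monoid_add"
  assumes W: "finite W"
  shows "(\<Sum>E | is_tree W E. \<Sum>(l, m) | {l, m} \<in> E.
            f (side E l m) (induced E (side E l m)) (induced E (side E m l)) l m) =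
         (\<Sum>V\<in>Pow W. \<Sum>E1 | is_tree V E1. \<Sum>E2 | is_tree (W - V) E2.
            \<Sum>l\<in>V. \<Sum>m\<in>W - V. f V E1 E2 l m)"
proof -
  define S1 where "S1 = (SIGMA E:{E. is_tree W E}. {(l, m). {l, m} \<in> E})"
  define S2 where "S2 = (SIGMA V:Pow W. SIGMA E1:{E1. is_tree V E1}. SIGMA E2:{E2. is_tree (W - V) E2}.
      SIGMA l:V. W - V)"
  have fin1: "finite {(l, m). {l, m} \<in> E}" if "is_tree W E" for E
  proof (rule finite_subset)
    show "{(l, m). {l, m} \<in> E} \<subseteq> W \<times> W"
      using is_treeD(3,4)[OF that] by blast
  qed (use W in simp)
  have finV: "finite V" if "V \<in> Pow W" for V using that W finite_subset by auto
  have "(\<Sum>E | is_tree W E. \<Sum>(l, m) | {l, m} \<in> E.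
            f (side E l m) (induced E (side E l m)) (induced E (side E m l)) l m) =
    (\<Sum>(E, l, m)\<in>S1. f (side E l m) (induced E (side E l m)) (induced E (side E m l)) l m)"
    unfolding S1_def using fin1 finite_trees[of W] by (subst sum.Sigma) (auto simp: case_prod_beta)
  also have "\<dots> = (\<Sum>(V, E1, E2, l, m)\<in>S2. f V E1 E2 l m)"
  proof (rule sum.reindex_bij_witness[of _ "\<lambda>(V, E1, E2, l, m). (insert {l, m} (E1 \<union> E2), l, m)"
        "\<lambda>(E, l, m). (side E l m, induced E (side E l m), induced E (side E m l), l, m)"])
    fix x assume "x \<in> S1"
    then obtain E l m where x: "x = (E, l, m)" and tr: "is_tree W E" and lm: "{l, m} \<in> E"
      by (auto simp: S1_def)
    have ml: "{m, l} \<in> E" using lm by (simp add: insert_commute)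
    note s = split_tree[OF tr lm] and s' = split_tree[OF tr ml]
    show "(case case x of (E, l, m) \<Rightarrow> (side E l m, induced E (side E l m), induced E (side E m l), l, m) of
        (V, E1, E2, l, m) \<Rightarrow> (insert {l, m} (E1 \<union> E2), l, m)) = x"
      using s(6) by (simp add: x)
    have "W - side E l m = side E m l" using s by blast
    then show "(case x of (E, l, m) \<Rightarrow> (side E l m, induced E (side E l m), induced E (side E m l), l, m)) \<in> S2"
      using s s'(5) by (auto simp: x S2_def)
    show "(case (case x of (E, l, m) \<Rightarrow> (side E l m, induced E (side E l m), induced E (side E m l), l, m)) of
       (V, E1, E2, l, m) \<Rightarrow> f V E1 E2 l m) =
       (case x of (E, l, m) \<Rightarrow> f (side E l m) (induced E (side E l m)) (induced E (side E m l)) l m)"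
      by (simp add: x)
  next
    fix y assume "y \<in> S2"
    then obtain V E1 E2 l m where y: "y = (V, E1, E2, l, m)" and V: "V \<subseteq> W" and
      tr: "is_tree V E1" "is_tree (W - V) E2" and lm: "l \<in> V" "m \<in> W - V" by (auto simp: S2_def)
    have dis: "V \<inter> (W - V) = {}" "(W - V) \<inter> V = {}" "V \<union> (W - V) = W" using V by auto
    let ?E = "insert {l, m} (E1 \<union> E2)"
    have E': "insert {m, l} (E2 \<union> E1) = ?E" by (auto simp: insert_commute)
    have "side ?E l m = V" "side ?E m l = W - V" "induced ?E V = E1" "induced ?E (W - V) = E2"
      using side_glue[OF tr dis(1) lm] induced_glue[OF tr dis(1) lm]
        side_glue[OF tr(2,1) dis(2) lm(2,1)] induced_glue[OF tr(2,1) dis(2) lm(2,1)] E' by simp_all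
    then show "(case case y of (V, E1, E2, l, m) \<Rightarrow> (insert {l, m} (E1 \<union> E2), l, m) of
        (E, l, m) \<Rightarrow> (side E l m, induced E (side E l m), induced E (side E m l), l, m)) = y"
      by (simp add: y)
    show "(case y of (V, E1, E2, l, m) \<Rightarrow> (insert {l, m} (E1 \<union> E2), l, m)) \<in> S1"
      using is_tree_glue[OF tr dis(1) lm] dis by (auto simp: y S1_def)
  qed
  also have "\<dots> = (\<Sum>V\<in>Pow W. \<Sum>E1 | is_tree V E1. \<Sum>E2 | is_tree (W - V) E2.
            \<Sum>l\<in>V. \<Sum>m\<in>W - V. f V E1 E2 l m)"
    unfolding S2_def using W finV finite_trees
    by (simp add: sum.Sigma[symmetric] finite_SigmaI)
  finally show ?thesis .
qed

section \<open>Unique paths and the first step towards a vertex\<close>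

lemma is_path_unique:
  assumes tr: "is_tree V E" and "is_path E i xs j" "is_path E i ys j"
  shows "xs = ys"
  using assms(2,3)
proof (induction xs arbitrary: i ys)
  case Nil
  then show ?case by (simp add: is_path_def)
next
  case (Cons x xs)
  obtain ys' where ys: "ys = i # ys'" using Cons.prems by (cases ys) (auto simp: is_path_def)
  have x: "x = i" using Cons.prems by (simp add: is_path_def)
  show ?case
  proof (cases "xs = [] \<or> ys' = []")
    case True
    then show ?thesis using Cons.prems ys x by (auto simp: is_path_def split: if_splits)
  next
    case False
    then obtain a as b bs where xs: "xs = a # as" and ys': "ys' = b # bs"
      by (meson neq_Nil_conv)
    have p: "is_path E i (i # a # as) j" "is_path E i (i # b # bs) j"
      using Cons.prems by (simp_all add: xs ys ys' x)
    \<comment> \<open>If the paths left \<open>i\<close> through different vertices, one could go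
      from \<open>i\<close> to \<open>b\<close>, on to \<open>j\<close> and back to \<open>a\<close>
      without the edge \<open>{i, a}\<close>, which is a bridge.\<close>
    have "a = b"
    proof (rule ccontr)
      assume ne: "a \<noteq> b"
      have "conn (E - {{i, a}}) a j" "conn (E - {{i, a}}) b j"
        using is_path_avoid[OF p(1)] is_path_avoid[OF p(2)] is_path_conn by blast+
      moreover have "adjacent (E - {{i, a}}) i b"
        using p ne by (auto simp: is_path_def adjacent_def doubleton_eq_iff)
      ultimately have "conn (E - {{i, a}}) i a"
        using conn_sym by (meson converse_rtranclp_into_rtranclp rtranclp_trans)
      moreover have "{i, a} \<in> E" using p by (auto simp: is_path_def adjacent_def)
      ultimately show False using is_treeD(7)[OF tr] by blast
    qed
    moreover have "is_path E a xs j" "is_path E b ys' j"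
      using p by (auto simp: is_path_def xs ys')
    ultimately have "xs = ys'" using Cons.IH by blast
    then show ?thesis by (simp add: x ys)
  qed
qed

lemma path_of_eq:
  assumes "is_tree V E" "is_path E i xs j"
  shows "path_of E i j = xs"
  unfolding path_of_def using assms is_path_unique by blast

text \<open>Together with its converse below, this characterises the neighbour as the unique
  \<open>l\<close> adjacent to \<open>r\<close> whose side of the edge contains \<open>v\<close>, so
  that paths can be replaced by components. A path inside that side cannot meet \<open>r\<close>,
  again because \<open>{l, r}\<close> is a bridge, and so \<open>r\<close> may be put in front of
  it.\<close>

lemma neighbour_towards_eq:
  assumes tr: "is_tree V E" and e: "{l, r} \<in> E" and v: "v \<in> side E l r"
  shows "neighbour_towards E r v = l"
proof -
  have c: "conn (E - {{l, r}}) l v" using v by (simp add: side_def)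
  obtain xs where xs: "is_path (E - {{l, r}}) l xs v" using conn_is_path[OF c] by blast
  have "r \<notin> set xs"
  proof
    assume "r \<in> set xs"
    then obtain us vs where "xs = us @ r # vs" by (auto dest: split_list)
    then have "is_path (E - {{l, r}}) r (r # vs) v"
      using xs by (auto simp: is_path_def successively_append_iff)
    then have "conn (E - {{l, r}}) r v" by (rule is_path_conn)
    then have "conn (E - {{l, r}}) l r" using c conn_sym by (meson rtranclp_trans)
    then show False using is_treeD(7)[OF tr e] by blast
  qed
  moreover have "successively (adjacent E) xs"
    using xs by (auto simp: is_path_def adjacent_def elim: successively_mono)
  moreover obtain xs' where "xs = l # xs'" using xs by (cases xs) (auto simp: is_path_def)
  ultimately have "is_path E r (r # l # xs') v"
    using xs e by (auto simp: is_path_def adjacent_def insert_commute)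
  from path_of_eq[OF tr this] show ?thesis by (simp add: neighbour_towards_def)
qed

lemma neighbour_towards:
  assumes tr: "is_tree V E" and rv: "r \<in> V" "v \<in> V" "r \<noteq> v"
  shows "{neighbour_towards E r v, r} \<in> E" "v \<in> side E (neighbour_towards E r v) r"
proof -
  obtain xs where xs: "is_path E r xs v"
    using conn_is_path[OF is_treeD(6)[OF tr rv(1,2)]] by blast
  then obtain y zs where x: "xs = r # y # zs"
    using rv(3) by (cases xs; cases "tl xs") (auto simp: is_path_def)
  have y: "neighbour_towards E r v = y"
    using path_of_eq[OF tr xs] by (simp add: neighbour_towards_def x)
  show "{neighbour_towards E r v, r} \<in> E"
    using xs by (auto simp: y x is_path_def adjacent_def insert_commute)
  have "conn (E - {{r, y}}) y v"
    using is_path_avoid[of E r y zs v y] xs is_path_conn by (auto simp: x)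
  then show "v \<in> side E (neighbour_towards E r v) r"
    by (simp add: y side_def insert_commute)
qed

text \<open>In each tree exactly one edge at \<open>r\<close> leads towards \<open>v\<close>.
  Cutting there is canonical, so the left-hand side is a sum over trees and not over trees with a
  chosen edge.\<close>

lemma sum_tree_cut:
  fixes f :: "nat set \<Rightarrow> nat set set \<Rightarrow> nat set set \<Rightarrow> nat \<Rightarrow> 'a::comm_monoid_add"
  assumes W: "finite W" and rv: "r \<in> W" "v \<in> W" "r \<noteq> v"
  shows "(\<Sum>E | is_tree W E. let l = neighbour_towards E r v in
            f (side E l r) (induced E (side E l r)) (induced E (side E r l)) l) =
         (\<Sum>V | V \<subseteq> W \<and> v \<in> V \<and> r \<notin> V. \<Sum>E1 | is_tree V E1. \<Sum>E2 | is_tree (W - V) E2.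
            \<Sum>l\<in>V. f V E1 E2 l)"
proof -
  \<comment> \<open>An indicator that keeps, among the oriented edges \<open>(l, m)\<close>, only
    the one entering \<open>r\<close> from the side of \<open>v\<close>.\<close>
  define g where "g V E1 E2 l m = (if m = r then if v \<in> V then f V E1 E2 l else 0 else 0)" for V E1 E2 l m
  have 1: "(let l = neighbour_towards E r v in
            f (side E l r) (induced E (side E l r)) (induced E (side E r l)) l) =
      (\<Sum>(l, m) | {l, m} \<in> E. g (side E l m) (induced E (side E l m)) (induced E (side E m l)) l m)"
    if tr: "is_tree W E" for E
  proof -
    let ?l = "neighbour_towards E r v"
    have "finite {(l, m). {l, m} \<in> E}"
    proof (rule finite_subset)
      show "{(l, m). {l, m} \<in> E} \<subseteq> W \<times> W"
        using is_treeD(3,4)[OF tr] by blast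
    qed (use W in simp)
    then have "(\<Sum>(l, m) | {l, m} \<in> E. g (side E l m) (induced E (side E l m)) (induced E (side E m l)) l m)
       = (\<Sum>(l, m)\<in>{(?l, r)}. g (side E l m) (induced E (side E l m)) (induced E (side E m l)) l m)"
    proof (rule sum.mono_neutral_right)
      show "{(?l, r)} \<subseteq> {(l, m). {l, m} \<in> E}" using neighbour_towards[OF tr rv] by simp
      have "g (side E l m) (induced E (side E l m)) (induced E (side E m l)) l m = 0"
        if "{l, m} \<in> E" "(l, m) \<noteq> (?l, r)" for l m
        using neighbour_towards_eq[OF tr that(1), of v] that(2) by (auto simp: g_def)
      then show "\<forall>x\<in>{(l, m). {l, m} \<in> E} - {(?l, r)}. (case x of (l, m) \<Rightarrow>
          g (side E l m) (induced E (side E l m)) (induced E (side E m l)) l m) = 0" by (auto simp only: split: prod.splits)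
    qed
    then show ?thesis using neighbour_towards[OF tr rv] by (simp add: g_def Let_def)
  qed
  have 2: "(\<Sum>m\<in>W - V. g V E1 E2 l m) = (if v \<in> V \<and> r \<notin> V then f V E1 E2 l else 0)" for V E1 E2 l
    unfolding g_def using W rv by (subst sum.delta) auto
  have 3: "(\<Sum>E1 | is_tree V E1. \<Sum>E2 | is_tree (W - V) E2. \<Sum>l\<in>V. \<Sum>m\<in>W - V. g V E1 E2 l m) =
      (if v \<in> V \<and> r \<notin> V then \<Sum>E1 | is_tree V E1. \<Sum>E2 | is_tree (W - V) E2. \<Sum>l\<in>V. f V E1 E2 l else 0)"
    for V
    unfolding 2 by (cases "v \<in> V \<and> r \<notin> V") (simp, simp only: if_False sum.neutral_const)
  have "(\<Sum>E | is_tree W E. let l = neighbour_towards E r v in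
            f (side E l r) (induced E (side E l r)) (induced E (side E r l)) l) =
     (\<Sum>V\<in>Pow W. if v \<in> V \<and> r \<notin> V
        then \<Sum>E1 | is_tree V E1. \<Sum>E2 | is_tree (W - V) E2. \<Sum>l\<in>V. f V E1 E2 l else 0)"
    using sum_tree_edges[OF W, of g] 1 unfolding 3 by simp
  also have "\<dots> = (\<Sum>V | V \<subseteq> W \<and> v \<in> V \<and> r \<notin> V.
      \<Sum>E1 | is_tree V E1. \<Sum>E2 | is_tree (W - V) E2. \<Sum>l\<in>V. f V E1 E2 l)"
    using W by (subst sum.inter_filter[symmetric]) (auto intro!: sum.cong)
  finally show ?thesis .
qed

section \<open>Weighted sums over trees\<close>

lemma prod_split_tree:
  fixes w :: "nat set \<Rightarrow> 'a::comm_monoid_mult"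
  assumes tr: "is_tree W E" and lm: "{l, m} \<in> E"
  shows "(\<Prod>e\<in>E - {{l, m}}. w e) =
    (\<Prod>e\<in>induced E (side E l m). w e) * (\<Prod>e\<in>induced E (side E m l). w e)"
    "(\<Prod>e\<in>E. w e) = w {l, m} *
    ((\<Prod>e\<in>induced E (side E l m). w e) * (\<Prod>e\<in>induced E (side E m l). w e))"
    "E - {{l, m}} = induced E (side E l m) \<union> induced E (side E m l)"
    "induced E (side E l m) \<inter> induced E (side E m l) = {}"
proof -
  have ml: "{m, l} \<in> E" using lm by (simp add: insert_commute)
  note s = split_tree[OF tr lm] and s' = split_tree[OF tr ml]
  note g = glue_edges[OF s(5) s'(5) s(3,1,2), unfolded s(6)]
  show "E - {{l, m}} = induced E (side E l m) \<union> induced E (side E m l)"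
    "induced E (side E l m) \<inter> induced E (side E m l) = {}" using g by blast+
  then show 1: "(\<Prod>e\<in>E - {{l, m}}. w e) =
      (\<Prod>e\<in>induced E (side E l m). w e) * (\<Prod>e\<in>induced E (side E m l). w e)"
    using is_treeD(9)[OF s(5)] is_treeD(9)[OF s'(5)] by (simp add: prod.union_disjoint)
  show "(\<Prod>e\<in>E. w e) = w {l, m} *
      ((\<Prod>e\<in>induced E (side E l m). w e) * (\<Prod>e\<in>induced E (side E m l). w e))"
    using prod.remove[OF is_treeD(9)[OF tr] lm, of w] by (simp add: 1)
qed

text \<open>The weighted spanning tree sum of the complete graph on \<open>V\<close>. It is 0, not
  1, on the empty set, so that sums over all of \<open>Pow\<close> may include empty blocks.\<close>

definition tree_sum :: "(nat set \<Rightarrow> 'a::comm_semiring_1) \<Rightarrow> nat set \<Rightarrow> 'a" where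
  "tree_sum w V = (\<Sum>E | is_tree V E. \<Prod>e\<in>E. w e)"

lemma tree_sum_empty [simp]: "tree_sum w {} = 0"
  by (simp add: tree_sum_def is_tree_def)

lemma is_tree_singleton: "is_tree {v} E \<longleftrightarrow> E = {}"
proof
  assume tr: "is_tree {v} E"
  have "e \<notin> E" for e using is_treeD(11)[OF tr, of e] by auto
  then show "E = {}" by blast
qed (auto simp: is_tree_iff adjacent_def)

lemma tree_sum_singleton [simp]: "tree_sum w {v} = 1"
  by (simp add: tree_sum_def is_tree_singleton)

text \<open>Cutting the edge at \<open>r\<close> towards \<open>v\<close> singles out the branch
  containing \<open>v\<close>. The recursion has the shape obtained by differentiating an
  exponential with respect to the parameter of \<open>v\<close>, and the two are compared in this
  form.\<close>

lemma tree_sum_rec: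
  assumes W: "finite W" and rv: "r \<in> W" "v \<in> W" "r \<noteq> v"
  shows "tree_sum w W =
    (\<Sum>V | V \<subseteq> W \<and> v \<in> V \<and> r \<notin> V. (\<Sum>l\<in>V. w {l, r}) * tree_sum w V * tree_sum w (W - V))"
proof -
  have "tree_sum w W = (\<Sum>E | is_tree W E. let l = neighbour_towards E r v in
      w {l, r} * (\<Prod>e\<in>induced E (side E l r). w e) * (\<Prod>e\<in>induced E (side E r l). w e))"
    unfolding tree_sum_def Let_def
  proof (intro sum.cong refl, elim CollectE)
    fix E assume tr: "is_tree W E"
    let ?l = "neighbour_towards E r v"
    show "(\<Prod>e\<in>E. w e) = w {?l, r} * (\<Prod>e\<in>induced E (side E ?l r). w e) * (\<Prod>e\<in>induced E (side E r ?l). w e)"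
      using prod_split_tree(2)[OF tr neighbour_towards(1)[OF tr rv], of w] by (simp add: mult.assoc)
  qed
  also have "\<dots> = (\<Sum>V | V \<subseteq> W \<and> v \<in> V \<and> r \<notin> V. \<Sum>E1 | is_tree V E1. \<Sum>E2 | is_tree (W - V) E2.
      \<Sum>l\<in>V. w {l, r} * (\<Prod>e\<in>E1. w e) * (\<Prod>e\<in>E2. w e))"
    by (rule sum_tree_cut[OF W rv, of "\<lambda>V E1 E2 l. w {l, r} * (\<Prod>e\<in>E1. w e) * (\<Prod>e\<in>E2. w e)"])
  also have "\<dots> = (\<Sum>V | V \<subseteq> W \<and> v \<in> V \<and> r \<notin> V. (\<Sum>l\<in>V. w {l, r}) * tree_sum w V * tree_sum w (W - V))"
    by (simp add: tree_sum_def sum_distrib_left[symmetric] sum_distrib_right[symmetric])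
  finally show ?thesis .
qed

text \<open>A telescoping sum: the oriented edges separating \<open>a\<close> from \<open>b\<close>
  are those of the path between them. Moving the end point along an edge adds this edge if the step
  leads away from \<open>a\<close> and removes it if the step leads back, so the induction can
  follow any walk from \<open>a\<close> to \<open>b\<close>.\<close>

lemma sum_separating_edges:
  fixes z :: "nat \<Rightarrow> 'a::ab_group_add"
  assumes tr: "is_tree V E" and a: "a \<in> V" and b: "b \<in> V"
  shows "(\<Sum>(l, m) | {l, m} \<in> E \<and> a \<in> side E l m \<and> b \<in> side E m l. z l - z m) = z a - z b"
proof -
  define S where "S x = {(l, m). {l, m} \<in> E \<and> a \<in> side E l m \<and> x \<in> side E m l}" for x
  have fin: "finite (S x)" for x
  proof (rule finite_subset)
    show "S x \<subseteq> V \<times> V"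
      using is_treeD(3,4)[OF tr] by (auto simp: S_def)
  qed (use is_treeD(1)[OF tr] in simp)
  have dis: "x \<notin> side E l m" if "{l, m} \<in> E" "x \<in> side E m l" for x l m
    using split_tree(3)[OF tr that(1)] that(2) by blast
  have S_step: "S y' = insert (y, y') (S y) \<and> (y, y') \<notin> S y" if e: "{y, y'} \<in> E" and ay: "a \<in> side E y y'" for y y'
  proof -
    have e': "{y', y} \<in> E" using e by (simp add: insert_commute)
    have *: "(l, m) \<in> S y' \<longleftrightarrow> (l, m) \<in> S y" if "{l, m} \<noteq> {y, y'}" for l m
      using side_step_iff[OF e, of m l] that by (auto simp: S_def insert_commute)
    have "(y, y') \<in> S y'" using e ay split_tree(2)[OF tr e] by (simp add: S_def)
    moreover have "(y, y') \<notin> S y" using dis[OF e'] split_tree(1)[OF tr e] by (auto simp: S_def)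
    moreover have "(y', y) \<notin> S x" for x using dis[OF e' ay] by (simp add: S_def)
    ultimately have "x \<in> S y' \<longleftrightarrow> x \<in> insert (y, y') (S y)" for x
      using *[of "fst x" "snd x"] by (cases x) (auto simp: doubleton_eq_iff)
    then show ?thesis using \<open>(y, y') \<notin> S y\<close> by blast
  qed
  have "conn E a b" using is_treeD(6)[OF tr a b] .
  then have "(\<Sum>(l, m)\<in>S b. z l - z m) = z a - z b"
  proof (induction rule: rtranclp_induct)
    case base
    have "S a = {}" using dis by (auto simp: S_def)
    then show ?case by simp
  next
    case (step y y')
    then have e: "{y, y'} \<in> E" "{y', y} \<in> E" by (simp_all add: adjacent_def insert_commute)
    then have "a \<in> side E y y' \<or> a \<in> side E y' y" using split_tree(4)[OF tr e(1)] a by blast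
    then show ?case
    proof
      assume "a \<in> side E y y'"
      from S_step[OF e(1) this]
      show ?thesis using step.IH fin by simp
    next
      assume "a \<in> side E y' y"
      from S_step[OF e(2) this]
      have "(z y' - z y) + (\<Sum>(l, m)\<in>S y'. z l - z m) = z a - z y" using step.IH fin[of y'] by simp
      then show ?thesis by (simp add: algebra_simps)
    qed
  qed
  then show ?thesis by (simp add: S_def)
qed

text \<open>Joining the two trees by \<open>{l, m}\<close> absorbs the \<open>w {l, m}\<close>
  contained in \<open>s l m\<close> into the weight of one tree on \<open>U\<close> and leaves
  \<open>z l - z m\<close>. With the marks \<open>k\<close> of \<open>A\<close> and
  \<open>k'\<close> of \<open>B\<close> held fixed, the possible joining edges are those separating
  \<open>k\<close> from \<open>k'\<close>, so the leftover factors telescope.\<close>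

lemma sum_tree_join:
  fixes w :: "nat set \<Rightarrow> 'a::comm_ring_1" and A B z :: "nat \<Rightarrow> 'a"
  assumes U: "finite U"
    and s: "\<And>l m. l \<in> U \<Longrightarrow> m \<in> U \<Longrightarrow> l \<noteq> m \<Longrightarrow> s l m = w {l, m} * (z l - z m)"
  shows "(\<Sum>V\<in>Pow U. tree_sum w V * tree_sum w (U - V) * sum A V * sum B (U - V) *
            (\<Sum>l\<in>V. \<Sum>m\<in>U - V. s l m)) =
         tree_sum w U * (\<Sum>k\<in>U. \<Sum>k'\<in>U. A k * B k' * (z k - z k'))"
proof -
  define f where "f V E1 E2 l m = prod w E1 * prod w E2 * (sum A V * sum B (U - V)) * s l m" for V E1 E2 l m
  have "(\<Sum>V\<in>Pow U. tree_sum w V * tree_sum w (U - V) * sum A V * sum B (U - V) *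
            (\<Sum>l\<in>V. \<Sum>m\<in>U - V. s l m)) =
      (\<Sum>V\<in>Pow U. \<Sum>E1 | is_tree V E1. \<Sum>E2 | is_tree (U - V) E2. \<Sum>l\<in>V. \<Sum>m\<in>U - V. f V E1 E2 l m)"
    by (simp add: f_def tree_sum_def sum_distrib_left[symmetric] sum_distrib_right[symmetric] mult.assoc)
  also have "\<dots> = (\<Sum>E | is_tree U E. \<Sum>(l, m) | {l, m} \<in> E.
        f (side E l m) (induced E (side E l m)) (induced E (side E m l)) l m)"
    by (rule sum_tree_edges[OF U, symmetric])
  also have "\<dots> = (\<Sum>E | is_tree U E. prod w E * (\<Sum>k\<in>U. \<Sum>k'\<in>U. A k * B k' * (z k - z k')))"
  proof (intro sum.cong refl, elim CollectE)
    fix E assume tr: "is_tree U E"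
    let ?P = "{(l, m). {l, m} \<in> E}"
    have finP: "finite ?P"
    proof (rule finite_subset)
      show "?P \<subseteq> U \<times> U" using is_treeD(3,4)[OF tr] by blast
    qed (use U in simp)
    \<comment> \<open>The sums over the two sides become sums over all of \<open>U\<close> with
      indicators, so that for fixed \<open>k\<close> and \<open>k'\<close> the sum over edges can be
      carried out first.\<close>
    have "f (side E l m) (induced E (side E l m)) (induced E (side E m l)) l m =
        prod w E * ((\<Sum>k\<in>U. \<Sum>k'\<in>U. if k \<in> side E l m \<and> k' \<in> side E m l then A k * B k' * (z l - z m) else 0))"
      if lm: "{l, m} \<in> E" for l m
    proof -
      note sp = split_tree[OF tr lm]
      have U1: "U - side E l m = side E m l" using sp by blast
      have IU: "U \<inter> side E l m = side E l m" "U \<inter> side E m l = side E m l" using sp(4) by blast+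
      have "(\<Sum>k\<in>U. \<Sum>k'\<in>U. if k \<in> side E l m \<and> k' \<in> side E m l then A k * B k' * (z l - z m) else 0) =
         (\<Sum>k\<in>U. \<Sum>k'\<in>U. (if k \<in> side E l m then A k else 0) * (if k' \<in> side E m l then B k' else 0) * (z l - z m))"
        by (intro sum.cong refl) auto
      also have "\<dots> = (\<Sum>k\<in>U. if k \<in> side E l m then A k else 0) *
          (\<Sum>k'\<in>U. if k' \<in> side E m l then B k' else 0) * (z l - z m)"
        unfolding sum_product by (simp only: sum_distrib_right)
      also have "\<dots> = sum A (side E l m) * sum B (side E m l) * (z l - z m)"
        by (simp add: sum.inter_restrict[OF U, symmetric] IU)
      finally show ?thesis
        using s[of l m] is_treeD(3-5)[OF tr lm]
        by (simp add: f_def U1 prod_split_tree(2)[OF tr lm, of w] mult_ac)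
    qed
    then have "(\<Sum>(l, m)\<in>?P. f (side E l m) (induced E (side E l m)) (induced E (side E m l)) l m) =
       (\<Sum>(l, m)\<in>?P. prod w E * ((\<Sum>k\<in>U. \<Sum>k'\<in>U. if k \<in> side E l m \<and> k' \<in> side E m l then A k * B k' * (z l - z m) else 0)))"
      by (intro sum.cong refl) auto
    also have "\<dots> = prod w E * (\<Sum>k\<in>U. \<Sum>k'\<in>U. \<Sum>(l, m)\<in>?P. if k \<in> side E l m \<and> k' \<in> side E m l then A k * B k' * (z l - z m) else 0)"
      unfolding case_prod_beta sum_distrib_left[symmetric]
      by (subst sum.swap, rule arg_cong[of _ _ "(*) _"], rule sum.cong[OF refl], rule sum.swap)
    also have "(\<Sum>k\<in>U. \<Sum>k'\<in>U. \<Sum>(l, m)\<in>?P. if k \<in> side E l m \<and> k' \<in> side E m l then A k * B k' * (z l - z m) else 0) =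
       (\<Sum>k\<in>U. \<Sum>k'\<in>U. A k * B k' * (z k - z k'))"
    proof (intro sum.cong refl)
      fix k k' assume k: "k \<in> U" "k' \<in> U"
      let ?c = "\<lambda>p. k \<in> side E (fst p) (snd p) \<and> k' \<in> side E (snd p) (fst p)"
      have "(\<Sum>(l, m)\<in>?P. if k \<in> side E l m \<and> k' \<in> side E m l then A k * B k' * (z l - z m) else 0) =
        (\<Sum>p\<in>{p \<in> ?P. ?c p}. A k * B k' * (z (fst p) - z (snd p)))"
        unfolding sum.inter_filter[OF finP] by (intro sum.cong refl) (clarsimp split: prod.splits)
      also have "\<dots> = A k * B k' * (\<Sum>p\<in>{p \<in> ?P. ?c p}. z (fst p) - z (snd p))"
        by (simp add: sum_distrib_left)
      also have "{p \<in> ?P. ?c p} = {(l, m). {l, m} \<in> E \<and> k \<in> side E l m \<and> k' \<in> side E m l}" by auto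
      finally show "(\<Sum>(l, m)\<in>?P. if k \<in> side E l m \<and> k' \<in> side E m l then A k * B k' * (z l - z m) else 0) =
          A k * B k' * (z k - z k')"
        using sum_separating_edges[OF tr k, of z] by (simp add: case_prod_unfold)
    qed
    finally show "(\<Sum>(l, m)\<in>?P. f (side E l m) (induced E (side E l m)) (induced E (side E m l)) l m) =
       prod w E * (\<Sum>k\<in>U. \<Sum>k'\<in>U. A k * B k' * (z k - z k'))" .
  qed
  finally show ?thesis by (simp add: tree_sum_def sum_distrib_right)
qed

section \<open>Trees with two distinguished vertices\<close>

lemma neighbour_towards_adjacent:
  assumes tr: "is_tree W E" and rv: "r \<in> W" "v \<in> W" "r \<noteq> v"
  shows "{r, v} \<in> E \<longleftrightarrow> neighbour_towards E r v = v"
proof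
  assume "{r, v} \<in> E"
  then have vr: "{v, r} \<in> E" by (simp add: insert_commute)
  then show "neighbour_towards E r v = v"
    using neighbour_towards_eq[OF tr vr] split_tree(1)[OF tr vr] by blast
next
  assume "neighbour_towards E r v = v"
  then show "{r, v} \<in> E" using neighbour_towards(1)[OF tr rv] by (simp add: insert_commute)
qed

text \<open>The tree will be cut first at \<open>I\<close> and then at \<open>J\<close>. The second
  cut takes place in the component of \<open>l\<close>, which no longer contains \<open>I\<close>;
  since the path from \<open>J\<close> to \<open>I\<close> ends with the edge from \<open>l\<close>,
  the vertex \<open>l\<close> takes over the role of the target.\<close>

lemma neighbour_towards_cut:
  assumes tr: "is_tree W E" and IJ: "I \<in> W" "J \<in> W" "I \<noteq> J"
  defines "l \<equiv> neighbour_towards E I J"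
  assumes l: "l \<noteq> J"
  shows "neighbour_towards (induced E (side E l I)) J l = neighbour_towards E J I"
    "{J, neighbour_towards E J I} \<in> induced E (side E l I)"
proof -
  note n = neighbour_towards[OF tr IJ, folded l_def]
  note sp = split_tree[OF tr n(1)]
  let ?E = "induced E (side E l I)"
  let ?b = "neighbour_towards ?E J l"
  note n' = neighbour_towards[OF sp(5) n(2) sp(1) l[symmetric]]
  have b: "?b \<in> side E l I" using is_treeD(3)[OF sp(5) n'(1)] .
  have I: "I \<notin> side E l I" using sp(2,3) by blast
  have "conn (?E - {{?b, J}}) ?b l" using n'(2) by (simp add: side_def)
  then have "conn (E - {{?b, J}}) ?b l" by (rule conn_mono) (auto simp: induced_def)
  moreover have "adjacent (E - {{?b, J}}) l I"
    using n(1) b I IJ by (auto simp: adjacent_def doubleton_eq_iff)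
  ultimately have "I \<in> side E ?b J" unfolding side_def by (simp add: rtranclp.rtrancl_into_rtrancl)
  moreover have "{?b, J} \<in> E" using n'(1) by (simp add: induced_def)
  ultimately show *: "?b = neighbour_towards E J I" using neighbour_towards_eq[OF tr] by simp
  show "{J, neighbour_towards E J I} \<in> induced E (side E l I)"
    using n'(1) by (simp add: * insert_commute)
qed

text \<open>If \<open>I\<close> and \<open>J\<close> are not adjacent, removing the first and the
  last edge of the path between them leaves three trees: on \<open>W - V\<close> around
  \<open>I\<close>, on \<open>U\<close> in the middle, on \<open>V - U\<close> around
  \<open>J\<close>. The inner ends \<open>a\<close> and \<open>b\<close> of the removed edges range
  over \<open>U\<close> independently and may coincide, whence \<open>sum A U * sum B U\<close>. If
  \<open>I\<close> and \<open>J\<close> are adjacent there is no middle tree.\<close>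

lemma sum_tree_two_marked:
  fixes w :: "nat set \<Rightarrow> 'a::comm_ring_1" and A B :: "nat \<Rightarrow> 'a" and g :: 'a
  assumes W: "finite W" and IJ: "I \<in> W" "J \<in> W" "I \<noteq> J"
  shows "(\<Sum>E | is_tree W E. let a = neighbour_towards E I J; b = neighbour_towards E J I in
      if {I, J} \<in> E then g * (\<Prod>e\<in>E - {{I, J}}. w e)
      else A a * B b * (\<Prod>e\<in>E - {{I, a}, {J, b}}. w e)) =
    (\<Sum>V | V \<subseteq> W \<and> J \<in> V \<and> I \<notin> V. tree_sum w (W - V) *
      (g * tree_sum w V + (\<Sum>U | U \<subseteq> V \<and> J \<notin> U. sum A U * sum B U * tree_sum w U * tree_sum w (V - U))))"
proof -
  \<comment> \<open>What remains on the component of \<open>l\<close> after the cut at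
    \<open>I\<close>. For \<open>l = J\<close> there is no second cut; otherwise the edge at
    \<open>J\<close> towards \<open>l\<close> is traded for the mark \<open>B\<close>.\<close>
  define h where "h E l = (if l = J then g * prod w E
      else A l * (B (neighbour_towards E J l) * prod w (E - {{J, neighbour_towards E J l}})))" for E l
  have "(let a = neighbour_towards E I J; b = neighbour_towards E J I in
      if {I, J} \<in> E then g * (\<Prod>e\<in>E - {{I, J}}. w e)
      else A a * B b * (\<Prod>e\<in>E - {{I, a}, {J, b}}. w e)) =
    (let l = neighbour_towards E I J in
      h (induced E (side E l I)) l * prod w (induced E (side E I l)))" if tr: "is_tree W E" for E
  proof (cases "neighbour_towards E I J = J")
    case True
    then have JI: "{J, I} \<in> E" "{I, J} \<in> E"
      using neighbour_towards_adjacent[OF tr IJ] by (simp_all add: insert_commute)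
    show ?thesis
      using True JI prod_split_tree(1)[OF tr JI(1), of w] by (simp add: Let_def h_def insert_commute mult_ac)
  next
    case False
    let ?a = "neighbour_towards E I J" and ?b = "neighbour_towards E J I"
    have nadj: "{I, J} \<notin> E" using neighbour_towards_adjacent[OF tr IJ] False by simp
    note n = neighbour_towards[OF tr IJ]
    let ?E1 = "induced E (side E ?a I)" and ?E2 = "induced E (side E I ?a)"
    note c = neighbour_towards_cut[OF tr IJ False]
    have fin: "finite ?E1" "finite ?E2" using is_treeD(9)[OF tr] by (simp_all add: induced_def)
    note p = prod_split_tree[OF tr n(1)]
    have "E - {{I, ?a}, {J, ?b}} = (E - {{?a, I}}) - {{J, ?b}}" by (auto simp: insert_commute)
    also have "\<dots> = (?E1 - {{J, ?b}}) \<union> ?E2" using p(3,4) c(2) by blast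
    finally have "prod w (E - {{I, ?a}, {J, ?b}}) = prod w (?E1 - {{J, ?b}}) * prod w ?E2"
      using p(4) fin by (simp add: prod.union_disjoint disjoint_iff)
    then show ?thesis using False nadj c(1) by (simp add: Let_def h_def mult.assoc)
  qed
  then have "(\<Sum>E | is_tree W E. let a = neighbour_towards E I J; b = neighbour_towards E J I in
      if {I, J} \<in> E then g * (\<Prod>e\<in>E - {{I, J}}. w e)
      else A a * B b * (\<Prod>e\<in>E - {{I, a}, {J, b}}. w e)) =
    (\<Sum>E | is_tree W E. let l = neighbour_towards E I J in
      h (induced E (side E l I)) l * prod w (induced E (side E I l)))"
    by (intro sum.cong refl) auto
  also have "\<dots> = (\<Sum>V | V \<subseteq> W \<and> J \<in> V \<and> I \<notin> V. \<Sum>E1 | is_tree V E1. \<Sum>E2 | is_tree (W - V) E2.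
            \<Sum>l\<in>V. h E1 l * prod w E2)"
    by (rule sum_tree_cut[OF W IJ, of "\<lambda>V E1 E2 l. h E1 l * prod w E2"])
  also have "\<dots> = (\<Sum>V | V \<subseteq> W \<and> J \<in> V \<and> I \<notin> V. tree_sum w (W - V) * (\<Sum>E | is_tree V E. \<Sum>l\<in>V. h E l))"
    unfolding tree_sum_def sum_distrib_left[symmetric] sum_distrib_right[symmetric] by (simp add: mult.commute)
  also have "\<dots> = (\<Sum>V | V \<subseteq> W \<and> J \<in> V \<and> I \<notin> V. tree_sum w (W - V) *
      (g * tree_sum w V + (\<Sum>U | U \<subseteq> V \<and> J \<notin> U. sum A U * sum B U * tree_sum w U * tree_sum w (V - U))))"
  proof (intro sum.cong refl arg_cong[of _ _ "(*) _"], elim CollectE conjE)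
    fix V assume V: "V \<subseteq> W" "J \<in> V" "I \<notin> V"
    have fin: "finite V" using V W finite_subset by blast
    have "(\<Sum>E | is_tree V E. \<Sum>l\<in>V. h E l) = (\<Sum>l\<in>V. \<Sum>E | is_tree V E. h E l)" by (rule sum.swap)
    also have "\<dots> = (\<Sum>E | is_tree V E. h E J) + (\<Sum>l\<in>V - {J}. \<Sum>E | is_tree V E. h E l)"
      by (rule sum.remove[OF fin V(2)])
    also have "(\<Sum>E | is_tree V E. h E J) = g * tree_sum w V"
      by (simp add: h_def tree_sum_def sum_distrib_left)
    also have "(\<Sum>l\<in>V - {J}. \<Sum>E | is_tree V E. h E l) =
       (\<Sum>l\<in>V - {J}. \<Sum>U | U \<subseteq> V \<and> l \<in> U \<and> J \<notin> U. A l * (sum B U * tree_sum w U * tree_sum w (V - U)))"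
    proof (intro sum.cong refl)
      fix l assume "l \<in> V - {J}"
      then have l: "J \<in> V" "l \<in> V" "J \<noteq> l" using V by auto
      have "(\<Sum>E | is_tree V E. h E l) = A l * (\<Sum>E | is_tree V E. let b = neighbour_towards E J l in
          B b * (prod w (induced E (side E b J)) * prod w (induced E (side E J b))))"
        unfolding sum_distrib_left Let_def
      proof (intro sum.cong refl, elim CollectE)
        fix E assume tr: "is_tree V E"
        show "h E l = A l * (B (neighbour_towards E J l) * (prod w (induced E (side E (neighbour_towards E J l) J)) *
          prod w (induced E (side E J (neighbour_towards E J l)))))"
          using l prod_split_tree(1)[OF tr neighbour_towards(1)[OF tr l], of w] by (simp add: h_def insert_commute)
      qed
      also have "(\<Sum>E | is_tree V E. let b = neighbour_towards E J l in
          B b * (prod w (induced E (side E b J)) * prod w (induced E (side E J b)))) =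
        (\<Sum>U | U \<subseteq> V \<and> l \<in> U \<and> J \<notin> U. \<Sum>E1 | is_tree U E1. \<Sum>E2 | is_tree (V - U) E2.
            \<Sum>b\<in>U. B b * (prod w E1 * prod w E2))"
        by (rule sum_tree_cut[OF fin l, of "\<lambda>U E1 E2 b. B b * (prod w E1 * prod w E2)"])
      also have "\<dots> = (\<Sum>U | U \<subseteq> V \<and> l \<in> U \<and> J \<notin> U. sum B U * tree_sum w U * tree_sum w (V - U))"
        unfolding tree_sum_def sum_distrib_left[symmetric] sum_distrib_right[symmetric] by (simp add: mult.assoc)
      finally show "(\<Sum>E | is_tree V E. h E l) =
        (\<Sum>U | U \<subseteq> V \<and> l \<in> U \<and> J \<notin> U. A l * (sum B U * tree_sum w U * tree_sum w (V - U)))"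
        by (simp add: sum_distrib_left)
    qed
    \<comment> \<open>Exchanging the sums turns \<open>l\<close> from a prescribed element of
      \<open>U\<close> into a free one, which produces the factor \<open>sum A U\<close>.\<close>
    also have "\<dots> = (\<Sum>U | U \<subseteq> V \<and> J \<notin> U. \<Sum>l | l \<in> V - {J} \<and> l \<in> U. A l * (sum B U * tree_sum w U * tree_sum w (V - U)))"
      using fin by (subst sum.swap_restrict[symmetric]) (auto intro!: sum.cong)
    also have "\<dots> = (\<Sum>U | U \<subseteq> V \<and> J \<notin> U. sum A U * sum B U * tree_sum w U * tree_sum w (V - U))"
    proof (intro sum.cong refl, elim CollectE conjE)
      fix U assume "U \<subseteq> V" "J \<notin> U"
      then have "{l. l \<in> V - {J} \<and> l \<in> U} = U" by blast
      then show "(\<Sum>l | l \<in> V - {J} \<and> l \<in> U. A l * (sum B U * tree_sum w U * tree_sum w (V - U))) =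
          sum A U * sum B U * tree_sum w U * tree_sum w (V - U)"
        by (simp add: sum_distrib_right mult.assoc)
    qed
    finally show "(\<Sum>E | is_tree V E. \<Sum>l\<in>V. h E l) =
      g * tree_sum w V + (\<Sum>U | U \<subseteq> V \<and> J \<notin> U. sum A U * sum B U * tree_sum w U * tree_sum w (V - U))" .
  qed
  finally show ?thesis .
qed

section \<open>Square-zero parameters\<close>

lemma ncoeff_add: "ncoeff (a + b) S = ncoeff a S + (ncoeff b S :: 'a::comm_ring_1)"
  by (simp add: plus_nilalg.rep_eq)

lemma ncoeff_diff: "ncoeff (a - b) S = ncoeff a S - (ncoeff b S :: 'a::comm_ring_1)"
  by (simp add: minus_nilalg.rep_eq)

lemma ncoeff_sum: "ncoeff (\<Sum>i\<in>I. f i) S = (\<Sum>i\<in>I. ncoeff (f i) S :: 'a::comm_ring_1)"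
  by (induction I rule: infinite_finite_induct) (simp_all add: zero_nilalg.rep_eq ncoeff_add)

lemma ncoeff_nconst_mult: "ncoeff (nconst c * a) S = c * (ncoeff a S :: 'a::comm_ring_1)"
proof (cases "finite S")
  case True
  have "ncoeff (nconst c * a) S = (\<Sum>T\<in>Pow S. if T = {} then c * ncoeff a S else 0)"
    unfolding times_nilalg.rep_eq nconst.rep_eq by (rule sum.cong) auto
  then show ?thesis using True by simp
qed (simp add: ncoeff_infinite)

lemma ncoeff_eps_mult:
  assumes "finite S" "i \<notin> S"
  shows "ncoeff (eps i * a) (insert i S) = (ncoeff a S :: 'a::comm_ring_1)"
proof -
  have "ncoeff (eps i * a) (insert i S) = (\<Sum>T\<in>Pow (insert i S). if T = {i} then ncoeff a S else 0)"
    unfolding times_nilalg.rep_eq eps.rep_eq using assms by (intro sum.cong) auto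
  then show ?thesis using assms by (simp add: sum.delta)
qed

lemma nconst_prod: "(\<Prod>i\<in>A. nconst (f i)) = (nconst (\<Prod>i\<in>A. f i) :: 'a::comm_ring_1 nilalg)"
proof -
  have "nconst 1 = (1 :: 'a nilalg)" by transfer auto
  then show ?thesis by (induction A rule: infinite_finite_induct) (simp_all add: nconst_mult)
qed

section \<open>Differentiation in the parameters and the exponential series\<close>

lemma sum_Pow_insert:
  assumes "finite S" "v \<notin> S"
  shows "(\<Sum>T\<in>Pow (insert v S). f T) = (\<Sum>T\<in>Pow S. f T) + (\<Sum>T\<in>Pow S. f (insert v T))"
proof -
  have "inj_on (insert v) (Pow S)" using assms by (auto simp: inj_on_def)
  moreover have "Pow S \<inter> insert v ` Pow S = {}" using assms by auto
  ultimately show ?thesis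
    unfolding Pow_insert using assms by (simp add: sum.union_disjoint sum.reindex)
qed

text \<open>The Leibniz rule: in a splitting of \<open>insert v S\<close> the label \<open>v\<close>
  goes either to the first factor or to the second.\<close>

lemma ncoeff_mult_insert:
  fixes a b :: "'a::comm_ring_1 nilalg"
  assumes S: "finite S" "v \<notin> S"
  shows "ncoeff (a * b) (insert v S) = ncoeff (neps_deriv v a * b) S + ncoeff (a * neps_deriv v b) S"
proof -
  have "ncoeff a T * ncoeff b (insert v S - T) = ncoeff a T * ncoeff (neps_deriv v b) (S - T)"
    "ncoeff a (insert v T) * ncoeff b (insert v S - insert v T) = ncoeff (neps_deriv v a) T * ncoeff b (S - T)"
    if "T \<subseteq> S" for T
  proof -
    have *: "insert v S - T = insert v (S - T)" "insert v S - insert v T = S - T" "v \<notin> T" "v \<notin> S - T"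
      using that S by auto
    show "ncoeff a T * ncoeff b (insert v S - T) = ncoeff a T * ncoeff (neps_deriv v b) (S - T)"
      "ncoeff a (insert v T) * ncoeff b (insert v S - insert v T) = ncoeff (neps_deriv v a) T * ncoeff b (S - T)"
      using * by (simp_all add: neps_deriv.rep_eq)
  qed
  then show ?thesis
    unfolding times_nilalg.rep_eq sum_Pow_insert[OF S] by (simp add: add.commute)
qed

lemma ncoeff_power_insert:
  fixes a :: "'a::comm_ring_1 nilalg"
  assumes "finite S" "v \<notin> S"
  shows "ncoeff (a ^ Suc k) (insert v S) = of_nat (Suc k) * ncoeff (neps_deriv v a * a ^ k) S"
  using assms
proof (induction k arbitrary: S)
  case 0
  then show ?case by (simp add: neps_deriv.rep_eq)
next
  case (Suc k)
  have "ncoeff (neps_deriv v (a ^ Suc k)) T = of_nat (Suc k) * ncoeff (neps_deriv v a * a ^ k) T" if "T \<subseteq> S" for T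
    using Suc.IH[of T] Suc.prems that finite_subset[OF that] by (auto simp: neps_deriv.rep_eq)
  then have "ncoeff (a * neps_deriv v (a ^ Suc k)) S = of_nat (Suc k) * ncoeff (a * (neps_deriv v a * a ^ k)) S"
    unfolding times_nilalg.rep_eq[of a] by (simp add: sum_distrib_left mult_ac)
  also have "a * (neps_deriv v a * a ^ k) = neps_deriv v a * a ^ Suc k" by (simp add: mult_ac)
  finally show ?case
    using ncoeff_mult_insert[OF Suc.prems, of a "a ^ Suc k"] by (simp add: algebra_simps)
qed

text \<open>The exponent may have a nonzero constant coefficient, so the series need not terminate
  and convergence has to be shown. At the empty set it is the ordinary exponential series; a larger
  set is reached through the differential equation of the exponential, which expresses its
  coefficient by those of smaller sets. Convergence and the recursion thus come from the same
  step.\<close>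

lemma nexp_sums:
  assumes "finite S"
  shows "(\<lambda>k. ncoeff (a ^ k) S / fact k) sums ncoeff (nexp a) S"
    and nexp_insert: "S = insert v S' \<Longrightarrow> v \<notin> S' \<Longrightarrow>
      ncoeff (nexp a) S = (\<Sum>T\<in>Pow S'. ncoeff a (insert v T) * ncoeff (nexp a) (S' - T))"
proof -
  have step: "(\<lambda>k. ncoeff (a ^ k) (insert v S') / fact k) sums
      (\<Sum>T\<in>Pow S'. ncoeff a (insert v T) * ncoeff (nexp a) (S' - T))"
    if S': "finite S'" "v \<notin> S'" and IH: "\<And>T. T \<subseteq> S' \<Longrightarrow> (\<lambda>k. ncoeff (a ^ k) T / fact k) sums ncoeff (nexp a) T"
    for v S'
  proof -
    have "(\<lambda>k. \<Sum>T\<in>Pow S'. ncoeff a (insert v T) * (ncoeff (a ^ k) (S' - T) / fact k)) sums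
      (\<Sum>T\<in>Pow S'. ncoeff a (insert v T) * ncoeff (nexp a) (S' - T))"
      by (intro sums_sum sums_mult IH) auto
    moreover have "(\<Sum>T\<in>Pow S'. ncoeff a (insert v T) * (ncoeff (a ^ k) (S' - T) / fact k)) =
        ncoeff (a ^ Suc k) (insert v S') / fact (Suc k)" for k
    proof -
      have "ncoeff (neps_deriv v a * a ^ k) S' = (\<Sum>T\<in>Pow S'. ncoeff a (insert v T) * ncoeff (a ^ k) (S' - T))"
        unfolding times_nilalg.rep_eq neps_deriv.rep_eq using S' by (intro sum.cong) auto
      then show ?thesis
        unfolding ncoeff_power_insert[OF S'] by (simp add: sum_divide_distrib del: of_nat_Suc)
    qed
    ultimately have "(\<lambda>k. ncoeff (a ^ Suc k) (insert v S') / fact (Suc k)) sums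
      (\<Sum>T\<in>Pow S'. ncoeff a (insert v T) * ncoeff (nexp a) (S' - T))" by simp
    \<comment> \<open>The term \<open>k = 0\<close> added here is a coefficient of 1 at a nonempty
      set, hence zero.\<close>
    from sums_Suc[OF this] show ?thesis by (simp add: one_nilalg.rep_eq)
  qed
  have *: "(\<lambda>k. ncoeff (a ^ k) S / fact k) sums ncoeff (nexp a) S" if "finite S" for S
    using that
  proof (induction S rule: finite_psubset_induct)
    case (psubset S)
    have "summable (\<lambda>k. ncoeff (a ^ k) S / fact k)"
    proof (cases "S = {}")
      case True
      have "ncoeff (a ^ k) {} = ncoeff a {} ^ k" for k
        by (induction k) (simp_all add: one_nilalg.rep_eq times_nilalg.rep_eq)
      then show ?thesis
        using summable_exp_generic[of "ncoeff a {}"] by (simp add: True scaleR_conv_of_real field_simps)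
    next
      case False
      then obtain v S' where S: "S = insert v S'" "v \<notin> S'" by (meson mk_disjoint_insert ex_in_conv)
      have fin: "finite S'" using psubset.hyps S by simp
      show ?thesis unfolding S(1)
        by (rule sums_summable, rule step[OF fin S(2)], rule psubset.IH) (use S in auto)
    qed
    then show ?case using psubset.hyps by (simp add: ncoeff_nexp summable_sums)
  qed
  show "(\<lambda>k. ncoeff (a ^ k) S / fact k) sums ncoeff (nexp a) S" using * assms .
  show "ncoeff (nexp a) S = (\<Sum>T\<in>Pow S'. ncoeff a (insert v T) * ncoeff (nexp a) (S' - T))"
    if "S = insert v S'" "v \<notin> S'"
  proof -
    have fin: "finite S'" using assms that by simp
    have "(\<lambda>k. ncoeff (a ^ k) S / fact k) sums (\<Sum>T\<in>Pow S'. ncoeff a (insert v T) * ncoeff (nexp a) (S' - T))"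
      unfolding that(1) by (rule step[OF fin that(2)], rule *) (use fin finite_subset in blast)
    then show ?thesis using *[OF assms] sums_unique2 by blast
  qed
qed

lemma nexp_empty: "ncoeff (nexp a) {} = exp (ncoeff a {})"
proof -
  have "ncoeff (a ^ k) {} = ncoeff a {} ^ k" for k
    by (induction k) (simp_all add: one_nilalg.rep_eq times_nilalg.rep_eq)
  then have "(\<lambda>k. ncoeff (a ^ k) {} / fact k) sums exp (ncoeff a {})"
    using exp_converges[of "ncoeff a {}"] by (simp add: scaleR_conv_of_real field_simps)
  then show ?thesis using nexp_sums(1)[of "{}" a] sums_unique2 by blast
qed

text \<open>Cutting all edges at the root \<open>r\<close> leaves a forest, so rooted trees are generated by an exponential.\<close>

lemma nexp_tree_sum:
  fixes w :: "nat set \<Rightarrow> complex"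
  assumes U: "finite U" "r \<notin> U"
    and a: "\<And>S. S \<subseteq> U \<Longrightarrow> S \<noteq> {} \<Longrightarrow> ncoeff a S = (\<Sum>k\<in>S. w {k, r}) * tree_sum w S * e S"
    and e: "e {} = 1" "\<And>S T. S \<subseteq> U \<Longrightarrow> T \<subseteq> U \<Longrightarrow> S \<inter> T = {} \<Longrightarrow> e (S \<union> T) = e S * e T"
    and S: "S \<subseteq> U"
  shows "ncoeff (nexp a) S = exp (ncoeff a {}) * tree_sum w (insert r S) * e S"
  using finite_subset[OF S U(1)] S
proof (induction S rule: finite_psubset_induct)
  case (psubset S)
  show ?case
  proof (cases "S = {}")
    case True
    then show ?thesis by (simp add: nexp_empty e)
  next
    case False
    then obtain v S' where S: "S = insert v S'" "v \<notin> S'" by (meson mk_disjoint_insert ex_in_conv)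
    have fin: "finite S'" using psubset.hyps S by simp
    have v: "v \<noteq> r" "v \<in> U" "S' \<subseteq> U" "r \<notin> S'" using psubset.prems U S by auto
    \<comment> \<open>The differential equation picks the branch at the root that contains
      \<open>v\<close>; cutting the edge at \<open>r\<close> towards \<open>v\<close> gives the same
      recursion on the tree side. Any \<open>v\<close> in \<open>S\<close> serves.\<close>
    have "ncoeff (nexp a) S = (\<Sum>T\<in>Pow S'. ncoeff a (insert v T) * ncoeff (nexp a) (S' - T))"
      by (rule nexp_insert[OF psubset.hyps S])
    also have "\<dots> = (\<Sum>T\<in>Pow S'. exp (ncoeff a {}) * e S *
        ((\<Sum>k\<in>insert v T. w {k, r}) * tree_sum w (insert v T) * tree_sum w (insert r S - insert v T)))"
    proof (intro sum.cong refl)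
      fix T assume "T \<in> Pow S'"
      then have T: "T \<subseteq> S'" by simp
      have IH: "ncoeff (nexp a) (S' - T) = exp (ncoeff a {}) * tree_sum w (insert r (S' - T)) * e (S' - T)"
        by (rule psubset.IH) (use S v in auto)
      have "e S = e (insert v T \<union> (S' - T))" using S T by (intro arg_cong[of _ _ e]) auto
      also have "\<dots> = e (insert v T) * e (S' - T)" by (rule e(2)) (use T v S in auto)
      finally have eS: "e S = e (insert v T) * e (S' - T)" .
      have "insert r S - insert v T = insert r (S' - T)" using S T v by auto
      moreover have "ncoeff a (insert v T) = (\<Sum>k\<in>insert v T. w {k, r}) * tree_sum w (insert v T) * e (insert v T)"
        by (rule a) (use T v in auto)
      ultimately show "ncoeff a (insert v T) * ncoeff (nexp a) (S' - T) = exp (ncoeff a {}) * e S *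
        ((\<Sum>k\<in>insert v T. w {k, r}) * tree_sum w (insert v T) * tree_sum w (insert r S - insert v T))"
        by (simp only: IH eS mult_ac)
    qed
    also have "\<dots> = exp (ncoeff a {}) * e S * (\<Sum>T\<in>Pow S'.
        (\<Sum>k\<in>insert v T. w {k, r}) * tree_sum w (insert v T) * tree_sum w (insert r S - insert v T))"
      by (simp only: sum_distrib_left)
    also have "(\<Sum>T\<in>Pow S'.
        (\<Sum>k\<in>insert v T. w {k, r}) * tree_sum w (insert v T) * tree_sum w (insert r S - insert v T)) =
      (\<Sum>V | V \<subseteq> insert r S \<and> v \<in> V \<and> r \<notin> V. (\<Sum>l\<in>V. w {l, r}) * tree_sum w V * tree_sum w (insert r S - V))"
      by (rule sum.reindex_bij_witness[of _ "\<lambda>V. V - {v}" "insert v"]) (use S v in \<open>auto simp: insert_absorb\<close>)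
    also have "\<dots> = tree_sum w (insert r S)"
      by (rule tree_sum_rec[symmetric]) (use psubset.hyps S v in auto)
    finally show ?thesis by (simp add: mult_ac)
  qed
qed

text \<open>Plane waves are multiplicative over disjoint label sets, so the common factor leaves the
  convolution and only the amplitudes are convolved.\<close>

lemma ncoeff_mult_phase:
  fixes a b :: "complex nilalg"
  assumes e: "\<And>T. T \<subseteq> S \<Longrightarrow> e T * e (S - T) = e S"
    and ab: "\<And>T. T \<subseteq> S \<Longrightarrow> ncoeff a T = a' T * e T" "\<And>T. T \<subseteq> S \<Longrightarrow> ncoeff b T = b' T * e T"
  shows "ncoeff (a * b) S = (\<Sum>T\<in>Pow S. a' T * b' (S - T)) * e S"
proof -
  have "ncoeff a T * ncoeff b (S - T) = a' T * b' (S - T) * e S" if "T \<subseteq> S" for T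
    using ab(1)[OF that] ab(2)[of "S - T"] e[OF that, symmetric] by simp
  then show ?thesis by (simp add: times_nilalg.rep_eq sum_distrib_right)
qed

lemma ncoeff_foldr_neps_deriv:
  "distinct xs \<Longrightarrow> S \<inter> set xs = {} \<Longrightarrow> ncoeff (foldr neps_deriv xs a) S = ncoeff a (S \<union> set xs)"
proof (induction xs arbitrary: S)
  case (Cons x xs)
  then have "x \<notin> S" "insert x S \<inter> set xs = {}" by auto
  then show ?case using Cons by (simp add: neps_deriv.rep_eq)
qed simp

section \<open>Plane waves\<close>

definition phase :: "(nat \<Rightarrow> complex) \<Rightarrow> (nat \<Rightarrow> complex) \<Rightarrow> (nat \<Rightarrow> complex) \<Rightarrow> point \<Rightarrow> nat set \<Rightarrow> complex" where
  "phase om z zb X S = exp (\<i> * pairing (\<Sum>k\<in>S. momentum om z zb k) X)"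

lemma pairing_add: "pairing (P + Q) X = pairing P X + pairing Q X"
  by (simp add: pairing_def algebra_simps sum.distrib)

lemma pairing_sum: "pairing (\<Sum>k\<in>S. P k) X = (\<Sum>k\<in>S. pairing (P k) X)"
  by (induction S rule: infinite_finite_induct) (simp_all add: pairing_add, simp_all add: pairing_def)

lemma pairing_upd: "pairing P (\<chi> d. if d = c then s else X $ d) = pairing P X + P $ c * (s - X $ c)"
proof -
  have "pairing P (\<chi> d. if d = c then s else X $ d) =
      (\<Sum>d\<in>UNIV. P $ d * X $ d + (if d = c then P $ c * (s - X $ c) else 0))"
    unfolding pairing_def by (rule sum.cong) (auto simp: algebra_simps)
  then show ?thesis by (simp add: sum.distrib pairing_def)
qed

lemma phase_empty [simp]: "phase om z zb X {} = 1"
  by (simp add: phase_def pairing_def)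

lemma phase_Un:
  "finite S \<Longrightarrow> finite T \<Longrightarrow> S \<inter> T = {} \<Longrightarrow>
    phase om z zb X (S \<union> T) = phase om z zb X S * phase om z zb X T"
  by (simp add: phase_def sum.union_disjoint pairing_add distrib_left exp_add)

lemma finite_subtrees: "subtrees N = (SIGMA V:Pow {1..N}. {E. is_tree V E})" "finite (subtrees N)"
proof -
  show "subtrees N = (SIGMA V:Pow {1..N}. {E. is_tree V E})"
    by (auto simp: subtrees_def)
  then show "finite (subtrees N)" by (simp add: finite_trees)
qed

context
  fixes N :: nat and om z zb :: "nat \<Rightarrow> complex"
begin

abbreviation "edge_weight \<equiv> edge_factor (kap z) (kapt om zb)"

lemma ncoeff_phi_tree:
  assumes "finite V"
  shows "ncoeff (phi_tree om z zb (V, E) X) S = (if S = V then prod edge_weight E * phase om z zb X V else 0)"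
proof -
  have "(\<Prod>k\<in>V. seed om z zb k X) =
      nconst (phase om z zb X V) * (\<Prod>k\<in>V. eps k)"
    using assms by (simp add: seed_def prod.distrib nconst_prod phase_def pairing_sum sum_distrib_left exp_sum mult.commute)
  then show ?thesis
    using assms by (simp add: phi_tree_def ncoeff_nconst_mult ncoeff_prod_eps)
qed

text \<open>A tree carries the monomial of its node set, so the coefficient at \<open>S\<close>
  selects the trees with vertex set exactly \<open>S\<close>. Their weight does not depend on the
  marked node, which lets \<open>sum c S\<close> factor off.\<close>

lemma ncoeff_node_sum:
  "ncoeff (\<Sum>t\<in>subtrees N. \<Sum>k\<in>fst t. nconst (c k) * phi_tree om z zb t X) S =
    (if S \<subseteq> {1..N} then tree_sum edge_weight S * sum c S * phase om z zb X S else 0)"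
proof -
  have fin: "finite V" if "V \<in> Pow {1..N}" for V using that finite_subset by auto
  have "ncoeff (\<Sum>t\<in>subtrees N. \<Sum>k\<in>fst t. nconst (c k) * phi_tree om z zb t X) S =
    (\<Sum>V\<in>Pow {1..N}. \<Sum>E | is_tree V E. \<Sum>k\<in>V. c k * ncoeff (phi_tree om z zb (V, E) X) S)"
    unfolding finite_subtrees(1) ncoeff_sum ncoeff_nconst_mult
    by (subst sum.Sigma) (simp_all add: finite_trees case_prod_unfold)
  also have "\<dots> = (\<Sum>V\<in>Pow {1..N}. if V = S then \<Sum>E | is_tree V E. \<Sum>k\<in>V. c k * (prod edge_weight E * phase om z zb X V) else 0)"
    by (intro sum.cong refl) (simp add: ncoeff_phi_tree fin)
  also have "\<dots> = (if S \<subseteq> {1..N} then \<Sum>E | is_tree S E. \<Sum>k\<in>S. c k * (prod edge_weight E * phase om z zb X S) else 0)"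
    by simp
  also have "(\<Sum>E | is_tree S E. \<Sum>k\<in>S. c k * (prod edge_weight E * phase om z zb X S)) = tree_sum edge_weight S * sum c S * phase om z zb X S"
    unfolding tree_sum_def sum_distrib_left[symmetric] sum_distrib_right[symmetric]
    by (simp add: mult_ac)
  finally show ?thesis .
qed

text \<open>For \<open>\<xi>\<close> equal to \<open>kapt om zb L\<close> each term is the weight of
  an edge joining \<open>L\<close> to a node of \<open>S\<close>. A general \<open>\<xi>\<close>
  replaces the spinor of \<open>L\<close> in the numerator, as for the two special edges in
  \<open>tree_weight\<close>.\<close>

definition node_sum :: "nat \<Rightarrow> spinor \<Rightarrow> nat set \<Rightarrow> complex" where
  "node_sum L \<xi> S = (\<Sum>k\<in>S. sqb \<xi> (kapt om zb k) / ang (kap z L) (kap z k))"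

lemma ncoeff_F_contr:
  assumes "finite S"
  shows "ncoeff (F_contr N om z zb L \<xi> X) S =
    (if S = {} then \<xi> $ 1 * (X $ Cw - z L * X $ Cub) + \<xi> $ 2 * (X $ Cu - z L * X $ Cwb) else 0) -
    \<i> * (if S \<subseteq> {1..N} then tree_sum edge_weight S * node_sum L \<xi> S * phase om z zb X S else 0)"
  unfolding F_contr_def ncoeff_diff ncoeff_nconst_mult ncoeff_node_sum node_sum_def[symmetric]
  by (simp add: nconst.rep_eq node_sum_def)

lemma deriv_phase:
  "((\<lambda>s. phase om z zb (\<chi> d. if d = c then s else X $ d) S) has_field_derivative
    \<i> * (\<Sum>k\<in>S. momentum om z zb k $ c) * phase om z zb X S) (at (X $ c))"
  unfolding phase_def pairing_upd by (auto intro!: derivative_eq_intros)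

definition H_contr :: "nat \<Rightarrow> spinor \<Rightarrow> 2 \<Rightarrow> point \<Rightarrow> complex nilalg" where
  "H_contr L \<xi> A' X = (\<Sum>C'\<in>UNIV. nconst (\<xi> $ C') * H_mat N om z zb L A' C' X)"

text \<open>Differentiating a plane wave brings down \<open>\<i>\<close> times the total momentum,
  and this \<open>\<i>\<close> combines with the \<open>- \<i>\<close> before the tree sum to 1. The
  derivatives of the linear part of \<open>F_up\<close> form the identity matrix.\<close>

lemma ncoeff_H_mat:
  assumes S: "finite S"
  shows "ncoeff (H_mat N om z zb L A' C' X) S = (if S = {} then (if A' = C' then 1 else 0) else 0) +
    (if S \<subseteq> {1..N} then tree_sum edge_weight S * node_sum L (axis C' 1) S * (\<Sum>k\<in>S. kapt om zb k $ A')
       * phase om z zb X S else 0)"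
proof -
  define g where "g = (if S \<subseteq> {1..N} then tree_sum edge_weight S * node_sum L (axis C' 1) S else 0)"
  define lin where "lin Y = (if S = {} then (axis C' 1 :: spinor) $ 1 * (Y $ Cw - z L * Y $ Cub) +
      (axis C' 1 :: spinor) $ 2 * (Y $ Cu - z L * Y $ Cwb) else 0)" for Y :: point
  define c where "c = (if A' = 1 then Cw else Cu)"
  have A': "A' = 1 \<or> A' = 2" using exhaust_2 by blast
  have C': "C' = 1 \<or> C' = 2" using exhaust_2 by blast
  have F: "ncoeff (F_up N om z zb L C' Y) S = lin Y - \<i> * (g * phase om z zb Y S)" for Y
    unfolding F_up_def ncoeff_F_contr[OF S] lin_def g_def by simp
  have 1: "((\<lambda>s. lin (\<chi> d. if d = c then s else X $ d)) has_field_derivative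
      (if S = {} then (if A' = C' then 1 else 0) else 0)) (at (X $ c))"
    using A' C' unfolding lin_def c_def axis_def
    by (auto intro!: derivative_eq_intros)
  have "((\<lambda>s. ncoeff (F_up N om z zb L C' (\<chi> d. if d = c then s else X $ d)) S) has_field_derivative
     (if S = {} then (if A' = C' then 1 else 0) else 0) -
     \<i> * (g * (\<i> * (\<Sum>k\<in>S. momentum om z zb k $ c) * phase om z zb X S))) (at (X $ c))"
    unfolding F by (intro DERIV_diff 1 DERIV_cmult deriv_phase)
  then have "ncoeff (pd c (F_up N om z zb L C') X) S = (if S = {} then (if A' = C' then 1 else 0) else 0) +
     g * (\<Sum>k\<in>S. momentum om z zb k $ c) * phase om z zb X S"
    unfolding ncoeff_pd by (subst DERIV_imp_deriv) (auto simp: algebra_simps)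
  \<comment> \<open>The \<open>Cw\<close> and \<open>Cu\<close> components of the momentum are the
    two components of \<open>kapt\<close>; this is why the derivatives produce dotted
    spinors.\<close>
  moreover have "momentum om z zb k $ c = kapt om zb k $ A'" for k
    using A' by (auto simp: c_def momentum_def kapt_def)
  moreover have "H_mat N om z zb L A' C' X = pd c (F_up N om z zb L C') X"
    by (simp add: H_mat_def c_def)
  ultimately show ?thesis by (simp add: g_def)
qed

lemma node_sum_axis: "(\<Sum>C'\<in>UNIV. \<xi> $ C' * node_sum L (axis C' 1) S) = node_sum L \<xi> S"
proof -
  have "sqb \<xi> \<mu> / d = \<xi> $ 1 * (sqb (axis 1 1) \<mu> / d) + \<xi> $ 2 * (sqb (axis 2 1) \<mu> / d)" for \<mu> d
    by (simp add: sqb_eq axis_def algebra_simps diff_divide_distrib)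
  then show ?thesis
    by (simp add: sum_2 node_sum_def sum_distrib_left sum.distrib[symmetric])
qed

lemma ncoeff_H_contr:
  assumes S: "S \<subseteq> {1..N}"
  shows "ncoeff (H_contr L \<xi> A' X) S = ((if S = {} then \<xi> $ A' else 0) +
    tree_sum edge_weight S * node_sum L \<xi> S * (\<Sum>k\<in>S. kapt om zb k $ A')) * phase om z zb X S"
proof -
  have fin: "finite S" using S finite_subset by auto
  have "ncoeff (H_contr L \<xi> A' X) S = (\<Sum>C'\<in>UNIV. \<xi> $ C' * (if S = {} then (if A' = C' then 1 else 0) else 0) +
    tree_sum edge_weight S * (\<xi> $ C' * node_sum L (axis C' 1) S) * (\<Sum>k\<in>S. kapt om zb k $ A') * phase om z zb X S)"
    unfolding H_contr_def ncoeff_sum ncoeff_nconst_mult ncoeff_H_mat[OF fin]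
    using S by (simp add: algebra_simps)
  also have "\<dots> = (if S = {} then \<xi> $ A' else 0) +
     tree_sum edge_weight S * (\<Sum>C'\<in>UNIV. \<xi> $ C' * node_sum L (axis C' 1) S) * (\<Sum>k\<in>S. kapt om zb k $ A') * phase om z zb X S"
    unfolding sum.distrib sum_distrib_left[symmetric] sum_distrib_right[symmetric]
    by (simp add: if_distrib[of "(*) _"] sum.delta cong: if_cong)
  finally show ?thesis unfolding node_sum_axis by (auto simp: algebra_simps)
qed

text \<open>Contraction with \<open>kapt om zb L\<close> makes \<open>node_sum\<close> a sum of
  weights of edges ending at \<open>L\<close>, which is the hypothesis of the exponential formula
  with root \<open>L\<close>.\<close>

lemma ncoeff_exp_F:
  assumes S: "S \<subseteq> {1..N}" and L: "L \<notin> {1..N}"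
  shows "ncoeff (nexp (nconst \<i> * F_scalar N om z zb L X)) S =
    phase om z zb X {L} * tree_sum edge_weight (insert L S) * phase om z zb X S"
proof -
  have F: "F_scalar N om z zb L X = F_contr N om z zb L (kapt om zb L) X"
    unfolding F_scalar_def by (rule F_up_contraction)
  have "ncoeff (nexp (nconst \<i> * F_scalar N om z zb L X)) S =
     exp (ncoeff (nconst \<i> * F_scalar N om z zb L X) {}) * tree_sum edge_weight (insert L S) * phase om z zb X S"
  proof (rule nexp_tree_sum[where U = "{1..N}" and e = "phase om z zb X"])
    fix T assume T: "T \<subseteq> {1..N}" "T \<noteq> {}"
    then have fin: "finite T" using finite_subset by auto
    have "node_sum L (kapt om zb L) T = (\<Sum>k\<in>T. edge_weight {k, L})"
      unfolding node_sum_def edge_factor_pair[symmetric] by (simp add: insert_commute)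
    then show "ncoeff (nconst \<i> * F_scalar N om z zb L X) T = (\<Sum>k\<in>T. edge_weight {k, L}) * tree_sum edge_weight T * phase om z zb X T"
      unfolding F ncoeff_nconst_mult ncoeff_F_contr[OF fin] using T by (simp add: mult_ac)
  next
    fix S T assume "S \<subseteq> {1..N}" "T \<subseteq> {1..N}" "S \<inter> T = {}"
    then show "phase om z zb X (S \<union> T) = phase om z zb X S * phase om z zb X T"
      by (intro phase_Un) (auto intro: finite_subset)
  qed (use S L in simp_all)
  \<comment> \<open>The constant coefficient of \<open>F_scalar\<close> is the pairing of the
    momentum of \<open>L\<close> with \<open>X\<close>, so the exponential also supplies the plane
    wave of \<open>L\<close> itself.\<close>
  also have "exp (ncoeff (nconst \<i> * F_scalar N om z zb L X) {}) = phase om z zb X {L}"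
    unfolding F ncoeff_nconst_mult ncoeff_F_contr[OF finite.emptyI]
    by (simp add: phase_def pairing_momentum kapt_def algebra_simps)
  finally show ?thesis .
qed

end

section \<open>Products of one-forms\<close>

definition one_form :: "(coord \<Rightarrow> 'a::comm_ring_1) \<Rightarrow> 'a form" where
  "one_form a = (\<chi> S. \<Sum>c\<in>UNIV. if S = {c} then a c else 0)"

lemma one_form_component: "one_form a $ S = (if \<exists>c. S = {c} then a (the_elem S) else 0)"
proof (cases "\<exists>c. S = {c}")
  case True
  then show ?thesis by (auto simp: one_form_def)
next
  case False
  then have "S \<noteq> {c}" for c by blast
  then show ?thesis using False by (simp add: one_form_def)
qed

lemma wedge_add_left: "(\<alpha> + \<beta>) \<and>\<^sub>F \<gamma> = \<alpha> \<and>\<^sub>F \<gamma> + \<beta> \<and>\<^sub>F \<gamma>"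
  by (simp add: wedge_def vec_eq_iff algebra_simps sum.distrib)

lemma wedge_scale_left: "(c *s \<alpha>) \<and>\<^sub>F \<beta> = c *s (\<alpha> \<and>\<^sub>F \<beta>)"
  by (simp add: wedge_def vec_eq_iff sum_distrib_left mult_ac)

lemma wedge_scale_right: "\<alpha> \<and>\<^sub>F (c *s \<beta>) = c *s (\<alpha> \<and>\<^sub>F \<beta>)"
  by (simp add: wedge_def vec_eq_iff sum_distrib_left mult_ac)

text \<open>The second factor lives on singletons, so only the complements of single elements
  survive in the sum over subsets. The sign counts the coordinates that \<open>c\<close> has to
  pass; written as a product it can be evaluated by rewriting once \<open>S\<close> is
  explicit.\<close>

lemma wedge_one_form:
  "(\<omega> \<and>\<^sub>F one_form a) $ S =
    (\<Sum>c\<in>S. (\<Prod>i\<in>S. if coord_pos c < coord_pos i then -1 else 1) * a c * \<omega> $ (S - {c}))"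
proof -
  have sgn: "(-1 :: 'a) ^ card {(i, j). i \<in> S - {c} \<and> j \<in> S - (S - {c}) \<and> coord_pos j < coord_pos i} =
      (\<Prod>i\<in>S. if coord_pos c < coord_pos i then -1 else 1)" if c: "c \<in> S" for c
  proof -
    have "{(i, j). i \<in> S - {c} \<and> j \<in> S - (S - {c}) \<and> coord_pos j < coord_pos i} =
        (\<lambda>i. (i, c)) ` {i \<in> S. coord_pos c < coord_pos i}" using c by auto
    then have "card {(i, j). i \<in> S - {c} \<and> j \<in> S - (S - {c}) \<and> coord_pos j < coord_pos i} =
        card {i \<in> S. coord_pos c < coord_pos i}" by (simp add: card_image inj_on_def)
    then show ?thesis by (simp add: prod.If_cases Int_def)
  qed
  have "(\<omega> \<and>\<^sub>F one_form a) $ S = (\<Sum>T\<in>(\<lambda>c. S - {c}) ` S.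
     (-1) ^ card {(i, j). i \<in> T \<and> j \<in> S - T \<and> coord_pos j < coord_pos i} * \<omega> $ T * one_form a $ (S - T))"
    unfolding wedge_def vec_lambda_beta
  proof (rule sum.mono_neutral_right)
    show "\<forall>T\<in>Pow S - (\<lambda>c. S - {c}) ` S.
      (-1) ^ card {(i, j). i \<in> T \<and> j \<in> S - T \<and> coord_pos j < coord_pos i} * \<omega> $ T * one_form a $ (S - T) = 0"
    proof
      fix T assume T: "T \<in> Pow S - (\<lambda>c. S - {c}) ` S"
      have "S - T \<noteq> {c}" for c
      proof
        assume "S - T = {c}"
        with T have "T = S - {c}" "c \<in> S" by auto
        with T show False by blast
      qed
      then show "(-1) ^ card {(i, j). i \<in> T \<and> j \<in> S - T \<and> coord_pos j < coord_pos i} * \<omega> $ T * one_form a $ (S - T) = 0"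
        by (simp add: one_form_component)
    qed
  qed auto
  also have "\<dots> = (\<Sum>c\<in>S. (\<Prod>i\<in>S. if coord_pos c < coord_pos i then -1 else 1) * a c * \<omega> $ (S - {c}))"
  proof (subst sum.reindex)
    show "inj_on (\<lambda>c. S - {c}) S" by (auto simp: inj_on_def)
    have *: "S - (S - {c}) = {c}" if "c \<in> S" for c using that by auto
    show "(\<Sum>c\<in>S. ((\<lambda>T. (-1) ^ card {(i, j). i \<in> T \<and> j \<in> S - T \<and> coord_pos j < coord_pos i} * \<omega> $ T *
        one_form a $ (S - T)) \<circ> (\<lambda>c. S - {c})) c) =
      (\<Sum>c\<in>S. (\<Prod>i\<in>S. if coord_pos c < coord_pos i then -1 else 1) * a c * \<omega> $ (S - {c}))"
      by (intro sum.cong refl) (simp only: o_def sgn, simp add: * one_form_component mult_ac)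
  qed
  finally show ?thesis .
qed

text \<open>The 4 by 4 determinant in its Laplace expansion along the first two rows.\<close>

definition det4 :: "(coord \<Rightarrow> 'a::comm_ring_1) \<Rightarrow> (coord \<Rightarrow> 'a) \<Rightarrow> (coord \<Rightarrow> 'a) \<Rightarrow> (coord \<Rightarrow> 'a) \<Rightarrow> 'a" where
  "det4 a b c d =
    (let m = \<lambda>i j. a i * b j - a j * b i; n = \<lambda>i j. c i * d j - c j * d i in
      m Cu Cub * n Cw Cwb - m Cu Cw * n Cub Cwb + m Cu Cwb * n Cub Cw
      + m Cub Cw * n Cu Cwb - m Cub Cwb * n Cu Cw + m Cw Cwb * n Cu Cub)"

lemma wedge4_component:
  "(one_form a \<and>\<^sub>F one_form b \<and>\<^sub>F one_form c \<and>\<^sub>F one_form d) $ S = (if S = UNIV then det4 a b c d else 0)"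
proof (cases "S = UNIV")
  case True
  then show ?thesis
    by (simp add: UNIV_coord wedge_one_form one_form_component insert_Diff_if det4_def)
      (simp add: algebra_simps)
next
  case False
  \<comment> \<open>A degree count: each one-form raises the degree by one, and \<open>UNIV\<close>
    is the only set of four coordinates.\<close>
  have step: "(\<omega> \<and>\<^sub>F one_form e) $ T = 0" if "\<And>T. card T \<noteq> k \<Longrightarrow> \<omega> $ T = 0" "card T \<noteq> Suc k"
    for \<omega> :: "'a form" and e k and T :: "coord set"
    unfolding wedge_one_form
  proof (intro sum.neutral ballI)
    fix x assume "x \<in> T"
    then have "card (T - {x}) \<noteq> k" using that(2) by (metis card_Suc_Diff1 finite_code)
    then show "(\<Prod>i\<in>T. if coord_pos x < coord_pos i then - 1 else 1) * e x * \<omega> $ (T - {x}) = 0"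
      using that(1) by simp
  qed
  have "one_form a $ T = 0" if "card T \<noteq> 1" for T
    using that by (auto simp: one_form_component)
  from step[OF step[OF step[OF this]]]
  have "(one_form a \<and>\<^sub>F one_form b \<and>\<^sub>F one_form c \<and>\<^sub>F one_form d) $ T = 0" if "card T \<noteq> 4" for T
    using that by (simp add: eval_nat_numeral)
  moreover have "card S \<noteq> 4"
  proof
    have c4: "card (UNIV :: coord set) = 4" by (simp add: UNIV_coord)
    assume "card S = 4"
    then have "S = UNIV" using c4 by (intro card_subset_eq) auto
    with False show False by simp
  qed
  ultimately show ?thesis using False by simp
qed

lemma dX_one_form: "dX c = one_form (\<lambda>d. if d = c then 1 else 0)"
  by (auto simp: dX_def axis_def one_form_component vec_eq_iff)

lemma one_form_add: "one_form a + one_form b = one_form (\<lambda>c. a c + b c)"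
  by (simp add: one_form_component vec_eq_iff)

lemma one_form_diff: "one_form a - one_form b = one_form (\<lambda>c. a c - b c)"
  by (simp add: one_form_component vec_eq_iff)

lemma one_form_scale: "k *s one_form a = one_form (\<lambda>c. k * a c)"
  by (simp add: one_form_component vec_eq_iff)

lemma dvol_component: "dvol $ S = (if S = UNIV then nconst (4 * \<i>) else 0)"
  by (simp add: dvol_def dX_one_form wedge4_component det4_def)

text \<open>The ring of coefficients is not a field; cancellation works because the component of
  \<open>dvol\<close> is an invertible constant.\<close>

lemma density_eqI:
  assumes "\<alpha> = f *s dvol"
  shows "density \<alpha> = f"
  unfolding density_def
proof (rule the_equality)
  show "\<alpha> = f *s dvol" by (rule assms)
  fix g assume "\<alpha> = g *s dvol"
  then have "(f *s dvol) $ UNIV = (g *s dvol) $ UNIV" using assms by simp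
  then have "f * nconst (4 * \<i>) * nconst (inverse (4 * \<i>)) = g * nconst (4 * \<i>) * nconst (inverse (4 * \<i>))"
    by (simp add: dvol_component)
  moreover have "nconst (4 * \<i>) * nconst (inverse (4 * \<i>)) = (1 :: complex nilalg)"
  proof -
    have "nconst (4 * \<i>) * nconst (inverse (4 * \<i>)) = (nconst 1 :: complex nilalg)"
      by (simp only: nconst_mult[symmetric]) (simp del: inverse_mult_distrib)
    also have "nconst 1 = (1 :: complex nilalg)" by transfer auto
    finally show ?thesis .
  qed
  ultimately show "g = f" by (simp add: mult.assoc)
qed

section \<open>Homogeneity\<close>

lemma card_tree:
  assumes "is_tree V E"
  shows "card V = Suc (card E)"
  using assms
proof (induction "card V" arbitrary: V E rule: less_induct)
  case less
  note tr = less.prems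
  show ?case
  proof (cases "E = {}")
    case True
    obtain v where v: "v \<in> V" using is_treeD(2)[OF tr] by blast
    have "x = v" if "x \<in> V" for x
    proof -
      have "conn E v x" using is_treeD(6)[OF tr v that] .
      then have "x \<in> {v}" by (rule conn_closed) (simp_all add: True)
      then show ?thesis by simp
    qed
    with v have "V = {v}" by blast
    then show ?thesis by (simp add: True)
  next
    case False
    then obtain l m where lm: "{l, m} \<in> E" using is_treeD(11)[OF tr] by blast
    have ml: "{m, l} \<in> E" using lm by (simp add: insert_commute)
    note s = split_tree[OF tr lm] and s' = split_tree[OF tr ml]
    have fin: "finite (side E l m)" "finite (side E m l)" using is_treeD(1)[OF s(5)] is_treeD(1)[OF s'(5)] .
    have c: "card V = card (side E l m) + card (side E m l)"
      using card_Un_disjoint[OF fin s(3)] s(4) by simp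
    have "card (side E l m) > 0" "card (side E m l) > 0"
      using fin s(1,2) card_gt_0_iff by blast+
    then have IH: "card (side E l m) = Suc (card (induced E (side E l m)))"
      "card (side E m l) = Suc (card (induced E (side E m l)))"
      using less.hyps[OF _ s(5)] less.hyps[OF _ s'(5)] c by linarith+
    have "card (E - {{l, m}}) = card (induced E (side E l m)) + card (induced E (side E m l))"
      unfolding prod_split_tree(3)[OF tr lm]
      by (rule card_Un_disjoint[OF is_treeD(9)[OF s(5)] is_treeD(9)[OF s'(5)] prod_split_tree(4)[OF tr lm]])
    moreover have "card E = Suc (card (E - {{l, m}}))" using card.remove[OF is_treeD(9)[OF tr] lm] .
    ultimately show ?thesis using c IH by simp
  qed
qed

text \<open>A handshake count: the degrees add up to \<open>2 * (card V - 1)\<close>. The resulting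
  -2 is what later balances the two factors of \<open>\<iota>\<close>, and the two of
  \<open>omicron\<close>, in the prefactor.\<close>

lemma sum_degree_tree:
  assumes tr: "is_tree V E"
  shows "(\<Sum>a\<in>V. int (degree_at E a) - 2) = - 2"
proof -
  have "card {a \<in> V. a \<in> e} = 2" if "e \<in> E" for e
  proof -
    obtain i j where "i \<in> V" "j \<in> V" "i \<noteq> j" "e = {i, j}" using is_treeD(11)[OF tr \<open>e \<in> E\<close>] by blast
    then have "{a \<in> V. a \<in> e} = {i, j}" by auto
    then show ?thesis using \<open>i \<noteq> j\<close> by simp
  qed
  then have "(\<Sum>a\<in>V. degree_at E a) = 2 * card E"
    unfolding degree_at_def
    by (rule sum_multicount[OF is_treeD(1)[OF tr] is_treeD(9)[OF tr], rule_format])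
  then have "(\<Sum>a\<in>V. int (degree_at E a)) = 2 * int (card E)"
    by (simp flip: of_nat_sum)
  then show ?thesis using card_tree[OF tr] by (simp add: sum_subtractf)
qed

lemma prod_powi_scale:
  fixes t :: complex
  assumes "t \<noteq> 0" "is_tree V E"
  shows "(\<Prod>a\<in>V. (t * x a) powi (int (degree_at E a) - 2)) =
    t powi (-2) * (\<Prod>a\<in>V. x a powi (int (degree_at E a) - 2))"
proof -
  have "(\<Prod>a\<in>V. t powi (int (degree_at E a) - 2)) = t powi (\<Sum>a\<in>V. int (degree_at E a) - 2)"
    using is_treeD(1)[OF assms(2)] assms(1)
    by (induction V rule: finite_induct) (simp_all add: power_int_add)
  then show ?thesis
    by (simp add: power_int_mult_distrib prod.distrib sum_degree_tree[OF assms(2)])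
qed

lemma prod_if_mem:
  fixes s :: "'a::comm_semiring_1"
  assumes "finite F"
  shows "(\<Prod>e\<in>F. if i \<in> e then s else 1) = s ^ card {e \<in> F. i \<in> e}"
proof -
  have "(\<Prod>e\<in>F. if i \<in> e then s else 1) = (\<Prod>e\<in>{e \<in> F. i \<in> e}. s)"
    by (rule prod.inter_filter[OF assms, symmetric])
  then show ?thesis by simp
qed

lemma ang_scale: "ang (s *s \<mu>) \<nu> = s * ang \<mu> \<nu>" "ang \<mu> (s *s \<nu>) = s * ang \<mu> \<nu>"
  by (simp_all add: ang_eq algebra_simps)

lemma sqb_scale: "sqb (s *s \<mu>) \<nu> = s * sqb \<mu> \<nu>" "sqb \<mu> (s *s \<nu>) = s * sqb \<mu> \<nu>"
  by (simp_all add: sqb_eq algebra_simps)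

text \<open>At an edge containing \<open>i\<close> the numerator scales by \<open>inverse t\<close>
  and the denominator by \<open>t\<close>.\<close>

lemma edge_factor_scale:
  assumes "t \<noteq> 0" "card e = 2"
  shows "edge_factor (lam(i := t *s lam i)) (lamt(i := inverse t *s lamt i)) e =
    (if i \<in> e then inverse t ^ 2 else 1) * edge_factor lam lamt e"
proof -
  obtain a b where ab: "e = {a, b}" "a \<noteq> b" using assms(2) by (auto simp: card_2_iff)
  show ?thesis
    using ab(2) assms(1) unfolding ab(1) edge_factor_pair
    by (auto simp: ang_scale sqb_scale field_simps power2_eq_square)
qed

text \<open>The last claim matters because the two neighbours may be the same vertex: the two
  special edges are still different, so removing them always removes two edges.\<close>

lemma tree_neighbours:
  assumes tr: "is_tree W E" and IJ: "I \<in> W" "J \<in> W" "I \<noteq> J" and nadj: "\<not> adjacent E I J"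
  shows "{I, neighbour_towards E I J} \<in> E" "{J, neighbour_towards E J I} \<in> E"
    "neighbour_towards E I J \<noteq> J" "neighbour_towards E I J \<noteq> I"
    "neighbour_towards E J I \<noteq> I" "neighbour_towards E J I \<noteq> J"
    "neighbour_towards E I J \<in> W" "neighbour_towards E J I \<in> W"
    "{I, neighbour_towards E I J} \<noteq> {J, neighbour_towards E J I}"
proof -
  show 1: "{I, neighbour_towards E I J} \<in> E" "{J, neighbour_towards E J I} \<in> E"
    using neighbour_towards(1)[OF tr IJ] neighbour_towards(1)[OF tr IJ(2,1) IJ(3)[symmetric]]
    by (simp_all add: insert_commute)
  then show 2: "neighbour_towards E I J \<noteq> J" "neighbour_towards E J I \<noteq> I"
    using nadj by (auto simp: adjacent_def insert_commute)
  show "neighbour_towards E I J \<noteq> I" "neighbour_towards E J I \<noteq> J"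
    "neighbour_towards E I J \<in> W" "neighbour_towards E J I \<in> W"
    using is_treeD(3-5)[OF tr 1(1)] is_treeD(3-5)[OF tr 1(2)] by auto
  show "{I, neighbour_towards E I J} \<noteq> {J, neighbour_towards E J I}"
    using 2 IJ(3) by (auto simp: doubleton_eq_iff)
qed

lemma tree_weight_eq_K:
  assumes tr: "is_tree {1..N + 2} E"
    and I: "\<forall>a\<in>{1..N + 2} - {N + 1}. sqb (lamt (N + 1)) (lamt a) \<noteq> 0"
    and J: "\<forall>b\<in>{1..N + 2} - {N + 2}. sqb (lamt (N + 2)) (lamt b) \<noteq> 0"
  shows "tree_weight N lam lamt \<xi> chi E = tree_K N lamt \<xi> chi E * (\<Prod>e\<in>E. edge_factor lam lamt e)"
proof (cases "adjacent E (N + 1) (N + 2)")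
  case True
  then have "{N + 1, N + 2} \<in> E" by (simp add: adjacent_def)
  moreover have "sqb (lamt (N + 1)) (lamt (N + 2)) \<noteq> 0" using I by simp
  ultimately show ?thesis
    using True prod.remove[OF is_treeD(9)[OF tr], of "{N + 1, N + 2}" "edge_factor lam lamt"]
    by (simp add: tree_weight_def tree_K_def Let_def edge_factor_pair)
next
  case False
  let ?a = "neighbour_towards E (N + 1) (N + 2)" and ?b = "neighbour_towards E (N + 2) (N + 1)"
  have *: "N + 1 \<in> {1..N + 2}" "N + 2 \<in> {1..N + 2}" "N + 1 \<noteq> N + 2" by auto
  note n = tree_neighbours[OF tr * False]
  have nz: "sqb (lamt (N + 1)) (lamt ?a) \<noteq> 0" "sqb (lamt (N + 2)) (lamt ?b) \<noteq> 0"
    using I J n by blast+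
  have "(\<Prod>e\<in>E. edge_factor lam lamt e) = (\<Prod>e\<in>{{N + 1, ?a}, {N + 2, ?b}}. edge_factor lam lamt e) *
      (\<Prod>e\<in>E - {{N + 1, ?a}, {N + 2, ?b}}. edge_factor lam lamt e)"
    using prod.subset_diff[of "{{N + 1, ?a}, {N + 2, ?b}}" E "edge_factor lam lamt"] n is_treeD(9)[OF tr]
    by (simp add: mult.commute)
  also have "(\<Prod>e\<in>{{N + 1, ?a}, {N + 2, ?b}}. edge_factor lam lamt e) =
      sqb (lamt (N + 1)) (lamt ?a) / ang (lam (N + 1)) (lam ?a) *
      (sqb (lamt (N + 2)) (lamt ?b) / ang (lam (N + 2)) (lam ?b))"
    using n(9) by (simp add: edge_factor_pair)
  finally show ?thesis
    using False nz by (simp add: tree_weight_def tree_K_def Let_def)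
qed

text \<open>If every edge had its full factor, the weight would scale by
  \<open>inverse t ^ 2\<close> per edge at \<open>i\<close>. In the special edges the spinors
  \<open>lamt\<close> of \<open>I\<close> and \<open>J\<close> have been replaced by reference
  spinors, and each missing one gives back a factor \<open>t\<close>. This also holds for the single
  special edge of the adjacent case.\<close>

lemma tree_weight_scale:
  assumes tr: "is_tree {1..N + 2} E" and t: "t \<noteq> 0"
  shows "tree_weight N (lam(i := t *s lam i)) (lamt(i := inverse t *s lamt i)) \<xi> chi E =
    (if i \<in> {N + 1, N + 2} then t else 1) * inverse t ^ (2 * degree_at E i) * tree_weight N lam lamt \<xi> chi E"
proof -
  let ?lam = "lam(i := t *s lam i)" and ?lamt = "lamt(i := inverse t *s lamt i)"
  have E2: "card e = 2" if "e \<in> E" for e using is_treeD(11)[OF tr that] by auto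
  note finE = is_treeD(9)[OF tr]
  have pr: "(\<Prod>e\<in>F. edge_factor ?lam ?lamt e) = inverse t ^ (2 * card {e \<in> F. i \<in> e}) * (\<Prod>e\<in>F. edge_factor lam lamt e)"
    if F: "F \<subseteq> E" for F
  proof -
    have "(\<Prod>e\<in>F. edge_factor ?lam ?lamt e) =
        (\<Prod>e\<in>F. (if i \<in> e then inverse t ^ 2 else 1) * edge_factor lam lamt e)"
      by (intro prod.cong refl edge_factor_scale t E2) (use F in auto)
    then show ?thesis
      using finite_subset[OF F finE] by (simp add: prod.distrib prod_if_mem power_mult)
  qed
  have deg: "degree_at E i = card {e \<in> E - M. i \<in> e} + card {e \<in> M. i \<in> e}" if "M \<subseteq> E" for M
  proof -
    have "{e \<in> E. i \<in> e} = {e \<in> E - M. i \<in> e} \<union> {e \<in> M. i \<in> e}" using that by auto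
    then show ?thesis unfolding degree_at_def
      using finE finite_subset[OF that finE] by (simp add: card_Un_disjoint disjoint_iff)
  qed
  have *: "N + 1 \<in> {1..N + 2}" "N + 2 \<in> {1..N + 2}" "N + 1 \<noteq> N + 2" by auto
  show ?thesis
  proof (cases "adjacent E (N + 1) (N + 2)")
    case True
    let ?M = "{{N + 1, N + 2}}"
    have M: "?M \<subseteq> E" using True by (simp add: adjacent_def)
    have "{e \<in> ?M. i \<in> e} = (if i \<in> {N + 1, N + 2} then ?M else {})" by auto
    then have d: "degree_at E i = card {e \<in> E - ?M. i \<in> e} + (if i \<in> {N + 1, N + 2} then 1 else 0)"
      using deg[OF M] by simp
    have "sqb \<xi> chi / ang (?lam (N + 1)) (?lam (N + 2)) =
      (if i \<in> {N + 1, N + 2} then t * inverse t ^ 2 else 1) * (sqb \<xi> chi / ang (lam (N + 1)) (lam (N + 2)))"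
      using t by (auto simp: ang_scale field_simps power2_eq_square)
    then show ?thesis
      using True unfolding tree_weight_def Let_def if_P[OF True] pr[OF Diff_subset] d
      by (simp add: power_add power_mult mult_ac del: One_nat_def)
  next
    case False
    let ?a = "neighbour_towards E (N + 1) (N + 2)" and ?b = "neighbour_towards E (N + 2) (N + 1)"
    let ?M = "{{N + 1, ?a}, {N + 2, ?b}}"
    note n = tree_neighbours[OF tr * False]
    have M: "?M \<subseteq> E" using n by simp
    have "{e \<in> ?M. i \<in> e} = (if i \<in> {N + 1, ?a} then {{N + 1, ?a}} else {}) \<union>
        (if i \<in> {N + 2, ?b} then {{N + 2, ?b}} else {})" by auto
    then have d: "degree_at E i = card {e \<in> E - ?M. i \<in> e} +
        ((if i \<in> {N + 1, ?a} then 1 else 0) + (if i \<in> {N + 2, ?b} then 1 else 0))"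
      using deg[OF M] n(9) by (simp add: card_Un_disjoint)
    have f: "sqb \<eta> (?lamt c) / ang (?lam j) (?lam c) =
      ((if i = j then t else 1) * (if i \<in> {j, c} then inverse t ^ 2 else 1)) * (sqb \<eta> (lamt c) / ang (lam j) (lam c))"
      if "c \<noteq> j" for \<eta> c j
      using that t by (auto simp: ang_scale sqb_scale field_simps power2_eq_square)
    have pw: "(inverse t :: complex) ^ (2 * (if Q then 1 else 0)) = (if Q then inverse t ^ 2 else 1)" for Q by simp
    have tt: "(if i = N + 1 then t else 1) * (if i = N + 2 then t else 1) = (if i \<in> {N + 1, N + 2} then t else 1)"
      by simp
    show ?thesis
      unfolding tree_weight_def Let_def if_not_P[OF False] pr[OF Diff_subset] d f[OF n(4)] f[OF n(6)]
        power_add distrib_left pw tt[symmetric]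
      by (simp only: mult_ac)
  qed
qed

lemma prod_powi_scale_at:
  fixes t :: complex
  assumes t: "t \<noteq> 0" and i: "i \<in> V" "finite V"
  shows "(\<Prod>a\<in>V. (ang ((lam(i := t *s lam i)) a) \<iota> * ang ((lam(i := t *s lam i)) a) omicron) powi (d a - 2)) =
    t powi (2 * d i - 4) * (\<Prod>a\<in>V. (ang (lam a) \<iota> * ang (lam a) omicron) powi (d a - 2))"
proof -
  have p: "(t * t) powi n = t powi (2 * n)" for n :: int
    by (simp add: power_int_mult_distrib power_int_add[symmetric] t flip: mult_2)
  have "(ang ((lam(i := t *s lam i)) a) \<iota> * ang ((lam(i := t *s lam i)) a) omicron) powi (d a - 2) =
      (if a = i then t powi (2 * d i - 4) else 1) * (ang (lam a) \<iota> * ang (lam a) omicron) powi (d a - 2)" for a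
  proof (cases "a = i")
    case True
    have "(t * x * (t * y)) powi (d i - 2) = t powi (2 * d i - 4) * (x * y) powi (d i - 2)" for x y
    proof -
      have "(t * x * (t * y)) = (t * t) * (x * y)" by (simp add: mult_ac)
      then show ?thesis using p[of "d i - 2"] by (simp only: power_int_mult_distrib) simp
    qed
    then show ?thesis using True by (simp add: ang_scale)
  qed simp
  then show ?thesis using i by (simp add: prod.distrib prod.delta)
qed

text \<open>For \<open>I\<close> the prefactor has weight 7: four from the power of the angle
  bracket of \<open>I\<close> and \<open>J\<close>, two from the brackets with
  \<open>\<iota>\<close> and \<open>omicron\<close>, one from the denominator. In each summand the
  powers of the degree cancel between edges and node factors and leave -4, plus 1 for the missing
  spinor; hence 7 + 1 - 4 = 4. For the other labels only the -4 remains.\<close>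

lemma MHV_formula_little_group:
  assumes t: "t \<noteq> 0" and i: "i \<in> {1..N + 2}"
  shows "MHV_formula N (lam(i := t *s lam i)) (lamt(i := inverse t *s lamt i)) \<iota> omicron \<xi> chi =
    t powi (if i \<in> {N + 1, N + 2} then 4 else -4) * MHV_formula N lam lamt \<iota> omicron \<xi> chi"
proof -
  let ?lam = "lam(i := t *s lam i)" and ?lamt = "lamt(i := inverse t *s lamt i)"
  let ?s = "if i \<in> {N + 1, N + 2} then t else 1"
  have pre: "ang (?lam (N + 1)) (?lam (N + 2)) ^ 4 * ang (?lam (N + 1)) \<iota> * ang (?lam (N + 1)) omicron *
      ang (?lam (N + 2)) \<iota> * ang (?lam (N + 2)) omicron / (sqb \<xi> (?lamt (N + 1)) * sqb chi (?lamt (N + 2))) =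
    ?s ^ 7 * (ang (lam (N + 1)) (lam (N + 2)) ^ 4 * ang (lam (N + 1)) \<iota> * ang (lam (N + 1)) omicron *
      ang (lam (N + 2)) \<iota> * ang (lam (N + 2)) omicron / (sqb \<xi> (lamt (N + 1)) * sqb chi (lamt (N + 2))))"
    using t by (auto simp: ang_scale sqb_scale divide_inverse power_mult_distrib mult_ac power_numeral_reduce)
  have "tree_weight N ?lam ?lamt \<xi> chi E *
      (\<Prod>a = 1..N + 2. (ang (?lam a) \<iota> * ang (?lam a) omicron) powi (int (degree_at E a) - 2)) =
    ?s * t powi (-4) * (tree_weight N lam lamt \<xi> chi E *
      (\<Prod>a = 1..N + 2. (ang (lam a) \<iota> * ang (lam a) omicron) powi (int (degree_at E a) - 2)))"
    if tr: "is_tree {1..N + 2} E" for E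
  proof -
    have "inverse t ^ (2 * degree_at E i) * t powi (2 * int (degree_at E i) - 4) = t powi (-4)"
    proof -
      have "inverse t ^ (2 * degree_at E i) = t powi (- 2 * int (degree_at E i))"
        using t by (simp add: power_int_def power_inverse nat_mult_distrib)
      then show ?thesis using t by (simp flip: power_int_add)
    qed
    moreover have "(r * x * y) * (x' * p) = r * (x * x') * (y * p)" for r x y x' p :: complex
      by (simp only: mult_ac)
    ultimately show ?thesis
      unfolding tree_weight_scale[OF tr t]
        prod_powi_scale_at[OF t i finite_atLeastAtMost, of lam \<iota> omicron "\<lambda>a. int (degree_at E a)"]
      by (simp only:)
  qed
  then have "(\<Sum>E | is_tree {1..N + 2} E. tree_weight N ?lam ?lamt \<xi> chi E *
      (\<Prod>a = 1..N + 2. (ang (?lam a) \<iota> * ang (?lam a) omicron) powi (int (degree_at E a) - 2))) =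
    ?s * t powi (-4) * (\<Sum>E | is_tree {1..N + 2} E. tree_weight N lam lamt \<xi> chi E *
      (\<Prod>a = 1..N + 2. (ang (lam a) \<iota> * ang (lam a) omicron) powi (int (degree_at E a) - 2)))"
    unfolding sum_distrib_left by (intro sum.cong refl) simp
  then have "MHV_formula N ?lam ?lamt \<iota> omicron \<xi> chi =
      ?s ^ 7 * ?s * t powi (-4) * MHV_formula N lam lamt \<iota> omicron \<xi> chi"
    unfolding MHV_formula_def MHV_formula_with_def Let_def pre by (simp only: mult_ac mult_minus_left mult_minus_right)
  moreover have "t ^ 7 * t * t powi (-4) = t powi 4"
  proof -
    have "t ^ 7 * t = t powi 8" by (simp flip: power_Suc2)
    then have "t ^ 7 * t * t powi (-4) = t powi (8 + -4)"
      using power_int_add[OF disjI1[OF t], of 8 "-4"] by (simp only:)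
    then show ?thesis by simp
  qed
  ultimately show ?thesis by (cases "i \<in> {N + 1, N + 2}") (simp_all only: if_True if_False power_one mult_1)
qed

text \<open>\<open>\<iota>\<close> and \<open>omicron\<close> occur twice each in the prefactor and
  with total exponent -2 in every tree; \<open>\<xi>\<close> and \<open>chi\<close> occur once in
  every \<open>tree_weight\<close> and once in the denominator of the prefactor.\<close>

lemma MHV_formula_reference_scale:
  assumes t: "t \<noteq> 0"
  shows "MHV_formula N lam lamt (t *s \<iota>) omicron \<xi> chi = MHV_formula N lam lamt \<iota> omicron \<xi> chi"
    "MHV_formula N lam lamt \<iota> (t *s omicron) \<xi> chi = MHV_formula N lam lamt \<iota> omicron \<xi> chi"
    "MHV_formula N lam lamt \<iota> omicron (t *s \<xi>) chi = MHV_formula N lam lamt \<iota> omicron \<xi> chi"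
    "MHV_formula N lam lamt \<iota> omicron \<xi> (t *s chi) = MHV_formula N lam lamt \<iota> omicron \<xi> chi"
proof -
  have tt: "t * t * t powi (- 2) = 1"
    using t by (simp add: power_int_minus power2_eq_square field_simps)
  have pr: "(\<Prod>a\<in>{1..N + 2}. (t * x a) powi (int (degree_at E a) - 2)) =
      t powi (-2) * (\<Prod>a\<in>{1..N + 2}. x a powi (int (degree_at E a) - 2))"
    if "is_tree {1..N + 2} E" for E x
    by (rule prod_powi_scale[OF t that])
  have iota: "(\<Sum>E | is_tree {1..N + 2} E. W E * (\<Prod>a = 1..N + 2. (t * x a) powi (int (degree_at E a) - 2))) =
     t powi (-2) * (\<Sum>E | is_tree {1..N + 2} E. W E * (\<Prod>a = 1..N + 2. x a powi (int (degree_at E a) - 2)))"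
    for W :: "nat set set \<Rightarrow> complex" and x
    unfolding sum_distrib_left by (intro sum.cong refl, elim CollectE) (simp only: pr mult_ac)
  have fin: "- (t * t * A / B) * (t powi (-2) * S) = - (A / B) * S" for A B S
  proof -
    have "- (t * t * A / B) * (t powi (-2) * S) = (t * t * t powi (-2)) * (- (A / B) * S)"
      by (simp only: divide_inverse mult_ac mult_minus_left mult_minus_right)
    then show ?thesis by (simp only: tt mult_1)
  qed
  show "MHV_formula N lam lamt (t *s \<iota>) omicron \<xi> chi = MHV_formula N lam lamt \<iota> omicron \<xi> chi"
  proof -
    have x: "t * ang (lam a) \<iota> * ang (lam a) omicron = t * (ang (lam a) \<iota> * ang (lam a) omicron)" for a
      by (rule mult.assoc)
    have "p * (t * a) * b * (t * c) * d = t * t * (p * a * b * c * d)" for p a b c d by (simp only: mult_ac)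
    then show ?thesis
      unfolding MHV_formula_def MHV_formula_with_def Let_def ang_scale x iota by (simp only: fin)
  qed
  show "MHV_formula N lam lamt \<iota> (t *s omicron) \<xi> chi = MHV_formula N lam lamt \<iota> omicron \<xi> chi"
  proof -
    have x: "ang (lam a) \<iota> * (t * ang (lam a) omicron) = t * (ang (lam a) \<iota> * ang (lam a) omicron)" for a
      by (rule mult.left_commute)
    have "p * a * (t * b) * c * (t * d) = t * t * (p * a * b * c * d)" for p a b c d by (simp only: mult_ac)
    then show ?thesis
      unfolding MHV_formula_def MHV_formula_with_def Let_def ang_scale x iota by (simp only: fin)
  qed
  have w1: "tree_weight N lam lamt (t *s \<xi>) chi E = t * tree_weight N lam lamt \<xi> chi E" for E
    by (simp add: tree_weight_def Let_def sqb_scale)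
  have w2: "tree_weight N lam lamt \<xi> (t *s chi) E = t * tree_weight N lam lamt \<xi> chi E" for E
    by (simp add: tree_weight_def Let_def sqb_scale)
  have c: "- (A / (t * b * d)) * (t * S) = - (A / (b * d)) * S" "- (A / (b * (t * d))) * (t * S) = - (A / (b * d)) * S"
    for A b d S using t by (simp_all add: divide_inverse)
  show "MHV_formula N lam lamt \<iota> omicron (t *s \<xi>) chi = MHV_formula N lam lamt \<iota> omicron \<xi> chi"
    unfolding MHV_formula_def MHV_formula_with_def Let_def sqb_scale w1 mult.assoc[of t] sum_distrib_left[symmetric]
    by (simp only: c mult.assoc[of t, symmetric])
  show "MHV_formula N lam lamt \<iota> omicron \<xi> (t *s chi) = MHV_formula N lam lamt \<iota> omicron \<xi> chi"
    unfolding MHV_formula_def MHV_formula_with_def Let_def sqb_scale w2 mult.assoc[of t] sum_distrib_left[symmetric]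
    by (simp only: c)
qed

lemma MHV_formula_eq_K:
  assumes "\<forall>a\<in>{1..N + 2} - {N + 1}. sqb (lamt (N + 1)) (lamt a) \<noteq> 0"
    and "\<forall>b\<in>{1..N + 2} - {N + 2}. sqb (lamt (N + 2)) (lamt b) \<noteq> 0"
  shows "MHV_formula N lam lamt \<iota> omicron \<xi> chi = MHV_formula_K N lam lamt \<iota> omicron \<xi> chi"
  unfolding MHV_formula_def MHV_formula_K_def MHV_formula_with_def Let_def
  by (intro arg_cong2[of _ _ _ _ "(*)"] sum.cong refl, elim CollectE) (rule tree_weight_eq_K[OF _ assms])

section \<open>The generating function\<close>

lemma nconst_1: "nconst 1 = (1 :: 'a::comm_ring_1 nilalg)"
  by transfer auto

lemma nconst_uminus: "nconst (- c) = - (nconst c :: 'a::comm_ring_1 nilalg)"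
  by transfer auto

lemma nconst_diff: "nconst (a - b) = nconst a - (nconst b :: 'a::comm_ring_1 nilalg)"
  by transfer auto

lemma nconst_0: "nconst 0 = (0 :: 'a::comm_ring_1 nilalg)"
  by transfer auto

text \<open>\<open>p\<close>, \<open>q\<close>, \<open>r\<close> stand for the second derivatives of
  the potential by uu, uw and ww. Leaving them as arbitrary ring elements makes the determinant
  below a polynomial identity.\<close>

definition tetrad_coeff :: "'a::comm_ring_1 \<Rightarrow> 'a \<Rightarrow> 'a \<Rightarrow> 2 \<Rightarrow> 2 \<Rightarrow> coord \<Rightarrow> 'a" where
  "tetrad_coeff p q r A A' c =
    2 * (if A = 1 then if A' = 1 then if c = Cub then 1 else 0 else if c = Cwb then 1 else 0
     else if A' = 1 then (case c of Cu \<Rightarrow> 0 | Cub \<Rightarrow> - q | Cw \<Rightarrow> 1 | Cwb \<Rightarrow> - p)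
     else (case c of Cu \<Rightarrow> 1 | Cub \<Rightarrow> r | Cw \<Rightarrow> 0 | Cwb \<Rightarrow> q))"

text \<open>The contraction of the tetrad with the lowered spinor \<open>(- \<zeta>, 1)\<close> and
  with a dotted vector \<open>h\<close>; here \<open>\<zeta>\<close> will be
  \<open>z L\<close>.\<close>

definition connection_coeff :: "(2 \<Rightarrow> 2 \<Rightarrow> coord \<Rightarrow> 'a::comm_ring_1) \<Rightarrow> 'a \<Rightarrow> (2 \<Rightarrow> 'a) \<Rightarrow> coord \<Rightarrow> 'a" where
  "connection_coeff \<theta> \<zeta> h c = h 1 * (\<theta> 2 1 c - \<zeta> * \<theta> 1 1 c) + h 2 * (\<theta> 2 2 c - \<zeta> * \<theta> 1 2 c)"

text \<open>The second derivatives \<open>p\<close>, \<open>q\<close>, \<open>r\<close> of the potential drop out.\<close>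

lemma tetrad_det:
  fixes p q r \<zeta> \<zeta>' :: "'a::comm_ring_1" and h h' :: "2 \<Rightarrow> 'a"
  defines "\<theta> \<equiv> tetrad_coeff p q r"
  defines "a \<equiv> connection_coeff \<theta> \<zeta> h" and "a' \<equiv> connection_coeff \<theta> \<zeta>' h'"
  defines "D \<equiv> \<lambda>A B. det4 (\<theta> A 2) (\<theta> B 1) a a' - det4 (\<theta> A 1) (\<theta> B 2) a a'"
  shows "\<zeta> * \<zeta>' * D 1 1 - \<zeta> * D 1 2 - \<zeta>' * D 2 1 + D 2 2 = 16 * (\<zeta> - \<zeta>')\<^sup>2 * (h 1 * h' 2 - h 2 * h' 1)"
  unfolding D_def a_def a'_def \<theta>_def connection_coeff_def tetrad_coeff_def det4_def Let_def
  by (simp add: power2_eq_square) (simp add: algebra_simps)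

context
  fixes N :: nat and om z zb :: "nat \<Rightarrow> complex"
begin

abbreviation background_tetrad :: "point \<Rightarrow> 2 \<Rightarrow> 2 \<Rightarrow> coord \<Rightarrow> complex nilalg" where
  "background_tetrad X \<equiv> tetrad_coeff (pd Cu (pd Cu (phi N om z zb)) X)
     (pd Cu (pd Cw (phi N om z zb)) X) (pd Cw (pd Cw (phi N om z zb)) X)"

lemma tetrad_one_form: "tetrad N om z zb A A' X = one_form (background_tetrad X A A')"
proof -
  have "A = 1 \<or> A = 2" "A' = 1 \<or> A' = 2" using exhaust_2 by blast+
  then show ?thesis
    unfolding tetrad_def dX_one_form one_form_scale one_form_add one_form_diff
    by (auto intro!: arg_cong[of _ _ one_form] simp: fun_eq_iff tetrad_coeff_def split: coord.split)
qed

definition wave_factor :: "nat \<Rightarrow> spinor \<Rightarrow> point \<Rightarrow> complex nilalg" where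
  "wave_factor L \<xi> X = nconst (- \<i> / (2 * sqb \<xi> (kapt om zb L))) * eps L *
    nexp (nconst \<i> * F_scalar N om z zb L X)"

abbreviation connection :: "nat \<Rightarrow> spinor \<Rightarrow> point \<Rightarrow> complex nilalg form" where
  "connection L \<xi> X \<equiv> one_form (connection_coeff (background_tetrad X) (nconst (z L))
     (\<lambda>A'. H_contr N om z zb L \<xi> A' X))"

text \<open>The connection is a symmetric rank-one tensor in its spinor indices times a scalar times
  a single one-form, so the index contraction of the 4-form decouples from the wedge
  product.\<close>

lemma gam_one_form:
  "gam N om z zb L \<xi> A B X =
    (nconst (lower (kap z L) $ A * lower (kap z L) $ B) * wave_factor L \<xi> X) *s connection L \<xi> X"
proof -
  have low: "lower (kap z L) $ 1 = - z L" "lower (kap z L) $ 2 = 1" by (simp_all add: kap_lower)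
  have 1: "(\<Sum>C\<in>UNIV. \<Sum>A'\<in>UNIV. \<Sum>C'\<in>UNIV.
        (nconst (lower (kap z L) $ C * \<xi> $ C') * H_mat N om z zb L A' C' X) *s tetrad N om z zb C A' X) =
     connection L \<xi> X"
    by (simp add: sum_2 low tetrad_one_form one_form_scale one_form_add)
      (auto intro!: arg_cong[of _ _ one_form]
        simp: fun_eq_iff connection_coeff_def H_contr_def sum_2 nconst_mult nconst_uminus nconst_1 algebra_simps)
  have "nconst (- \<i> * lower (kap z L) $ A * lower (kap z L) $ B / (2 * sqb \<xi> (kapt om zb L))) =
     nconst (lower (kap z L) $ A * lower (kap z L) $ B) * nconst (- \<i> / (2 * sqb \<xi> (kapt om zb L)))"
    unfolding nconst_mult[symmetric] by (simp add: mult_ac)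
  then show ?thesis unfolding gam_def 1 wave_factor_def by (simp add: mult_ac)
qed

text \<open>The index \<open>C\<close> contributes \<open>- (z I - z J)\<close>, and the indices
  \<open>A\<close>, \<open>B\<close> together with the determinant contribute
  \<open>16 * (z I - z J)\<^sup>2\<close> times the bracket. The product is -16 times a cube, and
  -16 is \<open>4 * \<i>\<close> squared, one factor of which belongs to
  \<open>dvol\<close>.\<close>

lemma MHV_form_eq:
  assumes IJ: "I = N + 1" "J = N + 2"
  shows "MHV_form N om z zb \<xi> chi X =
    (nconst (4 * \<i> * (z I - z J) ^ 3) * (wave_factor I \<xi> X * wave_factor J chi X) *
      (H_contr N om z zb I \<xi> 1 X * H_contr N om z zb J chi 2 X -
       H_contr N om z zb I \<xi> 2 X * H_contr N om z zb J chi 1 X)) *s dvol"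
  (is "_ = (_ * (?G * ?G') * ?h) *s dvol")
proof -
  let ?a = "connection_coeff (background_tetrad X) (nconst (z I)) (\<lambda>A'. H_contr N om z zb I \<xi> A' X)"
  let ?a' = "connection_coeff (background_tetrad X) (nconst (z J)) (\<lambda>A'. H_contr N om z zb J chi A' X)"
  let ?\<theta> = "background_tetrad X"
  define D where "D A B = det4 (?\<theta> A 2) (?\<theta> B 1) ?a ?a' - det4 (?\<theta> A 1) (?\<theta> B 2) ?a ?a'" for A B
  have low: "lower (kap z L) $ 1 = - z L" "lower (kap z L) $ 2 = 1" for L by (simp_all add: kap_lower)
  have S0: "Sigma0 N om z zb A B X = one_form (?\<theta> A 2) \<and>\<^sub>F one_form (?\<theta> B 1) + (-1) *s (one_form (?\<theta> A 1) \<and>\<^sub>F one_form (?\<theta> B 2))" for A B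
    unfolding Sigma0_def tetrad_one_form
    by (simp add: sum_2 eps_low_def eps_up_def nconst_0 nconst_1 nconst_uminus wedge_scale_right)
  have D: "(Sigma0 N om z zb A B X \<and>\<^sub>F one_form ?a \<and>\<^sub>F one_form ?a') $ S = (if S = UNIV then D A B else 0)" for A B S
    unfolding S0 wedge_add_left wedge_scale_left by (simp add: wedge4_component D_def)
  define k where "k L A = nconst (lower (kap z L) $ A)" for L A
  have k: "k L 1 = - nconst (z L)" "k L 2 = 1" for L by (simp_all add: k_def low nconst_uminus nconst_1)
  have up: "gam_up N om z zb J chi C B X = ((\<Sum>D\<in>UNIV. nconst (eps_up C D) * k J D) * k J B * ?G') *s one_form ?a'" for C B
    unfolding gam_up_def gam_one_form k_def
    by (simp add: sum_2 nconst_mult vec_eq_iff algebra_simps)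
  have det: "nconst (z I) * nconst (z J) * D 1 1 - nconst (z I) * D 1 2 - nconst (z J) * D 2 1 + D 2 2 =
      16 * (nconst (z I) - nconst (z J))\<^sup>2 * ?h"
    unfolding D_def by (rule tetrad_det)
  have "MHV_form N om z zb \<xi> chi X $ S = (\<Sum>A\<in>UNIV. \<Sum>B\<in>UNIV. \<Sum>C\<in>UNIV.
      k I A * k I C * ?G * ((\<Sum>D\<in>UNIV. nconst (eps_up C D) * k J D) * k J B * ?G') * (if S = UNIV then D A B else 0))" for S
    unfolding MHV_form_def IJ[symmetric] up gam_one_form k_def[symmetric] nconst_mult
    by (simp add: wedge_scale_left wedge_scale_right D mult_ac)
  also have "\<dots> S = ?G * ?G' * (\<Sum>C\<in>UNIV. k I C * (\<Sum>D\<in>UNIV. nconst (eps_up C D) * k J D)) *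
      (if S = UNIV then \<Sum>A\<in>UNIV. \<Sum>B\<in>UNIV. k I A * k J B * D A B else 0)" for S
    by (simp add: sum_2 algebra_simps)
  also have "(\<Sum>C\<in>UNIV. k I C * (\<Sum>D\<in>UNIV. nconst (eps_up C D) * k J D)) = - nconst (z I - z J)"
    by (simp add: sum_2 k eps_up_def nconst_0 nconst_1 nconst_uminus nconst_diff)
  also have "(\<Sum>A\<in>UNIV. \<Sum>B\<in>UNIV. k I A * k J B * D A B) = 16 * (nconst (z I) - nconst (z J))\<^sup>2 * ?h"
    unfolding det[symmetric] by (simp add: sum_2 k)
  finally have S: "MHV_form N om z zb \<xi> chi X $ S = ?G * ?G' * - nconst (z I - z J) *
      (if S = UNIV then 16 * (nconst (z I) - nconst (z J))\<^sup>2 * ?h else 0)" for S .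
  have n16: "16 = (nconst 16 :: complex nilalg)"
  proof -
    have "nconst (1 + 1) = (1 + 1 :: complex nilalg)" by (simp only: nconst_add nconst_1)
    then have "nconst 2 = (2 :: complex nilalg)" by simp
    then have "nconst (2 * 2 * (2 * 2)) = (2 * 2 * (2 * 2) :: complex nilalg)" by (simp only: nconst_mult)
    then show ?thesis by simp
  qed
  have "nconst (z I - z J) * (16 * (nconst (z I) - nconst (z J))\<^sup>2) =
      - (nconst (4 * \<i> * (z I - z J) ^ 3) * nconst (4 * \<i>) :: complex nilalg)"
    unfolding n16 nconst_diff[symmetric] power2_eq_square nconst_mult[symmetric] nconst_uminus[symmetric]
    by (simp add: power3_eq_cube mult_ac)
  then have c: "- nconst (z I - z J) * (16 * (nconst (z I) - nconst (z J))\<^sup>2) =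
      nconst (4 * \<i> * (z I - z J) ^ 3) * nconst (4 * \<i>)" by simp
  have "MHV_form N om z zb \<xi> chi X $ S = ((nconst (4 * \<i> * (z I - z J) ^ 3) * (?G * ?G') * ?h) *s dvol) $ S" for S
  proof (cases "S = UNIV")
    case True
    have "?G * ?G' * - nconst (z I - z J) * (16 * (nconst (z I) - nconst (z J))\<^sup>2 * ?h) =
      (- nconst (z I - z J) * (16 * (nconst (z I) - nconst (z J))\<^sup>2)) * (?G * ?G') * ?h"
      by (simp only: mult_ac)
    also have "\<dots> = nconst (4 * \<i> * (z I - z J) ^ 3) * (?G * ?G') * ?h * nconst (4 * \<i>)"
      unfolding c by (simp only: mult_ac)
    finally show ?thesis using True by (simp add: S dvol_component del: mult_minus_right mult_minus_left)
  qed (simp add: S dvol_component)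
  then show ?thesis by (simp add: vec_eq_iff)
qed

end

context
  fixes N :: nat and om z zb :: "nat \<Rightarrow> complex"
begin

section \<open>The bracket of the two derivative spinors and the tree sum\<close>

abbreviation "background_trees \<equiv> tree_sum (edge_factor (kap z) (kapt om zb))"

text \<open>The left-hand side is the bracket of \<open>\<xi>\<close> with the total spinor of
  \<open>U\<close>; each of its terms is expanded by the angle bracket of \<open>L\<close> and
  \<open>k\<close>, which is nonzero by assumption.\<close>

lemma node_sum_bracket:
  assumes nz: "\<And>k. k \<in> U \<Longrightarrow> z L \<noteq> z k"
  shows "\<xi> $ 1 * (\<Sum>k\<in>U. kapt om zb k $ 2) - \<xi> $ 2 * (\<Sum>k\<in>U. kapt om zb k $ 1) =
    (\<Sum>k\<in>U. (z L - z k) * (sqb \<xi> (kapt om zb k) / ang (kap z L) (kap z k)))"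
  unfolding sum_distrib_left sum_subtractf[symmetric]
  by (intro sum.cong refl) (use nz in \<open>simp add: ang_kap sqb_eq\<close>)

text \<open>\<open>U\<close> will be the middle tree between \<open>I\<close> and \<open>J\<close>:
  it is absent if they are adjacent, and otherwise carries one mark for each. The two summands are
  never both present, since \<open>background_trees {}\<close> is 0.\<close>

definition bracket_coeff :: "spinor \<Rightarrow> spinor \<Rightarrow> nat \<Rightarrow> nat \<Rightarrow> nat set \<Rightarrow> complex" where
  "bracket_coeff \<xi> chi I J U = (if U = {} then sqb \<xi> chi else 0) +
    (z I - z J) * background_trees U * node_sum om z zb I \<xi> U * node_sum om z zb J chi U"

text \<open>
  The contribution of two disjoint trees to \<open>[h\<^sub>I h\<^sub>J]\<close> is that of the trees obtained by joining them,
  and the factors \<open>z\<^sub>l - z\<^sub>m\<close> of the joining edge telescope along a path.  The result cancels the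
  part of the one-tree contribution that is not proportional to \<open>z\<^sub>I - z\<^sub>J\<close>.
\<close>

lemma sum_bracket_coeff:
  fixes \<xi> chi :: spinor
  assumes U: "finite U" and z: "inj_on z (insert I (insert J U))" "I \<notin> U" "J \<notin> U"
  defines "h \<equiv> \<lambda>L (\<eta> :: spinor) A' S. (if S = {} then \<eta> $ A' else 0) +
    background_trees S * node_sum om z zb L \<eta> S * (\<Sum>k\<in>S. kapt om zb k $ A')"
  shows "(\<Sum>S\<in>Pow U. h I \<xi> 1 S * h J chi 2 (U - S)) - (\<Sum>S\<in>Pow U. h I \<xi> 2 S * h J chi 1 (U - S)) =
    bracket_coeff \<xi> chi I J U"
proof -
  let ?w = "edge_factor (kap z) (kapt om zb)"
  define P where "P A' S = (\<Sum>k\<in>S. kapt om zb k $ A')" for A' :: 2 and S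
  define A where "A k = sqb \<xi> (kapt om zb k) / ang (kap z I) (kap z k)" for k
  define B where "B k = sqb chi (kapt om zb k) / ang (kap z J) (kap z k)" for k
  have AB: "node_sum om z zb I \<xi> S = sum A S" "node_sum om z zb J chi S = sum B S" for S
    by (simp_all add: node_sum_def A_def B_def)
  \<comment> \<open>The constant parts of the two factors sit at the empty set, so they enter only
    for \<open>S = {}\<close> or \<open>S = U\<close>; the remaining products pair two trees on
    complementary sets.\<close>
  have "h I \<xi> 1 S * h J chi 2 (U - S) - h I \<xi> 2 S * h J chi 1 (U - S) =
      (if S = {} then (if U = {} then sqb \<xi> chi else 0) + background_trees U * sum B U * (\<xi> $ 1 * P 2 U - \<xi> $ 2 * P 1 U) else 0)
      - (if S = U then background_trees U * sum A U * (chi $ 1 * P 2 U - chi $ 2 * P 1 U) else 0)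
      + background_trees S * background_trees (U - S) * sum A S * sum B (U - S) *
         (\<Sum>l\<in>S. \<Sum>m\<in>U - S. sqb (kapt om zb l) (kapt om zb m))" if "S \<in> Pow U" for S
  proof -
    have UU: "U - S = {} \<longleftrightarrow> S = U" using that by auto
    have s: "(\<Sum>l\<in>S. \<Sum>m\<in>U - S. sqb (kapt om zb l) (kapt om zb m)) =
        P 1 S * P 2 (U - S) - P 2 S * P 1 (U - S)"
      unfolding P_def sum_product sqb_eq by (simp only: sum_subtractf)
    show ?thesis
      unfolding h_def AB P_def[symmetric] s UU
      by (cases "S = {}"; cases "S = U") (simp_all add: sqb_eq P_def algebra_simps)
  qed
  then have "(\<Sum>S\<in>Pow U. h I \<xi> 1 S * h J chi 2 (U - S)) - (\<Sum>S\<in>Pow U. h I \<xi> 2 S * h J chi 1 (U - S)) =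
      (if U = {} then sqb \<xi> chi else 0) + background_trees U * sum B U * (\<xi> $ 1 * P 2 U - \<xi> $ 2 * P 1 U)
      - background_trees U * sum A U * (chi $ 1 * P 2 U - chi $ 2 * P 1 U)
      + (\<Sum>S\<in>Pow U. background_trees S * background_trees (U - S) * sum A S * sum B (U - S) *
         (\<Sum>l\<in>S. \<Sum>m\<in>U - S. sqb (kapt om zb l) (kapt om zb m)))"
    unfolding sum_subtractf[symmetric] using U by (simp add: sum.distrib sum_subtractf)
  also have "(\<Sum>S\<in>Pow U. background_trees S * background_trees (U - S) * sum A S * sum B (U - S) *
         (\<Sum>l\<in>S. \<Sum>m\<in>U - S. sqb (kapt om zb l) (kapt om zb m))) =
      background_trees U * (\<Sum>k\<in>U. \<Sum>k'\<in>U. A k * B k' * (z k - z k'))"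
  proof (rule sum_tree_join[OF U])
    fix l m assume lm: "l \<in> U" "m \<in> U" "l \<noteq> m"
    then have "z l \<noteq> z m" using z by (auto simp: inj_on_def)
    then show "sqb (kapt om zb l) (kapt om zb m) = ?w {l, m} * (z l - z m)"
      by (simp add: edge_factor_pair ang_kap)
  qed
  also have "\<xi> $ 1 * P 2 U - \<xi> $ 2 * P 1 U = (\<Sum>k\<in>U. (z I - z k) * A k)"
    unfolding P_def A_def by (rule node_sum_bracket) (use z in \<open>auto simp: inj_on_def\<close>)
  also have "chi $ 1 * P 2 U - chi $ 2 * P 1 U = (\<Sum>k\<in>U. (z J - z k) * B k)"
    unfolding P_def B_def by (rule node_sum_bracket) (use z in \<open>auto simp: inj_on_def\<close>)
  finally have 1: "(\<Sum>S\<in>Pow U. h I \<xi> 1 S * h J chi 2 (U - S)) - (\<Sum>S\<in>Pow U. h I \<xi> 2 S * h J chi 1 (U - S)) =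
      (if U = {} then sqb \<xi> chi else 0) + background_trees U * sum B U * (\<Sum>k\<in>U. (z I - z k) * A k)
      - background_trees U * sum A U * (\<Sum>k\<in>U. (z J - z k) * B k) + background_trees U * (\<Sum>k\<in>U. \<Sum>k'\<in>U. A k * B k' * (z k - z k'))" .
  \<comment> \<open>Termwise this is
    \<open>(z I - z k) - (z J - z k') + (z k - z k') = z I - z J\<close>: the telescoped
    contribution removes all dependence on the marked nodes.\<close>
  have "(\<Sum>k\<in>U. (z I - z k) * A k) * sum B U - sum A U * (\<Sum>k\<in>U. (z J - z k) * B k) +
      (\<Sum>k\<in>U. \<Sum>k'\<in>U. A k * B k' * (z k - z k')) = (z I - z J) * (sum A U * sum B U)"
    unfolding sum_product
    unfolding sum_distrib_left
    unfolding sum_subtractf[symmetric] sum.distrib[symmetric]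
    by (intro sum.cong refl) (simp add: algebra_simps)
  from arg_cong[OF this, of "(*) (background_trees U)"] show ?thesis
    unfolding 1 bracket_coeff_def AB by (simp add: algebra_simps)
qed

lemma phase_split:
  assumes "finite U" "S \<subseteq> U"
  shows "phase om z zb X S * phase om z zb X (U - S) = phase om z zb X U"
proof -
  have "finite S" "S \<union> (U - S) = U" using assms finite_subset by auto
  then show ?thesis using phase_Un[of S "U - S" om z zb X] assms by simp
qed

lemma ncoeff_bracket:
  assumes z: "inj_on z {1..N + 2}" and IJ: "I = N + 1" "J = N + 2" and U: "U \<subseteq> {1..N}"
  shows "ncoeff (H_contr N om z zb I \<xi> 1 X * H_contr N om z zb J chi 2 X -
       H_contr N om z zb I \<xi> 2 X * H_contr N om z zb J chi 1 X) U =
    bracket_coeff \<xi> chi I J U * phase om z zb X U"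
proof -
  have fin: "finite U" using U finite_subset by auto
  define h where "h = (\<lambda>L (\<eta> :: spinor) A' S. (if S = {} then \<eta> $ A' else 0) +
    background_trees S * node_sum om z zb L \<eta> S * (\<Sum>k\<in>S. kapt om zb k $ A'))"
  have H: "ncoeff (H_contr N om z zb L \<eta> A' X) S = h L \<eta> A' S * phase om z zb X S" if "S \<subseteq> U" for L \<eta> A' S
    unfolding h_def by (rule ncoeff_H_contr) (use that U in blast)
  have m: "ncoeff (H_contr N om z zb I \<xi> A' X * H_contr N om z zb J chi B' X) U =
     (\<Sum>S\<in>Pow U. h I \<xi> A' S * h J chi B' (U - S)) * phase om z zb X U" for A' B'
    by (rule ncoeff_mult_phase[OF phase_split[OF fin] H H])
  have "inj_on z (insert I (insert J U))" by (rule inj_on_subset[OF z]) (use U IJ in auto)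
  moreover have "I \<notin> U" "J \<notin> U" using U IJ by auto
  ultimately have "(\<Sum>S\<in>Pow U. h I \<xi> 1 S * h J chi 2 (U - S)) - (\<Sum>S\<in>Pow U. h I \<xi> 2 S * h J chi 1 (U - S)) =
      bracket_coeff \<xi> chi I J U"
    unfolding h_def by (rule sum_bracket_coeff[OF fin])
  then show ?thesis by (simp only: ncoeff_diff m left_diff_distrib[symmetric])
qed

text \<open>\<open>S\<close> collects the other nodes in the component of \<open>I\<close>,
  \<open>R\<close> is the middle tree, and the rest hangs at \<open>J\<close>. The factor
  \<open>z I - z J\<close> clears the denominator of the adjacent case and provides the prefactor of
  the other one, matching both parts of \<open>bracket_coeff\<close>.\<close>

lemma sum_tree_weight:
  assumes z: "inj_on z {1..N + 2}" and IJ: "I = N + 1" "J = N + 2"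
  shows "(z I - z J) * (\<Sum>E | is_tree {1..N + 2} E. tree_weight N (kap z) (kapt om zb) \<xi> chi E) =
    (\<Sum>S\<in>Pow {1..N}. background_trees (insert I S) *
      (\<Sum>R\<in>Pow ({1..N} - S). bracket_coeff \<xi> chi I J R * background_trees (insert J ({1..N} - S - R))))"
proof -
  let ?w = "edge_factor (kap z) (kapt om zb)"
  let ?W = "{1..N + 2}"
  define A where "A k = sqb \<xi> (kapt om zb k) / ang (kap z I) (kap z k)" for k
  define B where "B k = sqb chi (kapt om zb k) / ang (kap z J) (kap z k)" for k
  have AB: "node_sum om z zb I \<xi> S = sum A S" "node_sum om z zb J chi S = sum B S" for S
    by (simp_all add: node_sum_def A_def B_def)
  have IJW: "I \<in> ?W" "J \<in> ?W" "I \<noteq> J" using IJ by auto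
  have zIJ: "z I - z J \<noteq> 0" using inj_onD[OF z _ IJW(1,2)] IJW(3) by auto
  have W: "?W = insert I (insert J {1..N})" using IJ by auto
  have nIJ: "I \<notin> {1..N}" "J \<notin> {1..N}" using IJ by auto
  have "(\<Sum>E | is_tree ?W E. tree_weight N (kap z) (kapt om zb) \<xi> chi E) =
    (\<Sum>E | is_tree ?W E. let a = neighbour_towards E I J; b = neighbour_towards E J I in
      if {I, J} \<in> E then sqb \<xi> chi / (z I - z J) * (\<Prod>e\<in>E - {{I, J}}. ?w e)
      else A a * B b * (\<Prod>e\<in>E - {{I, a}, {J, b}}. ?w e))"
    unfolding tree_weight_def IJ[symmetric] Let_def adjacent_def A_def B_def
    by (simp only: ang_kap)
  also have "\<dots> = (\<Sum>V | V \<subseteq> ?W \<and> J \<in> V \<and> I \<notin> V. background_trees (?W - V) *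
      (sqb \<xi> chi / (z I - z J) * background_trees V + (\<Sum>R | R \<subseteq> V \<and> J \<notin> R. sum A R * sum B R * background_trees R * background_trees (V - R))))"
    by (rule sum_tree_two_marked[OF finite_atLeastAtMost IJW])
  also have "\<dots> = (\<Sum>S\<in>Pow {1..N}. background_trees (insert I S) *
      (sqb \<xi> chi / (z I - z J) * background_trees (insert J ({1..N} - S)) +
        (\<Sum>R\<in>Pow ({1..N} - S). sum A R * sum B R * background_trees R * background_trees (insert J ({1..N} - S - R)))))"
  \<comment> \<open>\<open>V\<close> is everything outside the component of \<open>I\<close>; it
    contains \<open>J\<close>, so it is determined by the nodes of \<open>{1..N}\<close> that it
    leaves to \<open>I\<close>.\<close>
  proof (rule sum.reindex_bij_witness[of _ "\<lambda>S. insert J ({1..N} - S)" "\<lambda>V. {1..N} - V"])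
    fix V assume "V \<in> {V. V \<subseteq> ?W \<and> J \<in> V \<and> I \<notin> V}"
    then have V: "V \<subseteq> insert I (insert J {1..N})" "J \<in> V" "I \<notin> V" unfolding W by blast+
    have 1: "insert J ({1..N} - ({1..N} - V)) = V" "?W - V = insert I ({1..N} - V)"
      unfolding W using V nIJ by blast+
    then show "insert J ({1..N} - ({1..N} - V)) = V" by blast
    show "{1..N} - V \<in> Pow {1..N}" by blast
    have VJ: "{1..N} - ({1..N} - V) = V - {J}" using V nIJ by blast
    have "{R. R \<subseteq> V \<and> J \<notin> R} = Pow ({1..N} - ({1..N} - V))" unfolding VJ by blast
    moreover have "V - R = insert J ({1..N} - ({1..N} - V) - R)" if "R \<in> Pow ({1..N} - ({1..N} - V))" for R
      using that V(2) unfolding VJ by blast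
    ultimately have "(\<Sum>R | R \<subseteq> V \<and> J \<notin> R. sum A R * sum B R * background_trees R * background_trees (V - R)) =
      (\<Sum>R\<in>Pow ({1..N} - ({1..N} - V)). sum A R * sum B R * background_trees R * background_trees (insert J ({1..N} - ({1..N} - V) - R)))"
      by (intro sum.cong) simp_all
    then show "background_trees (insert I ({1..N} - V)) *
      (sqb \<xi> chi / (z I - z J) * background_trees (insert J ({1..N} - ({1..N} - V))) +
        (\<Sum>R\<in>Pow ({1..N} - ({1..N} - V)). sum A R * sum B R * background_trees R * background_trees (insert J ({1..N} - ({1..N} - V) - R)))) =
      background_trees (?W - V) * (sqb \<xi> chi / (z I - z J) * background_trees V + (\<Sum>R | R \<subseteq> V \<and> J \<notin> R. sum A R * sum B R * background_trees R * background_trees (V - R)))"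
      by (simp only: 1)
  next
    fix S assume S: "S \<in> Pow {1..N}"
    then show "{1..N} - insert J ({1..N} - S) = S" using nIJ by blast
    show "insert J ({1..N} - S) \<in> {V. V \<subseteq> ?W \<and> J \<in> V \<and> I \<notin> V}" unfolding W using nIJ IJW by blast
  qed
  finally have 1: "(\<Sum>E | is_tree ?W E. tree_weight N (kap z) (kapt om zb) \<xi> chi E) = \<dots>" .
  have 2: "(z I - z J) * (t * (s / (z I - z J) * t' + r)) = t * (s * t' + (z I - z J) * r)" for t s t' r
    using zIJ by (simp add: field_simps)
  have 3: "(\<Sum>R\<in>Pow ({1..N} - S). bracket_coeff \<xi> chi I J R * background_trees (insert J ({1..N} - S - R))) =
     sqb \<xi> chi * background_trees (insert J ({1..N} - S)) +
        (z I - z J) * (\<Sum>R\<in>Pow ({1..N} - S). sum A R * sum B R * background_trees R * background_trees (insert J ({1..N} - S - R)))" for S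
  proof -
    have "(\<Sum>R\<in>Pow ({1..N} - S). bracket_coeff \<xi> chi I J R * background_trees (insert J ({1..N} - S - R))) =
      (\<Sum>R\<in>Pow ({1..N} - S). (if R = {} then sqb \<xi> chi * background_trees (insert J ({1..N} - S)) else 0) +
        (z I - z J) * (sum A R * sum B R * background_trees R * background_trees (insert J ({1..N} - S - R))))"
      by (intro sum.cong refl) (simp add: bracket_coeff_def AB)
    then show ?thesis by (simp add: sum.distrib sum_distrib_left)
  qed
  show ?thesis unfolding 1 3 sum_distrib_left[of "z I - z J" _ "Pow {1..N}"] 2 ..
qed

text \<open>The constants combine as follows: \<open>4 * \<i> * (z I - z J) ^ 3\<close> from the
  contraction, two factors \<open>- \<i> / 2\<close> from the connections and one more
  \<open>z I - z J\<close> from the tree sum give \<open>- \<i> * (z I - z J) ^ 4\<close>.\<close>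

lemma density_MHV_form:
  assumes z: "inj_on z {1..N + 2}"
  shows "ncoeff (density (MHV_form N om z zb \<xi> chi X)) {1..N + 2} =
    \<i> * MHV_formula N (kap z) (kapt om zb) (vector [0, 1]) (vector [0, 1]) \<xi> chi *
      exp (\<i> * pairing (\<Sum>i = 1..N + 2. momentum om z zb i) X)"
proof -
  define I J where IJ: "I = N + 1" "J = N + 2"
  let ?E = "\<lambda>L. nexp (nconst \<i> * F_scalar N om z zb L X)"
  let ?h = "H_contr N om z zb I \<xi> 1 X * H_contr N om z zb J chi 2 X -
       H_contr N om z zb I \<xi> 2 X * H_contr N om z zb J chi 1 X"
  let ?U = "{1..N}"
  let ?c = "\<lambda>L \<eta>. - \<i> / (2 * sqb \<eta> (kapt om zb L))"
  let ?c0 = "4 * \<i> * (z I - z J) ^ 3 * (?c I \<xi> * ?c J chi)"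
  have nI: "I \<notin> insert J ?U" "J \<notin> ?U" "I \<notin> ?U" and W: "{1..N + 2} = insert I (insert J ?U)" using IJ by auto
  \<comment> \<open>This bracketing makes the two successive convolutions reproduce the nested sum
    over \<open>S\<close> and \<open>R\<close> of the tree side.\<close>
  have dens: "density (MHV_form N om z zb \<xi> chi X) = eps I * (eps J * (nconst ?c0 * (?E I * (?h * ?E J))))"
    by (rule density_eqI) (simp only: MHV_form_eq[OF IJ] wave_factor_def nconst_mult mult_ac)
  have E: "ncoeff (?E L) S = phase om z zb X {L} * background_trees (insert L S) * phase om z zb X S" if "S \<subseteq> ?U" "L \<notin> ?U" for S L
    using ncoeff_exp_F[OF that] .
  have hE: "ncoeff (?h * ?E J) S = (\<Sum>R\<in>Pow S. bracket_coeff \<xi> chi I J R *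
      (phase om z zb X {J} * background_trees (insert J (S - R)))) * phase om z zb X S" if S: "S \<subseteq> ?U" for S
  proof (rule ncoeff_mult_phase)
    show "phase om z zb X R * phase om z zb X (S - R) = phase om z zb X S" if "R \<subseteq> S" for R
      by (rule phase_split[OF _ that]) (use S finite_subset in auto)
    show "ncoeff ?h R = bracket_coeff \<xi> chi I J R * phase om z zb X R" if "R \<subseteq> S" for R
      by (rule ncoeff_bracket[OF z IJ]) (use that S in blast)
    show "ncoeff (?E J) R = phase om z zb X {J} * background_trees (insert J R) * phase om z zb X R" if "R \<subseteq> S" for R
      by (rule E) (use that S nI in auto)
  qed
  have "ncoeff (?E I * (?h * ?E J)) ?U = (\<Sum>S\<in>Pow ?U. phase om z zb X {I} * background_trees (insert I S) *
      (\<Sum>R\<in>Pow (?U - S). bracket_coeff \<xi> chi I J R * (phase om z zb X {J} * background_trees (insert J (?U - S - R))))) *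
      phase om z zb X ?U"
    by (rule ncoeff_mult_phase[OF phase_split[OF finite_atLeastAtMost] E hE]) (use nI in auto)
  also have "\<dots> = (\<Sum>S\<in>Pow ?U. background_trees (insert I S) *
      (\<Sum>R\<in>Pow (?U - S). bracket_coeff \<xi> chi I J R * background_trees (insert J (?U - S - R)))) *
      (phase om z zb X {I} * (phase om z zb X {J} * phase om z zb X ?U))"
    unfolding sum_distrib_left sum_distrib_right by (simp only: mult_ac)
  also have "phase om z zb X {I} * (phase om z zb X {J} * phase om z zb X ?U) = phase om z zb X {1..N + 2}"
    unfolding W using phase_Un[of "{J}" ?U om z zb X] phase_Un[of "{I}" "insert J ?U" om z zb X] nI
    by (simp add: insert_commute[of J I])
  also have "(\<Sum>S\<in>Pow ?U. background_trees (insert I S) *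
      (\<Sum>R\<in>Pow (?U - S). bracket_coeff \<xi> chi I J R * background_trees (insert J (?U - S - R)))) =
      (z I - z J) * (\<Sum>E | is_tree {1..N + 2} E. tree_weight N (kap z) (kapt om zb) \<xi> chi E)"
    by (rule sum_tree_weight[OF z IJ, symmetric])
  finally have 1: "ncoeff (density (MHV_form N om z zb \<xi> chi X)) {1..N + 2} =
     ?c0 * ((z I - z J) * (\<Sum>E | is_tree {1..N + 2} E. tree_weight N (kap z) (kapt om zb) \<xi> chi E) *
       phase om z zb X {1..N + 2})"
    unfolding dens W using nI by (simp add: ncoeff_eps_mult ncoeff_nconst_mult)
  \<comment> \<open>The order of the arguments gives -1 here. These brackets occur in pairs, so
    every factor raised to a degree is 1 and the four in the prefactor multiply to 1.\<close>
  have "ang (kap z a) (vector [0, 1]) = -1" for a by (simp add: ang_eq kap_def)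
  then have 2: "MHV_formula N (kap z) (kapt om zb) (vector [0, 1]) (vector [0, 1]) \<xi> chi =
     - ((z I - z J) ^ 4 / (sqb \<xi> (kapt om zb I) * sqb chi (kapt om zb J))) *
     (\<Sum>E | is_tree {1..N + 2} E. tree_weight N (kap z) (kapt om zb) \<xi> chi E)"
    unfolding MHV_formula_def MHV_formula_with_def Let_def IJ[symmetric] by (simp add: ang_kap)
  have 3: "4 * \<i> * x ^ 3 * (- \<i> / (2 * a) * (- \<i> / (2 * b))) * (x * s * e) = \<i> * (- (x ^ 4 / (a * b)) * s) * e"
    for x a b s e :: complex
  \<comment> \<open>If a denominator vanishes, both sides are 0 by the convention for
    division.\<close>
  proof (cases "a = 0 \<or> b = 0")
    case False
    then have "- \<i> / (2 * a) * (- \<i> / (2 * b)) = - (1 / (4 * (a * b)))" by (simp add: field_simps)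
    moreover have "x ^ 4 = x ^ 3 * x" by (simp flip: power_Suc2)
    ultimately show ?thesis by simp
  qed auto
  show ?thesis unfolding 1 2 phase_def by (rule 3)
qed

end

section \<open>Integration over the coordinates\<close>

lemma scale_deltas_single: "scale_deltas c (Poly_Mapping.single P d) = Poly_Mapping.single P (c * d)"
  by (rule poly_mapping_eqI) (simp add: scale_deltas_def map.rep_eq lookup_single when_def)

lemma plane_wave_integral_scale:
  "plane_wave_integral (\<lambda>X. c * exp (\<i> * pairing P X)) = scale_deltas (c * (2 * of_real pi) ^ 4) (delta4 P)"
proof -
  have "(\<lambda>X. c * exp (\<i> * pairing P X)) = plane_wave_sum (Poly_Mapping.single P c)"
    by (simp add: fun_eq_iff plane_wave_sum_def)
  then show ?thesis
    by (simp only: plane_wave_integral_sum) (simp add: delta4_def scale_deltas_single mult.commute)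
qed

theorem mainTheorem3:
  fixes N :: nat and om z zb :: "nat \<Rightarrow> complex" and \<xi> chi \<iota> omicron :: spinor
  assumes "N \<ge> 1"
    and "\<forall>i\<in>{1..N + 2}. om i \<noteq> 0"
    and "inj_on z {1..N + 2}"
    and "sqb \<xi> (kapt om zb (N + 1)) \<noteq> 0"
    and "sqb chi (kapt om zb (N + 2)) \<noteq> 0"
    and "\<iota> = vector [0, 1]" and "omicron = vector [0, 1]"
  shows "(\<forall>i\<in>{1..N + 2}. ang \<iota> (kap z i) = 1 \<and> ang omicron (kap z i) = 1) \<and>
    MHV_amplitude N om z zb \<xi> chi =
      scale_deltas (\<i> * (2 * of_real pi) ^ 4 * MHV_formula N (kap z) (kapt om zb) \<iota> omicron \<xi> chi)
        (delta4 (\<Sum>i = 1..N + 2. momentum om z zb i)) \<and>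
    (\<forall>(lam :: nat \<Rightarrow> spinor) (lamt :: nat \<Rightarrow> spinor) (\<iota> :: spinor) (omicron :: spinor)
        (\<xi> :: spinor) (chi :: spinor).
      ((\<forall>a\<in>{1..N + 2} - {N + 1}. sqb (lamt (N + 1)) (lamt a) \<noteq> 0) \<and>
       (\<forall>b\<in>{1..N + 2} - {N + 2}. sqb (lamt (N + 2)) (lamt b) \<noteq> 0) \<longrightarrow>
         MHV_formula N lam lamt \<iota> omicron \<xi> chi = MHV_formula_K N lam lamt \<iota> omicron \<xi> chi) \<and>
      (\<forall>t :: complex. t \<noteq> 0 \<longrightarrow>
        (\<forall>i\<in>{1..N + 2}.
          MHV_formula N (lam(i := t *s lam i)) (lamt(i := inverse t *s lamt i)) \<iota> omicron \<xi> chi =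
            t powi (if i \<in> {N + 1, N + 2} then 4 else -4) * MHV_formula N lam lamt \<iota> omicron \<xi> chi) \<and>
        MHV_formula N lam lamt (t *s \<iota>) omicron \<xi> chi = MHV_formula N lam lamt \<iota> omicron \<xi> chi \<and>
        MHV_formula N lam lamt \<iota> (t *s omicron) \<xi> chi = MHV_formula N lam lamt \<iota> omicron \<xi> chi \<and>
        MHV_formula N lam lamt \<iota> omicron (t *s \<xi>) chi = MHV_formula N lam lamt \<iota> omicron \<xi> chi \<and>
        MHV_formula N lam lamt \<iota> omicron \<xi> (t *s chi) = MHV_formula N lam lamt \<iota> omicron \<xi> chi))"
proof (intro conjI ballI allI impI)
  show "ang \<iota> (kap z i) = 1" "ang omicron (kap z i) = 1" for i
    using assms(6,7) by (simp_all add: ang_eq kap_def)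
  \<comment> \<open>Differentiating by all parameters and then setting them to zero reads off the
    top coefficient; the upper bound of the list is exclusive, hence \<open>N + 3\<close>.\<close>
  have "{} \<union> set [1..<N + 3] = {1..N + 2}" by auto
  then have "MHV_amplitude N om z zb \<xi> chi = ncoeff (form_integral (MHV_form N om z zb \<xi> chi)) {1..N + 2}"
    unfolding MHV_amplitude_def by (simp only: ncoeff_foldr_neps_deriv distinct_upt Int_empty_left)
  also have "\<dots> = plane_wave_integral (\<lambda>X. ncoeff (density (MHV_form N om z zb \<xi> chi X)) {1..N + 2})"
    by (rule ncoeff_form_integral[OF finite_atLeastAtMost])
  also have "\<dots> = scale_deltas (\<i> * MHV_formula N (kap z) (kapt om zb) \<iota> omicron \<xi> chi * (2 * of_real pi) ^ 4)
        (delta4 (\<Sum>i = 1..N + 2. momentum om z zb i))"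
    unfolding density_MHV_form[OF assms(3)] assms(6,7) by (rule plane_wave_integral_scale)
  also have "\<i> * MHV_formula N (kap z) (kapt om zb) \<iota> omicron \<xi> chi * (2 * of_real pi) ^ 4 =
      \<i> * (2 * of_real pi) ^ 4 * MHV_formula N (kap z) (kapt om zb) \<iota> omicron \<xi> chi"
    by (simp only: mult_ac)
  finally show "MHV_amplitude N om z zb \<xi> chi =
      scale_deltas (\<i> * (2 * of_real pi) ^ 4 * MHV_formula N (kap z) (kapt om zb) \<iota> omicron \<xi> chi)
        (delta4 (\<Sum>i = 1..N + 2. momentum om z zb i))" .
next
  fix lam lamt :: "nat \<Rightarrow> spinor" and \<iota> omicron \<xi> chi :: spinor
  assume "(\<forall>a\<in>{1..N + 2} - {N + 1}. sqb (lamt (N + 1)) (lamt a) \<noteq> 0) \<and>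
       (\<forall>b\<in>{1..N + 2} - {N + 2}. sqb (lamt (N + 2)) (lamt b) \<noteq> 0)"
  then show "MHV_formula N lam lamt \<iota> omicron \<xi> chi = MHV_formula_K N lam lamt \<iota> omicron \<xi> chi"
    by (intro MHV_formula_eq_K) blast+
qed (rule MHV_formula_little_group MHV_formula_reference_scale; assumption)+

end
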